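(* Let $(M,g)$ be a pseudo-Riemannian manifold, let $\nabla$ be a linear connection on $M$, let $J$ be an arbitrary $g$-symmetric endomorphism of the tangent bundle $TM$, and let $p,q$ be any real numbers. Let $\check J$ and $\check g$ be the endomorphism and the metric on $TM\oplus T^*M$ determined by $(J,g)$ and $p,q$ as in the context, and let $\Phi^\nabla:TM\oplus T^*M\to T(T^*M)$ be the isomorphism determined by $\nabla$. Define $\tilde J:T(T^*M)\to T(T^*M)$ and $\tilde g$ on the manifold $T^*M$ by $$\tilde J:=\Phi^\nabla\circ\check J\circ(\Phi^\nabla)^{-1},\qquad \tilde g:=\big((\Phi^\nabla)^{-1}\big)^*(\check g).$$ Then $(T^*M,\tilde J,\tilde g)$ is a metallic pseudo-Riemannian manifold.
   Context: A metallic pseudo-Riemannian manifold $(N,F,h)$ is a pseudo-Riemannian manifold $(N,h)$ with a $(1,1)$-tensor field $F$ such that $h(FX,Y)=h(X,FY)$ for all vector fields $X,Y$ and $F^2=pF+qI$ for some real numbers $p,q$. An endomorphism $J$ of $TM$ is $g$-symmetric if $g(JX,Y)=g(X,JY)$ for all $X,Y$. Let $\flat_g:TM\to T^*M$, $\flat_g(X)=g(X,\cdot)$, $\sharp_g:=\flat_g^{-1}$, and $(J^*\alpha)(X):=\alpha(JX)$. For vector fields $X,Y$ and 1-forms $\alpha,\beta$ on $M$ define $$\check J(X+\alpha):=JX+(-J^2+pJ+qI)(\sharp_g\alpha)+\flat_g(X)-J^*\alpha+p\alpha,$$ $$\check g(X+\alpha,Y+\beta):=g(X,Y)+\frac{p^2+4q}{4}g(\sharp_g\alpha,\sharp_g\beta)+\frac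 p4\big(\alpha(Y)+\beta(X)\big)-\frac12\big(\alpha(JY)+\beta(JX)\big).$$ Let $\pi:T^*M\to M$ be the projection. The connection $\nabla$ gives the splitting $T(T^*M)=T^H(T^*M)\oplus T^V(T^*M)$ into horizontal and vertical subbundles. For $a\in T^*M$, let $X^H_a\in T_a(T^*M)$ be the horizontal lift of $X\in T_{\pi(a)}M$ and let $\chi_a$ be the standard identification of $T^*_{\pi(a)}M$ with its tangent space $T_a(T^*_{\pi(a)}M)$. The bundle morphism $\Phi^\nabla$ is given at each $a\in T^*M$ by the linear isomorphism $T_{\pi(a)}M\oplus T^*_{\pi(a)}M\to T_a(T^*M)$, $\Phi^\nabla(X+\alpha):=X^H_a+\chi_a(\alpha)$; the formulas for $\tilde J,\tilde g$ are understood pointwise at each $a\in T^*M$ via this isomorphism.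
   Formalization: The formal statement adds that ǧ is nondegenerate at every point; for arbitrary J, p, q the claim fails (J=0, p=q=0 gives ǧ(X+α,Y+β)=g(X,Y), which is degenerate). Manifolds of dimension 0 are excluded. *)

theory Defs
  imports "HOL-Analysis.Analysis" "HOL-Library.Function_Algebras"
begin

instantiation "fun" :: (type, real_vector) real_vector
begin

definition "scaleR r f = (\<lambda>x. r *\<^sub>R f x)"

instance
  by standard (simp_all add: scaleR_fun_def fun_eq_iff scaleR_add_right scaleR_add_left)

end

lemma scaleR_fun_apply [simp]: "(r *\<^sub>R f) x = r *\<^sub>R f x"
  by (simp add: scaleR_fun_def)


section \<open>Smooth manifolds\<close>

text \<open>
  \<open>Ck_on k f S\<close> is only used for open \<open>S\<close> in a Euclidean space, where it says that \<open>f\<close> is of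
  class $C^k$ on \<open>S\<close>; the derivatives are taken in the ambient space.
\<close>

primrec Ck_on :: "nat \<Rightarrow> ('a::real_normed_vector \<Rightarrow> 'b::real_normed_vector) \<Rightarrow> 'a set \<Rightarrow> bool" where
  "Ck_on 0 f S \<longleftrightarrow> continuous_on S f"
| "Ck_on (Suc k) f S \<longleftrightarrow>
     (\<forall>x\<in>S. f differentiable (at x)) \<and> (\<forall>v. Ck_on k (\<lambda>x. frechet_derivative f (at x) v) S)"

definition smooth_on :: "('a::real_normed_vector \<Rightarrow> 'b::real_normed_vector) \<Rightarrow> 'a set \<Rightarrow> bool" where
  "smooth_on f S \<longleftrightarrow> (\<forall>k. Ck_on k f S)"

text \<open>
  A manifold modelled on the Euclidean space \<open>'e\<close> is given by an indexed atlas
  \<open>(patch i, chart i)\<close>, \<open>i \<in> indices\<close>. Its underlying set is the union of the patches (the values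
  of \<open>chart i\<close> outside \<open>patch i\<close> are irrelevant), and its topology is the one for which all charts
  are homeomorphisms between open sets.
\<close>

record ('i, 'm, 'e) manifold =
  indices :: "'i set"
  patch :: "'i \<Rightarrow> 'm set"
  chart :: "'i \<Rightarrow> 'm \<Rightarrow> 'e"

definition points :: "('i, 'm, 'e) manifold \<Rightarrow> 'm set" where
  "points M = (\<Union>i\<in>indices M. patch M i)"

definition charts_at :: "('i, 'm, 'e) manifold \<Rightarrow> 'm \<Rightarrow> 'i set" where
  "charts_at M x = {i \<in> indices M. x \<in> patch M i}"

definition image_of :: "('i, 'm, 'e) manifold \<Rightarrow> 'i \<Rightarrow> 'e set" where
  "image_of M i = chart M i ` patch M i"

definition param :: "('i, 'm, 'e) manifold \<Rightarrow> 'i \<Rightarrow> 'e \<Rightarrow> 'm" where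
  "param M i = inv_into (patch M i) (chart M i)"

definition transition :: "('i, 'm, 'e) manifold \<Rightarrow> 'i \<Rightarrow> 'i \<Rightarrow> 'e \<Rightarrow> 'e" where
  "transition M i j = chart M j \<circ> param M i"

definition manifold_topology :: "('i, 'm, 'e::topological_space) manifold \<Rightarrow> 'm topology" where
  "manifold_topology M =
     topology (\<lambda>W. W \<subseteq> points M \<and> (\<forall>i\<in>indices M. open (chart M i ` (W \<inter> patch M i))))"

definition smooth_manifold :: "('i, 'm, 'e::euclidean_space) manifold \<Rightarrow> bool" where
  "smooth_manifold M \<longleftrightarrow>
     (\<forall>i\<in>indices M. inj_on (chart M i) (patch M i) \<and>
        (\<forall>j\<in>indices M. open (chart M i ` (patch M i \<inter> patch M j)) \<and>
           smooth_on (transition M i j) (chart M i ` (patch M i \<inter> patch M j)))) \<and>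
     Hausdorff_space (manifold_topology M) \<and>
     second_countable (manifold_topology M)"

text \<open>
  A tangent vector at \<open>x\<close> is the family of its components in the charts around \<open>x\<close>, which
  transform by the Jacobian of the transition maps; components at all other indices are set to 0,
  so that the tangent space is a linear subspace of \<open>'i \<Rightarrow> 'e\<close>.
\<close>

definition tangent_space :: "('i, 'm, 'e::euclidean_space) manifold \<Rightarrow> 'm \<Rightarrow> ('i \<Rightarrow> 'e) set" where
  "tangent_space M x =
     {v. (\<forall>i\<in>charts_at M x. \<forall>j\<in>charts_at M x.
            v j = frechet_derivative (transition M i j) (at (chart M i x)) (v i)) \<and>
         (\<forall>i. i \<notin> charts_at M x \<longrightarrow> v i = 0)}"

text \<open>The tangent vector at \<open>x\<close> whose component in the chart \<open>i\<close> is \<open>u\<close>.\<close>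

definition coord_vector ::
  "('i, 'm, 'e::euclidean_space) manifold \<Rightarrow> 'i \<Rightarrow> 'm \<Rightarrow> 'e \<Rightarrow> 'i \<Rightarrow> 'e" where
  "coord_vector M i x u =
     (\<lambda>j. if j \<in> charts_at M x
          then frechet_derivative (transition M i j) (at (chart M i x)) u else 0)"

text \<open>
  In \<open>deriv_along\<close> and \<open>pushforward\<close> the result does not depend on the chart chosen at the foot
  point.
\<close>

definition deriv_along ::
  "('i, 'm, 'e::euclidean_space) manifold \<Rightarrow> 'm \<Rightarrow> ('i \<Rightarrow> 'e) \<Rightarrow> ('m \<Rightarrow> real) \<Rightarrow> real" where
  "deriv_along M x v f =
     (let i = (SOME i. i \<in> charts_at M x)
      in frechet_derivative (f \<circ> param M i) (at (chart M i x)) (v i))"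

definition pushforward ::
  "('i, 'm, 'e::euclidean_space) manifold \<Rightarrow> ('j, 'n, 'f::euclidean_space) manifold \<Rightarrow>
   ('m \<Rightarrow> 'n) \<Rightarrow> 'm \<Rightarrow> ('i \<Rightarrow> 'e) \<Rightarrow> 'j \<Rightarrow> 'f" where
  "pushforward M N f x v =
     (\<lambda>j. if j \<in> charts_at N (f x)
          then let i = (SOME i. i \<in> charts_at M x)
               in frechet_derivative (chart N j \<circ> f \<circ> param M i) (at (chart M i x)) (v i)
          else 0)"

definition velocity ::
  "('i, 'm, 'e::euclidean_space) manifold \<Rightarrow> (real \<Rightarrow> 'm) \<Rightarrow> real \<Rightarrow> 'i \<Rightarrow> 'e" where
  "velocity M c t =
     (\<lambda>i. if i \<in> charts_at M (c t) then vector_derivative (chart M i \<circ> c) (at t) else 0)"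

definition smooth_functions :: "('i, 'm, 'e::euclidean_space) manifold \<Rightarrow> ('m \<Rightarrow> real) set" where
  "smooth_functions M = {f. \<forall>i\<in>indices M. smooth_on (f \<circ> param M i) (image_of M i)}"

text \<open>Vector fields vanish off the manifold, so that equal fields are equal as functions.\<close>

definition vector_fields ::
  "('i, 'm, 'e::euclidean_space) manifold \<Rightarrow> ('m \<Rightarrow> 'i \<Rightarrow> 'e) set" where
  "vector_fields M =
     {X. (\<forall>x\<in>points M. X x \<in> tangent_space M x) \<and>
         (\<forall>x. x \<notin> points M \<longrightarrow> X x = 0) \<and>
         (\<forall>i\<in>indices M. smooth_on (\<lambda>y. X (param M i y) i) (image_of M i))}"


section \<open>Metallic pseudo-Riemannian manifolds\<close>

definition linear_on :: "'a::real_vector set \<Rightarrow> ('a \<Rightarrow> 'b::real_vector) \<Rightarrow> bool" where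
  "linear_on V f \<longleftrightarrow>
     (\<forall>u\<in>V. \<forall>v\<in>V. f (u + v) = f u + f v) \<and> (\<forall>r. \<forall>u\<in>V. f (r *\<^sub>R u) = r *\<^sub>R f u)"

definition nondegenerate_on :: "'a::real_vector set \<Rightarrow> ('a \<Rightarrow> 'a \<Rightarrow> real) \<Rightarrow> bool" where
  "nondegenerate_on V b \<longleftrightarrow> (\<forall>u\<in>V. (\<forall>v\<in>V. b u v = 0) \<longrightarrow> u = 0)"

text \<open>Tensor fields are smooth if their components in the coordinate frames are.\<close>

definition pseudo_riemannian_metric ::
  "('i, 'm, 'e::euclidean_space) manifold \<Rightarrow> ('m \<Rightarrow> ('i \<Rightarrow> 'e) \<Rightarrow> ('i \<Rightarrow> 'e) \<Rightarrow> real) \<Rightarrow> bool" where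
  "pseudo_riemannian_metric M g \<longleftrightarrow>
     (\<forall>x\<in>points M.
        (\<forall>u\<in>tangent_space M x. linear_on (tangent_space M x) (g x u)) \<and>
        (\<forall>u\<in>tangent_space M x. \<forall>v\<in>tangent_space M x. g x u v = g x v u) \<and>
        nondegenerate_on (tangent_space M x) (g x)) \<and>
     (\<forall>i\<in>indices M. \<forall>u w.
        smooth_on (\<lambda>y. g (param M i y) (coord_vector M i (param M i y) u)
                                       (coord_vector M i (param M i y) w)) (image_of M i))"

definition endomorphism_field ::
  "('i, 'm, 'e::euclidean_space) manifold \<Rightarrow> ('m \<Rightarrow> ('i \<Rightarrow> 'e) \<Rightarrow> 'i \<Rightarrow> 'e) \<Rightarrow> bool" where
  "endomorphism_field M F \<longleftrightarrow>
     (\<forall>x\<in>points M. F x ` tangent_space M x \<subseteq> tangent_space M x \<and>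
        linear_on (tangent_space M x) (F x)) \<and>
     (\<forall>i\<in>indices M. \<forall>u.
        smooth_on (\<lambda>y. F (param M i y) (coord_vector M i (param M i y) u) i) (image_of M i))"

definition metric_symmetric ::
  "('i, 'm, 'e::euclidean_space) manifold \<Rightarrow> ('m \<Rightarrow> ('i \<Rightarrow> 'e) \<Rightarrow> ('i \<Rightarrow> 'e) \<Rightarrow> real) \<Rightarrow>
   ('m \<Rightarrow> ('i \<Rightarrow> 'e) \<Rightarrow> 'i \<Rightarrow> 'e) \<Rightarrow> bool" where
  "metric_symmetric M g F \<longleftrightarrow>
     (\<forall>x\<in>points M. \<forall>u\<in>tangent_space M x. \<forall>v\<in>tangent_space M x. g x (F x u) v = g x u (F x v))"

definition metallic_pseudo_riemannian_manifold ::
  "('i, 'm, 'e::euclidean_space) manifold \<Rightarrow> ('m \<Rightarrow> ('i \<Rightarrow> 'e) \<Rightarrow> 'i \<Rightarrow> 'e) \<Rightarrow>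
   ('m \<Rightarrow> ('i \<Rightarrow> 'e) \<Rightarrow> ('i \<Rightarrow> 'e) \<Rightarrow> real) \<Rightarrow> bool" where
  "metallic_pseudo_riemannian_manifold N F h \<longleftrightarrow>
     smooth_manifold N \<and> pseudo_riemannian_metric N h \<and> endomorphism_field N F \<and>
     metric_symmetric N h F \<and>
     (\<exists>p q. \<forall>x\<in>points N. \<forall>v\<in>tangent_space N x. F x (F x v) = p *\<^sub>R F x v + q *\<^sub>R v)"

text \<open>Additivity and the Leibniz rule for constant \<open>f\<close> make \<open>D X\<close> linear over the reals.\<close>

definition linear_connection ::
  "('i, 'm, 'e::euclidean_space) manifold \<Rightarrow>
   (('m \<Rightarrow> 'i \<Rightarrow> 'e) \<Rightarrow> ('m \<Rightarrow> 'i \<Rightarrow> 'e) \<Rightarrow> 'm \<Rightarrow> 'i \<Rightarrow> 'e) \<Rightarrow> bool" where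
  "linear_connection M D \<longleftrightarrow>
     (\<forall>X\<in>vector_fields M. \<forall>Y\<in>vector_fields M. D X Y \<in> vector_fields M) \<and>
     (\<forall>X\<in>vector_fields M. \<forall>X'\<in>vector_fields M. \<forall>Y\<in>vector_fields M.
        D (X + X') Y = D X Y + D X' Y \<and> D Y (X + X') = D Y X + D Y X') \<and>
     (\<forall>f\<in>smooth_functions M. \<forall>X\<in>vector_fields M. \<forall>Y\<in>vector_fields M.
        D (\<lambda>x. f x *\<^sub>R X x) Y = (\<lambda>x. f x *\<^sub>R D X Y x) \<and>
        D X (\<lambda>x. f x *\<^sub>R Y x) = (\<lambda>x. deriv_along M x (X x) f *\<^sub>R Y x + f x *\<^sub>R D X Y x))"


section \<open>The cotangent bundle and the bundle morphism defined by a connection\<close>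

text \<open>Covectors vanish off the tangent space, so that they form a vector space.\<close>

definition cotangent_space ::
  "('i, 'm, 'e::euclidean_space) manifold \<Rightarrow> 'm \<Rightarrow> (('i \<Rightarrow> 'e) \<Rightarrow> real) set" where
  "cotangent_space M x =
     {\<alpha>. linear_on (tangent_space M x) \<alpha> \<and> (\<forall>v. v \<notin> tangent_space M x \<longrightarrow> \<alpha> v = 0)}"

text \<open>The components of a covector are collected in an element of \<open>'e\<close> via the basis of \<open>'e\<close>.\<close>

definition covector_coords ::
  "('i, 'm, 'e::euclidean_space) manifold \<Rightarrow> 'i \<Rightarrow> 'm \<Rightarrow> (('i \<Rightarrow> 'e) \<Rightarrow> real) \<Rightarrow> 'e" where
  "covector_coords M i x \<alpha> = (\<Sum>b\<in>Basis. \<alpha> (coord_vector M i x b) *\<^sub>R b)"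

definition cotangent_bundle ::
  "('i, 'm, 'e::euclidean_space) manifold \<Rightarrow>
   ('i, 'm \<times> (('i \<Rightarrow> 'e) \<Rightarrow> real), 'e \<times> 'e) manifold" where
  "cotangent_bundle M =
     \<lparr>indices = indices M,
      patch = (\<lambda>i. SIGMA x:patch M i. cotangent_space M x),
      chart = (\<lambda>i (x, \<alpha>). (chart M i x, covector_coords M i x \<alpha>))\<rparr>"

text \<open>
  The horizontal vectors at \<open>a = (x, \<alpha>)\<close> are the velocities of the parallel curves of covectors
  through \<open>a\<close>. If \<open>\<alpha>\<^sub>t\<close> is parallel over a curve \<open>\<gamma>\<close>, then \<open>\<alpha>\<^sub>t(Y)\<close> has derivative
  $\alpha_t(\nabla_{\gamma'} Y)$ for every vector field \<open>Y\<close>; so horizontality of \<open>w\<close> says that the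
  derivative along \<open>w\<close> of the function \<open>(y, \<beta>) \<mapsto> \<beta>(Y y)\<close> is $\alpha(\nabla_{\pi_* w} Y)$.
  In canonical coordinates $(x^i, p_i)$ the horizontal lift of $\partial_i$ is
  $\partial/\partial x^i + \Gamma_{ij}^k p_k\, \partial/\partial p_j$.
\<close>

definition horizontal_space ::
  "('i, 'm, 'e::euclidean_space) manifold \<Rightarrow>
   (('m \<Rightarrow> 'i \<Rightarrow> 'e) \<Rightarrow> ('m \<Rightarrow> 'i \<Rightarrow> 'e) \<Rightarrow> 'm \<Rightarrow> 'i \<Rightarrow> 'e) \<Rightarrow>
   'm \<times> (('i \<Rightarrow> 'e) \<Rightarrow> real) \<Rightarrow> ('i \<Rightarrow> 'e \<times> 'e) set" where
  "horizontal_space M D a =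
     {w \<in> tangent_space (cotangent_bundle M) a.
        \<forall>X\<in>vector_fields M. \<forall>Y\<in>vector_fields M.
          X (fst a) = pushforward (cotangent_bundle M) M fst a w \<longrightarrow>
          deriv_along (cotangent_bundle M) a w (\<lambda>(y, \<beta>). \<beta> (Y y)) = snd a (D X Y (fst a))}"

definition horizontal_lift ::
  "('i, 'm, 'e::euclidean_space) manifold \<Rightarrow>
   (('m \<Rightarrow> 'i \<Rightarrow> 'e) \<Rightarrow> ('m \<Rightarrow> 'i \<Rightarrow> 'e) \<Rightarrow> 'm \<Rightarrow> 'i \<Rightarrow> 'e) \<Rightarrow>
   'm \<times> (('i \<Rightarrow> 'e) \<Rightarrow> real) \<Rightarrow> ('i \<Rightarrow> 'e) \<Rightarrow> 'i \<Rightarrow> 'e \<times> 'e" where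
  "horizontal_lift M D a v =
     (THE w. w \<in> horizontal_space M D a \<and> pushforward (cotangent_bundle M) M fst a w = v)"

definition vertical_lift ::
  "('i, 'm, 'e::euclidean_space) manifold \<Rightarrow> 'm \<times> (('i \<Rightarrow> 'e) \<Rightarrow> real) \<Rightarrow>
   (('i \<Rightarrow> 'e) \<Rightarrow> real) \<Rightarrow> 'i \<Rightarrow> 'e \<times> 'e" where
  "vertical_lift M a \<beta> = velocity (cotangent_bundle M) (\<lambda>t. (fst a, snd a + t *\<^sub>R \<beta>)) 0"

text \<open>An element \<open>X + \<alpha>\<close> of the fibre of $TM \oplus T^*M$ is the pair \<open>(X, \<alpha>)\<close>.\<close>

definition gen_tangent_space ::
  "('i, 'm, 'e::euclidean_space) manifold \<Rightarrow> 'm \<Rightarrow> (('i \<Rightarrow> 'e) \<times> (('i \<Rightarrow> 'e) \<Rightarrow> real)) set" where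
  "gen_tangent_space M x = tangent_space M x \<times> cotangent_space M x"

definition Phi ::
  "('i, 'm, 'e::euclidean_space) manifold \<Rightarrow>
   (('m \<Rightarrow> 'i \<Rightarrow> 'e) \<Rightarrow> ('m \<Rightarrow> 'i \<Rightarrow> 'e) \<Rightarrow> 'm \<Rightarrow> 'i \<Rightarrow> 'e) \<Rightarrow>
   'm \<times> (('i \<Rightarrow> 'e) \<Rightarrow> real) \<Rightarrow> ('i \<Rightarrow> 'e) \<times> (('i \<Rightarrow> 'e) \<Rightarrow> real) \<Rightarrow> 'i \<Rightarrow> 'e \<times> 'e" where
  "Phi M D a = (\<lambda>(X, \<alpha>). horizontal_lift M D a X + vertical_lift M a \<alpha>)"

definition Phi_inv ::
  "('i, 'm, 'e::euclidean_space) manifold \<Rightarrow>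
   (('m \<Rightarrow> 'i \<Rightarrow> 'e) \<Rightarrow> ('m \<Rightarrow> 'i \<Rightarrow> 'e) \<Rightarrow> 'm \<Rightarrow> 'i \<Rightarrow> 'e) \<Rightarrow>
   'm \<times> (('i \<Rightarrow> 'e) \<Rightarrow> real) \<Rightarrow> ('i \<Rightarrow> 'e \<times> 'e) \<Rightarrow> ('i \<Rightarrow> 'e) \<times> (('i \<Rightarrow> 'e) \<Rightarrow> real)" where
  "Phi_inv M D a = inv_into (gen_tangent_space M (fst a)) (Phi M D a)"


section \<open>The induced structures\<close>

definition flat ::
  "('i, 'm, 'e::euclidean_space) manifold \<Rightarrow> ('m \<Rightarrow> ('i \<Rightarrow> 'e) \<Rightarrow> ('i \<Rightarrow> 'e) \<Rightarrow> real) \<Rightarrow>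
   'm \<Rightarrow> ('i \<Rightarrow> 'e) \<Rightarrow> ('i \<Rightarrow> 'e) \<Rightarrow> real" where
  "flat M g x X = (\<lambda>v. if v \<in> tangent_space M x then g x X v else 0)"

definition sharp ::
  "('i, 'm, 'e::euclidean_space) manifold \<Rightarrow> ('m \<Rightarrow> ('i \<Rightarrow> 'e) \<Rightarrow> ('i \<Rightarrow> 'e) \<Rightarrow> real) \<Rightarrow>
   'm \<Rightarrow> (('i \<Rightarrow> 'e) \<Rightarrow> real) \<Rightarrow> 'i \<Rightarrow> 'e" where
  "sharp M g x = inv_into (tangent_space M x) (flat M g x)"

definition dual_endo ::
  "('i, 'm, 'e::euclidean_space) manifold \<Rightarrow> ('m \<Rightarrow> ('i \<Rightarrow> 'e) \<Rightarrow> 'i \<Rightarrow> 'e) \<Rightarrow>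
   'm \<Rightarrow> (('i \<Rightarrow> 'e) \<Rightarrow> real) \<Rightarrow> ('i \<Rightarrow> 'e) \<Rightarrow> real" where
  "dual_endo M J x \<alpha> = (\<lambda>v. if v \<in> tangent_space M x then \<alpha> (J x v) else 0)"

definition check_J ::
  "('i, 'm, 'e::euclidean_space) manifold \<Rightarrow> ('m \<Rightarrow> ('i \<Rightarrow> 'e) \<Rightarrow> ('i \<Rightarrow> 'e) \<Rightarrow> real) \<Rightarrow>
   ('m \<Rightarrow> ('i \<Rightarrow> 'e) \<Rightarrow> 'i \<Rightarrow> 'e) \<Rightarrow> real \<Rightarrow> real \<Rightarrow> 'm \<Rightarrow>
   ('i \<Rightarrow> 'e) \<times> (('i \<Rightarrow> 'e) \<Rightarrow> real) \<Rightarrow> ('i \<Rightarrow> 'e) \<times> (('i \<Rightarrow> 'e) \<Rightarrow> real)" where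
  "check_J M g J p q x = (\<lambda>(X, \<alpha>).
     let Z = sharp M g x \<alpha>
     in (J x X + (- J x (J x Z) + p *\<^sub>R J x Z + q *\<^sub>R Z),
         flat M g x X - dual_endo M J x \<alpha> + p *\<^sub>R \<alpha>))"

definition check_g ::
  "('i, 'm, 'e::euclidean_space) manifold \<Rightarrow> ('m \<Rightarrow> ('i \<Rightarrow> 'e) \<Rightarrow> ('i \<Rightarrow> 'e) \<Rightarrow> real) \<Rightarrow>
   ('m \<Rightarrow> ('i \<Rightarrow> 'e) \<Rightarrow> 'i \<Rightarrow> 'e) \<Rightarrow> real \<Rightarrow> real \<Rightarrow> 'm \<Rightarrow>
   ('i \<Rightarrow> 'e) \<times> (('i \<Rightarrow> 'e) \<Rightarrow> real) \<Rightarrow> ('i \<Rightarrow> 'e) \<times> (('i \<Rightarrow> 'e) \<Rightarrow> real) \<Rightarrow> real" where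
  "check_g M g J p q x = (\<lambda>(X, \<alpha>) (Y, \<beta>).
     g x X Y + (p\<^sup>2 + 4 * q) / 4 * g x (sharp M g x \<alpha>) (sharp M g x \<beta>)
     + p / 4 * (\<alpha> Y + \<beta> X) - 1 / 2 * (\<alpha> (J x Y) + \<beta> (J x X)))"

text \<open>
  \<open>check_g\<close> is always bilinear and symmetric, but not always nondegenerate: for \<open>p = q = 0\<close> and
  \<open>J = 0\<close> it is the pullback of \<open>g\<close> along the projection $TM \oplus T^*M \to TM$. Being a metric
  on $TM \oplus T^*M$ is thus a condition on \<open>(g, J, p, q)\<close>; it amounts to the invertibility of
  $\frac{3p^2 + 16q}{4} I + pJ - J^2$ at every point.
\<close>

definition is_metric_check_g ::
  "('i, 'm, 'e::euclidean_space) manifold \<Rightarrow> ('m \<Rightarrow> ('i \<Rightarrow> 'e) \<Rightarrow> ('i \<Rightarrow> 'e) \<Rightarrow> real) \<Rightarrow>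
   ('m \<Rightarrow> ('i \<Rightarrow> 'e) \<Rightarrow> 'i \<Rightarrow> 'e) \<Rightarrow> real \<Rightarrow> real \<Rightarrow> bool" where
  "is_metric_check_g M g J p q \<longleftrightarrow>
     (\<forall>x\<in>points M. nondegenerate_on (gen_tangent_space M x) (check_g M g J p q x))"

definition tilde_J ::
  "('i, 'm, 'e::euclidean_space) manifold \<Rightarrow> ('m \<Rightarrow> ('i \<Rightarrow> 'e) \<Rightarrow> ('i \<Rightarrow> 'e) \<Rightarrow> real) \<Rightarrow>
   (('m \<Rightarrow> 'i \<Rightarrow> 'e) \<Rightarrow> ('m \<Rightarrow> 'i \<Rightarrow> 'e) \<Rightarrow> 'm \<Rightarrow> 'i \<Rightarrow> 'e) \<Rightarrow>
   ('m \<Rightarrow> ('i \<Rightarrow> 'e) \<Rightarrow> 'i \<Rightarrow> 'e) \<Rightarrow> real \<Rightarrow> real \<Rightarrow>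
   'm \<times> (('i \<Rightarrow> 'e) \<Rightarrow> real) \<Rightarrow> ('i \<Rightarrow> 'e \<times> 'e) \<Rightarrow> 'i \<Rightarrow> 'e \<times> 'e" where
  "tilde_J M g D J p q a = Phi M D a \<circ> check_J M g J p q (fst a) \<circ> Phi_inv M D a"

definition tilde_g ::
  "('i, 'm, 'e::euclidean_space) manifold \<Rightarrow> ('m \<Rightarrow> ('i \<Rightarrow> 'e) \<Rightarrow> ('i \<Rightarrow> 'e) \<Rightarrow> real) \<Rightarrow>
   (('m \<Rightarrow> 'i \<Rightarrow> 'e) \<Rightarrow> ('m \<Rightarrow> 'i \<Rightarrow> 'e) \<Rightarrow> 'm \<Rightarrow> 'i \<Rightarrow> 'e) \<Rightarrow>
   ('m \<Rightarrow> ('i \<Rightarrow> 'e) \<Rightarrow> 'i \<Rightarrow> 'e) \<Rightarrow> real \<Rightarrow> real \<Rightarrow>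
   'm \<times> (('i \<Rightarrow> 'e) \<Rightarrow> real) \<Rightarrow> ('i \<Rightarrow> 'e \<times> 'e) \<Rightarrow> ('i \<Rightarrow> 'e \<times> 'e) \<Rightarrow> real" where
  "tilde_g M g D J p q a U V =
     check_g M g J p q (fst a) (Phi_inv M D a U) (Phi_inv M D a V)"

end

theory Submission
  imports Defs
begin

text \<open>
  The musical isomorphism turns \<open>TM \<oplus> T\<^sup>*M\<close> into \<open>TM \<oplus> TM\<close>, where \<open>check_J\<close> is the block matrix with
  rows $(J, -J^2 + pJ + qI)$ and $(I, pI - J)$, and \<open>check_g\<close> has the Gram matrix with rows
  $(I, \frac{p}{4}I - \frac12 J)$ and $(\frac{p}{4}I - \frac12 J, \frac{p^2+4q}{4}I)$ relative to \<open>g\<close>. All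
  blocks are polynomials in the symmetric endomorphism \<open>J\<close>, so the metallic identity and the symmetry
  reduce to a computation with commuting matrices, which \<open>\<Phi>\<close> transports to \<open>T\<^sup>*M\<close> pointwise.

  Smoothness is read off in the canonical charts. There the horizontal lift is
  $u \mapsto (u, \eta \circ \Gamma(u, \cdot))$: since \<open>D\<close> is only given on global fields, its Christoffel
  symbols are extracted with plateau functions, and derivatives of evaluation functions then pin down
  the horizontal vectors. The musical isomorphism is smooth because the inverse of a smooth family of
  linear isomorphisms is smooth.
\<close>

section \<open>Calculus of smooth maps\<close>

text \<open>Several objects are given only by choice: \<open>horizontal_lift\<close> is a definite
  description, \<open>sharp\<close> and \<open>Phi_inv\<close> are set-theoretic inverses,
  \<open>deriv_along\<close> and \<open>pushforward\<close> pick some chart. Each must be replaced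
  by a coordinate formula before its smoothness can be discussed. For the horizontal lift this
  requires many global vector fields, because horizontality and the connection axioms are tested
  against global fields only. Such fields arise by cutting off coordinate fields and extending them
  by zero; the extension is smooth because compact subsets of a Hausdorff manifold are closed.
  Second countability reaches the cotangent bundle through a countable cover of \<open>M\<close> by
  patches. In canonical charts \<open>Phi\<close> turns out to be a shear, hence bijective for every
  connection. The pointwise identities on the cotangent bundle are then those of the generalized
  tangent space, and nondegeneracy is exactly what \<open>is_metric_check_g\<close> provides
  there.\<close>

lemma Ck_on_cong:
  assumes "open S" "\<And>x. x \<in> S \<Longrightarrow> f x = g x" "Ck_on k f S"
  shows "Ck_on k g S"
  using assms(2,3)
proof (induction k arbitrary: f g)
  case 0
  then show ?case by (simp cong: continuous_on_cong)
next
  case (Suc k)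
  have d: "f differentiable (at x)" if "x \<in> S" for x using Suc.prems that by simp
  have g: "g differentiable (at x)" if "x \<in> S" for x
    using d[OF that] has_derivative_transform_within_open[of f _ x UNIV S g, OF _ \<open>open S\<close> that Suc.prems(1)]
    unfolding differentiable_def by blast
  have "frechet_derivative f (at x) = frechet_derivative g (at x)" if "x \<in> S" for x
    by (rule frechet_derivative_transform_within_open[OF d[OF that] \<open>open S\<close> that]) (rule Suc.prems(1))
  then show ?case
    using Suc.prems(2) g by (auto intro: Suc.IH[rotated])
qed

lemma Ck_on_subset: "Ck_on k f S \<Longrightarrow> T \<subseteq> S \<Longrightarrow> Ck_on k f T"
  by (induction k arbitrary: f) (auto intro: continuous_on_subset)

lemma Ck_on_lower: "Ck_on (Suc k) f S \<Longrightarrow> Ck_on k f S"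
proof (induction k arbitrary: f)
  case 0
  then show ?case
    by (auto intro!: differentiable_imp_continuous_on differentiable_at_imp_differentiable_on)
next
  case (Suc k)
  then show ?case by simp
qed

lemma Ck_on_local:
  assumes "\<And>x. x \<in> S \<Longrightarrow> \<exists>U. open U \<and> x \<in> U \<and> Ck_on k f U"
  shows "Ck_on k f S"
  using assms
proof (induction k arbitrary: f)
  case 0
  then show ?case
    by (auto intro!: continuous_at_imp_continuous_on simp: continuous_on_eq_continuous_at)
      (use continuous_on_eq_continuous_at in blast)
next
  case (Suc k)
  have "f differentiable (at x)" if "x \<in> S" for x using Suc.prems[OF that] by auto
  moreover have "Ck_on k (\<lambda>x. frechet_derivative f (at x) v) S" for v
    by (rule Suc.IH) (use Suc.prems in fastforce)
  ultimately show ?case by simp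
qed

text \<open>The inductive steps supply the derivative in closed form through this rule.
  \<open>Ck_on\<close> tests directional derivatives in fixed directions, so no norm on a space of
  linear maps is involved.\<close>

lemma Ck_on_SucI:
  assumes "open S" "\<And>x. x \<in> S \<Longrightarrow> (f has_derivative f' x) (at x)" "\<And>v. Ck_on k (\<lambda>x. f' x v) S"
  shows "Ck_on (Suc k) f S"
proof -
  have "f' x v = frechet_derivative f (at x) v" if "x \<in> S" for x v
    using frechet_derivative_at[OF assms(2)[OF that]] by simp
  then have "Ck_on k (\<lambda>x. frechet_derivative f (at x) v) S" for v
    by (intro Ck_on_cong[OF \<open>open S\<close> _ assms(3)[of v]])
  then show ?thesis using assms(2) by (auto simp: differentiable_def)
qed

lemma Ck_on_SucD:
  assumes "Ck_on (Suc k) f S"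
  shows "x \<in> S \<Longrightarrow> (f has_derivative frechet_derivative f (at x)) (at x)"
    "Ck_on k (\<lambda>x. frechet_derivative f (at x) v) S"
  using assms by (auto simp: frechet_derivative_works[symmetric])

lemma Ck_on_const: "open S \<Longrightarrow> Ck_on k (\<lambda>_. c) S"
proof (induction k arbitrary: c)
  case (Suc k)
  show ?case by (rule Ck_on_SucI[where f'="\<lambda>_ _. 0"]) (use Suc in auto)
qed simp

lemma Ck_on_bounded_linear:
  assumes "bounded_linear L" "open S" "Ck_on k f S"
  shows "Ck_on k (\<lambda>x. L (f x)) S"
  using assms(3)
proof (induction k arbitrary: f)
  case 0
  then show ?case by (simp add: bounded_linear.continuous_on[OF assms(1)])
next
  case (Suc k)
  show ?case
    by (rule Ck_on_SucI[where f'="\<lambda>x v. L (frechet_derivative f (at x) v)"])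
      (auto intro!: assms(2) bounded_linear.has_derivative[OF assms(1)] Ck_on_SucD[OF Suc.prems] Suc.IH)
qed

lemma Ck_on_ident: "open S \<Longrightarrow> Ck_on k (\<lambda>x. x) S"
  by (cases k) (auto intro!: continuous_on_id Ck_on_SucI[where f'="\<lambda>_ v. v"] Ck_on_const)

lemma Ck_on_add:
  assumes "open S" "Ck_on k f S" "Ck_on k g S"
  shows "Ck_on k (\<lambda>x. f x + g x) S"
  using assms(2,3)
proof (induction k arbitrary: f g)
  case 0
  then show ?case by (simp add: continuous_on_add)
next
  case (Suc k)
  show ?case
    by (rule Ck_on_SucI[where f'="\<lambda>x v. frechet_derivative f (at x) v + frechet_derivative g (at x) v"])
      (auto intro!: assms(1) has_derivative_add Ck_on_SucD[OF Suc.prems(1)] Ck_on_SucD[OF Suc.prems(2)] Suc.IH)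
qed

text \<open>The product rule leaves one factor undifferentiated; \<open>Ck_on_lower\<close> brings
  that factor down to class \<open>k\<close>, where the induction hypothesis applies.\<close>

lemma Ck_on_bilinear:
  assumes "bounded_bilinear bil" "open S" "Ck_on k f S" "Ck_on k g S"
  shows "Ck_on k (\<lambda>x. bil (f x) (g x)) S"
  using assms(3,4)
proof (induction k arbitrary: f g)
  case 0
  then show ?case by (simp add: bounded_bilinear.continuous_on[OF assms(1)])
next
  case (Suc k)
  show ?case
    by (rule Ck_on_SucI[where f'="\<lambda>x v. bil (f x) (frechet_derivative g (at x) v) + bil (frechet_derivative f (at x) v) (g x)"])
      (auto intro!: assms(2) bounded_bilinear.FDERIV[OF assms(1)] Ck_on_add
        Ck_on_SucD[OF Suc.prems(1)] Ck_on_SucD[OF Suc.prems(2)] Suc.IH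
        Suc.prems[THEN Ck_on_lower])
qed

lemma Ck_on_sum:
  assumes "open S" "\<And>i. i \<in> I \<Longrightarrow> Ck_on k (f i) S"
  shows "Ck_on k (\<lambda>x. \<Sum>i\<in>I. f i x) S"
  using assms(2)
proof (induction I rule: infinite_finite_induct)
  case (insert i I)
  then show ?case by (simp add: Ck_on_add[OF \<open>open S\<close>])
qed (simp_all add: Ck_on_const \<open>open S\<close>)

text \<open>In the chain rule the derivative of \<open>f\<close> is taken in the moving direction
  \<open>?g' x v\<close>, whereas \<open>Ck_on\<close> knows only fixed directions. Expanding that
  direction in \<open>Basis\<close> reduces to the maps \<open>?f' (g x) b\<close>, to which the
  induction hypothesis applies because \<open>f\<close> is arbitrary in it.\<close>

lemma Ck_on_compose:
  fixes g :: "'a::real_normed_vector \<Rightarrow> 'b::euclidean_space"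
  assumes "open S" "open T" "Ck_on k f T" "Ck_on k g S" "g ` S \<subseteq> T"
  shows "Ck_on k (\<lambda>x. f (g x)) S"
  using assms(3,4)
proof (induction k arbitrary: f)
  case 0
  then show ?case using assms(5) by (auto intro: continuous_on_compose2)
next
  case (Suc k)
  let ?f' = "\<lambda>x. frechet_derivative f (at x)" and ?g' = "\<lambda>x. frechet_derivative g (at x)"
  have "((\<lambda>x. f (g x)) has_derivative (\<lambda>v. \<Sum>b\<in>Basis. (?g' x v \<bullet> b) *\<^sub>R ?f' (g x) b)) (at x)"
    if "x \<in> S" for x
  proof -
    have f: "(f has_derivative ?f' (g x)) (at (g x))"
      using Ck_on_SucD(1)[OF Suc.prems(1)] that assms(5) by blast
    have repr: "?f' (g x) u = (\<Sum>b\<in>Basis. (u \<bullet> b) *\<^sub>R ?f' (g x) b)" for u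
    proof -
      have lin: "linear (?f' (g x))" using f by (rule has_derivative_linear)
      have "?f' (g x) u = ?f' (g x) (\<Sum>b\<in>Basis. (u \<bullet> b) *\<^sub>R b)" by (simp add: euclidean_representation)
      also have "\<dots> = (\<Sum>b\<in>Basis. (u \<bullet> b) *\<^sub>R ?f' (g x) b)"
        by (simp add: linear_sum[OF lin] linear_cmul[OF lin])
      finally show ?thesis .
    qed
    show ?thesis
      by (rule has_derivative_eq_rhs[OF has_derivative_compose[OF Ck_on_SucD(1)[OF Suc.prems(2) that] f]])
        (rule ext, rule repr)
  qed
  moreover have "Ck_on k (\<lambda>x. \<Sum>b\<in>Basis. (?g' x v \<bullet> b) *\<^sub>R ?f' (g x) b) S" for v
    by (intro Ck_on_sum Ck_on_bilinear[OF bounded_bilinear_scaleR] assms(1) Suc.IH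
        Ck_on_bounded_linear[OF bounded_linear_inner_left] Ck_on_SucD[OF Suc.prems(1)]
        Ck_on_SucD[OF Suc.prems(2)] Ck_on_lower[OF Suc.prems(2)])
  ultimately show ?case by (intro Ck_on_SucI[OF assms(1)])
qed

text \<open>A smooth family of linear maps is recorded by its values on basis vectors; expanding
  \<open>h y\<close> turns the application into a finite sum of products.\<close>

lemma Ck_on_linear_family:
  fixes F :: "'a::real_normed_vector \<Rightarrow> 'b::euclidean_space \<Rightarrow> 'c::real_normed_vector"
  assumes "open S" "\<And>y. y \<in> S \<Longrightarrow> linear (F y)" "\<And>b. b \<in> Basis \<Longrightarrow> Ck_on k (\<lambda>y. F y b) S" "Ck_on k h S"
  shows "Ck_on k (\<lambda>y. F y (h y)) S"
proof (rule Ck_on_cong[OF \<open>open S\<close>])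
  fix y assume "y \<in> S"
  then have lin: "linear (F y)" by (rule assms(2))
  have "F y (h y) = F y (\<Sum>b\<in>Basis. (h y \<bullet> b) *\<^sub>R b)" by (simp add: euclidean_representation)
  also have "\<dots> = (\<Sum>b\<in>Basis. (h y \<bullet> b) *\<^sub>R F y b)"
    by (simp add: linear_sum[OF lin] linear_cmul[OF lin])
  finally show "(\<Sum>b\<in>Basis. (h y \<bullet> b) *\<^sub>R F y b) = F y (h y)" by simp
next
  show "Ck_on k (\<lambda>y. \<Sum>b\<in>Basis. (h y \<bullet> b) *\<^sub>R F y b) S"
    by (intro Ck_on_sum Ck_on_bilinear[OF bounded_bilinear_scaleR] assms
        Ck_on_bounded_linear[OF bounded_linear_inner_left])
qed

text \<open>
  The derivative of the inverse family is obtained from the inverse function theorem for the map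
  \<open>(y, u) \<mapsto> (y, F y u)\<close>, so that continuity of the inverse need not be shown first.
\<close>

lemma linear_right_inverse:
  assumes "linear f" "\<And>u. g (f u) = u" "\<And>u. f (g u) = u"
  shows "linear g"
proof (rule linearI)
  show "g (a + b) = g a + g b" for a b
    using linear_add[OF assms(1), of "g a" "g b"] assms(2)[of "g a + g b"] by (simp add: assms(3))
  show "g (r *\<^sub>R a) = r *\<^sub>R g a" for r a
    using linear_cmul[OF assms(1), of r "g a"] assms(2)[of "r *\<^sub>R g a"] by (simp add: assms(3))
qed

lemma has_derivative_inverse_family:
  fixes F :: "'a::euclidean_space \<Rightarrow> 'b::euclidean_space \<Rightarrow> 'b"
  assumes "open S" and lin: "\<And>y. y \<in> S \<Longrightarrow> linear (F y)"
    and ck: "\<And>b. Ck_on (Suc 0) (\<lambda>y. F y b) S"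
    and inv: "\<And>y u. y \<in> S \<Longrightarrow> G y (F y u) = u" "\<And>y u. y \<in> S \<Longrightarrow> F y (G y u) = u"
    and "y \<in> S"
  shows "((\<lambda>z. G z w) has_derivative
           (\<lambda>v. - G y (frechet_derivative (\<lambda>z. F z (G y w)) (at y) v))) (at y)"
proof -
  define u where "u = G y w"
  define \<Psi> where "\<Psi> = (\<lambda>(z, u). (z, F z u))"
  define \<Theta> where "\<Theta> = (\<lambda>(z, u). (z, G z u))"
  define \<delta> where "\<delta> = frechet_derivative (\<lambda>z. F z u) (at y)"
  let ?T = "S \<times> (UNIV :: 'b set)"
  have "open ?T" using \<open>open S\<close> by (simp add: open_Times)
  have ck1: "Ck_on (Suc 0) (\<lambda>p. F (fst p) b) ?T" for b
    by (rule Ck_on_compose[OF \<open>open ?T\<close> \<open>open S\<close> ck])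
      (auto simp del: Ck_on.simps intro!: Ck_on_bounded_linear[OF bounded_linear_fst] Ck_on_ident \<open>open ?T\<close>)
  have ckF: "Ck_on (Suc 0) (\<lambda>p. F (fst p) (snd p)) ?T"
    by (rule Ck_on_linear_family[OF \<open>open ?T\<close> _ ck1])
      (auto simp del: Ck_on.simps intro!: lin Ck_on_bounded_linear[OF bounded_linear_snd] Ck_on_ident \<open>open ?T\<close>)
  have mem: "(y, u) \<in> ?T" using \<open>y \<in> S\<close> by simp
  define \<Delta> where "\<Delta> = frechet_derivative (\<lambda>p. F (fst p) (snd p)) (at (y, u))"
  have \<Delta>: "((\<lambda>p. F (fst p) (snd p)) has_derivative \<Delta>) (at (y, u))"
    unfolding \<Delta>_def using Ck_on_SucD(1)[OF ckF mem] .
  have lin\<Delta>: "linear \<Delta>" using \<Delta> by (rule has_derivative_linear)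
  have linG: "linear (G y)"
    by (rule linear_right_inverse[OF lin[OF \<open>y \<in> S\<close>]]) (simp_all add: inv \<open>y \<in> S\<close>)
  have \<Delta>1: "\<Delta> (v, 0) = \<delta> v" for v
  proof -
    have "((\<lambda>z. (z, u)) has_derivative (\<lambda>v. (v, 0))) (at y)"
      by (auto intro!: derivative_eq_intros)
    from has_derivative_compose[OF this \<Delta>]
    have "((\<lambda>z. F z u) has_derivative (\<lambda>v. \<Delta> (v, 0))) (at y)" by simp
    from frechet_derivative_at[OF this] show ?thesis by (simp add: \<delta>_def fun_eq_iff)
  qed
  have \<Delta>2: "\<Delta> (0, v) = F y v" for v
  proof -
    have "((\<lambda>z. (y, z)) has_derivative (\<lambda>v. (0, v))) (at u)"
      by (auto intro!: derivative_eq_intros)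
    from has_derivative_compose[OF this \<Delta>]
    have "(F y has_derivative (\<lambda>v. \<Delta> (0, v))) (at u)" by simp
    moreover have "(F y has_derivative F y) (at u)"
      using lin[OF \<open>y \<in> S\<close>] by (simp add: linear_imp_has_derivative)
    ultimately have "(\<lambda>v. \<Delta> (0, v)) = F y" by (rule has_derivative_unique)
    then show ?thesis by (rule fun_cong)
  qed
  have \<Delta>12: "\<Delta> (v, v') = \<delta> v + F y v'" for v v'
    using linear_add[OF lin\<Delta>, of "(v, 0)" "(0, v')"] by (simp add: \<Delta>1 \<Delta>2)
  have d\<Psi>: "(\<Psi> has_derivative (\<lambda>(v, v'). (v, \<delta> v + F y v'))) (at (y, u))"
  proof -
    have "((\<lambda>p. (fst p, F (fst p) (snd p))) has_derivative (\<lambda>p. (fst p, \<Delta> p))) (at (y, u))"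
      by (intro has_derivative_Pair \<Delta>) (auto intro!: derivative_eq_intros)
    moreover have "\<Psi> = (\<lambda>p. (fst p, F (fst p) (snd p)))" by (auto simp: \<Psi>_def)
    moreover have "(\<lambda>(v, v'). (v, \<delta> v + F y v')) = (\<lambda>p. (fst p, \<Delta> p))" by (auto simp: \<Delta>12)
    ultimately show ?thesis by simp
  qed
  have "continuous_on ?T \<Psi>"
  proof -
    have "\<Psi> = (\<lambda>p. (fst p, F (fst p) (snd p)))" by (auto simp: \<Psi>_def)
    then show ?thesis
      using Ck_on_lower[OF ckF] by (auto intro!: continuous_intros)
  qed
  \<comment> \<open>The derivative of \<open>\<Psi>\<close> is block triangular with diagonal blocks
    the identity and \<open>F y\<close>; back substitution gives its inverse.\<close>
  have d\<Theta>: "(\<Theta> has_derivative (\<lambda>(v, v'). (v, G y (v' - \<delta> v)))) (at (\<Psi> (y, u)))"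
  proof (rule has_derivative_inverse_strong[OF \<open>open ?T\<close> mem \<open>continuous_on ?T \<Psi>\<close> _ d\<Psi>])
    show "\<Theta> (\<Psi> x) = x" if "x \<in> ?T" for x
      using that inv by (auto simp: \<Theta>_def \<Psi>_def)
    show "(\<lambda>(v, v'). (v, \<delta> v + F y v')) \<circ> (\<lambda>(v, v'). (v, G y (v' - \<delta> v))) = id"
      using inv \<open>y \<in> S\<close> by auto
  qed
  have \<Psi>yu: "\<Psi> (y, u) = (y, w)" using inv \<open>y \<in> S\<close> by (simp add: \<Psi>_def u_def)
  have "((\<lambda>z. (z, w)) has_derivative (\<lambda>v. (v, 0))) (at y)"
    by (auto intro!: derivative_eq_intros)
  from has_derivative_compose[OF this d\<Theta>[unfolded \<Psi>yu]]
  have "((\<lambda>z. snd (\<Theta> (z, w))) has_derivative (\<lambda>v. snd (v, G y (0 - \<delta> v)))) (at y)"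
    using has_derivative_snd by fastforce
  then show ?thesis
    by (simp add: \<Theta>_def linear_neg[OF linG] \<delta>_def u_def)
qed

text \<open>The formula for the derivative of \<open>G\<close> involves \<open>G\<close> itself
  twice but no derivative of \<open>G\<close>. Class \<open>k\<close> of \<open>G\<close> for every
  argument therefore yields class \<open>k + 1\<close>, by two nested uses of
  \<open>Ck_on_linear_family\<close>.\<close>

lemma Ck_on_inverse_family:
  fixes F :: "'a::euclidean_space \<Rightarrow> 'b::euclidean_space \<Rightarrow> 'b"
  assumes "open S" and lin: "\<And>y. y \<in> S \<Longrightarrow> linear (F y)"
    and ck: "\<And>k b. Ck_on k (\<lambda>y. F y b) S"
    and inv: "\<And>y u. y \<in> S \<Longrightarrow> G y (F y u) = u" "\<And>y u. y \<in> S \<Longrightarrow> F y (G y u) = u"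
  shows "Ck_on k (\<lambda>y. G y w) S"
proof (induction k arbitrary: w)
  case 0
  have "(\<lambda>z. G z w) differentiable (at y)" if "y \<in> S" for y
    using has_derivative_inverse_family[OF assms that] unfolding differentiable_def by blast
  then show ?case
    by (auto intro!: differentiable_imp_continuous_on differentiable_at_imp_differentiable_on)
next
  case (Suc k)
  let ?D = "\<lambda>y v u. frechet_derivative (\<lambda>z. F z u) (at y) v"
  have linG: "linear (G y)" if "y \<in> S" for y
    by (rule linear_right_inverse[OF lin[OF that]]) (simp_all add: inv that)
  have dF: "((\<lambda>z. F z u) has_derivative (\<lambda>v. ?D y v u)) (at y)" if "y \<in> S" for y u
    using Ck_on_SucD(1)[OF ck[of "Suc 0"] that] .
  \<comment> \<open>Linearity in \<open>u\<close> survives differentiation in \<open>y\<close>,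
    because \<open>F z\<close> is linear for all \<open>z\<close> in the open set \<open>S\<close>
    and derivatives are unique.\<close>
  have linD: "linear (?D y v)" if "y \<in> S" for y v
  proof (rule linearI)
    fix a b :: 'b and r :: real
    have "((\<lambda>z. F z a + F z b) has_derivative (\<lambda>v. ?D y v a + ?D y v b)) (at y)"
      by (intro has_derivative_add dF that)
    from has_derivative_transform_within_open[OF this \<open>open S\<close> that]
    have "((\<lambda>z. F z (a + b)) has_derivative (\<lambda>v. ?D y v a + ?D y v b)) (at y)"
      by (simp add: linear_add[OF lin])
    from fun_cong[OF has_derivative_unique[OF dF[OF that] this], of v]
    show "?D y v (a + b) = ?D y v a + ?D y v b" .
    have "((\<lambda>z. r *\<^sub>R F z a) has_derivative (\<lambda>v. r *\<^sub>R ?D y v a)) (at y)"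
      by (intro has_derivative_scaleR_right dF that)
    from has_derivative_transform_within_open[OF this \<open>open S\<close> that]
    have "((\<lambda>z. F z (r *\<^sub>R a)) has_derivative (\<lambda>v. r *\<^sub>R ?D y v a)) (at y)"
      by (simp add: linear_cmul[OF lin])
    from fun_cong[OF has_derivative_unique[OF dF[OF that] this], of v]
    show "?D y v (r *\<^sub>R a) = r *\<^sub>R ?D y v a" .
  qed
  show ?case
  proof (rule Ck_on_SucI[OF \<open>open S\<close>])
    show "((\<lambda>z. G z w) has_derivative (\<lambda>v. - G y (?D y v (G y w)))) (at y)" if "y \<in> S" for y
      using has_derivative_inverse_family[OF assms that] .
    have "Ck_on k (\<lambda>y. G y (?D y v (G y w))) S" for v
      by (rule Ck_on_linear_family[OF \<open>open S\<close> linG Suc.IH], assumption)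
        (rule Ck_on_linear_family[OF \<open>open S\<close> linD Ck_on_SucD(2)[OF ck] Suc.IH])
    then show "Ck_on k (\<lambda>y. - G y (?D y v (G y w))) S" for v
      by (rule Ck_on_bounded_linear[OF bounded_linear_minus[OF bounded_linear_ident] \<open>open S\<close>])
  qed
qed

section \<open>Closure properties of smooth maps\<close>

named_theorems smooth_intros

lemma smooth_on_cong:
  "open S \<Longrightarrow> (\<And>x. x \<in> S \<Longrightarrow> f x = g x) \<Longrightarrow> smooth_on f S \<Longrightarrow> smooth_on g S"
  unfolding smooth_on_def using Ck_on_cong[of S f g] by blast

lemma smooth_on_subset: "smooth_on f S \<Longrightarrow> T \<subseteq> S \<Longrightarrow> smooth_on f T"
  unfolding smooth_on_def using Ck_on_subset by blast

lemma smooth_on_local: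
  assumes "\<And>x. x \<in> S \<Longrightarrow> \<exists>U. open U \<and> x \<in> U \<and> smooth_on f U"
  shows "smooth_on f S"
  unfolding smooth_on_def
proof
  show "Ck_on k f S" for k
    by (rule Ck_on_local) (use assms in \<open>auto simp: smooth_on_def\<close>)
qed

lemma smooth_on_const [smooth_intros]: "open S \<Longrightarrow> smooth_on (\<lambda>_. c) S"
  by (simp add: smooth_on_def Ck_on_const)

lemma smooth_on_ident [smooth_intros]: "open S \<Longrightarrow> smooth_on (\<lambda>x. x) S"
  by (simp add: smooth_on_def Ck_on_ident)

lemma smooth_on_bounded_linear:
  "bounded_linear L \<Longrightarrow> open S \<Longrightarrow> smooth_on f S \<Longrightarrow> smooth_on (\<lambda>x. L (f x)) S"
  by (simp add: smooth_on_def Ck_on_bounded_linear)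

lemma smooth_on_bilinear:
  "bounded_bilinear bil \<Longrightarrow> open S \<Longrightarrow> smooth_on f S \<Longrightarrow> smooth_on g S \<Longrightarrow>
    smooth_on (\<lambda>x. bil (f x) (g x)) S"
  by (simp add: smooth_on_def Ck_on_bilinear)

lemma smooth_on_add [smooth_intros]:
  "open S \<Longrightarrow> smooth_on f S \<Longrightarrow> smooth_on g S \<Longrightarrow> smooth_on (\<lambda>x. f x + g x) S"
  by (simp add: smooth_on_def Ck_on_add)

lemma smooth_on_minus [smooth_intros]:
  "open S \<Longrightarrow> smooth_on f S \<Longrightarrow> smooth_on (\<lambda>x. - f x) S"
  by (rule smooth_on_bounded_linear[OF bounded_linear_minus[OF bounded_linear_ident]])

lemma smooth_on_diff [smooth_intros]:
  "open S \<Longrightarrow> smooth_on f S \<Longrightarrow> smooth_on g S \<Longrightarrow> smooth_on (\<lambda>x. f x - g x) S"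
  using smooth_on_add[OF _ _ smooth_on_minus, of S f g] by simp

lemmas smooth_on_scaleR [smooth_intros] = smooth_on_bilinear[OF bounded_bilinear_scaleR]
  and smooth_on_mult [smooth_intros] = smooth_on_bilinear[OF bounded_bilinear_mult]
  and smooth_on_inner [smooth_intros] = smooth_on_bilinear[OF bounded_bilinear_inner]
  and smooth_on_fst [smooth_intros] = smooth_on_bounded_linear[OF bounded_linear_fst]
  and smooth_on_snd [smooth_intros] = smooth_on_bounded_linear[OF bounded_linear_snd]

lemma smooth_on_sum [smooth_intros]:
  "open S \<Longrightarrow> (\<And>i. i \<in> I \<Longrightarrow> smooth_on (f i) S) \<Longrightarrow> smooth_on (\<lambda>x. \<Sum>i\<in>I. f i x) S"
  by (simp add: smooth_on_def Ck_on_sum)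

lemma smooth_on_Pair [smooth_intros]:
  assumes "open S" "smooth_on f S" "smooth_on g S"
  shows "smooth_on (\<lambda>x. (f x, g x)) S"
proof -
  have "smooth_on (\<lambda>x. (f x, 0) + (0, g x)) S"
    by (intro smooth_on_add assms smooth_on_bounded_linear[where L="\<lambda>x. (x, 0)"]
        smooth_on_bounded_linear[where L="\<lambda>x. (0, x)"] bounded_linear_Pair
        bounded_linear_ident bounded_linear_zero)
  then show ?thesis by simp
qed

lemma smooth_on_compose:
  fixes g :: "'a::real_normed_vector \<Rightarrow> 'b::euclidean_space"
  shows "open S \<Longrightarrow> open T \<Longrightarrow> smooth_on f T \<Longrightarrow> smooth_on g S \<Longrightarrow> g ` S \<subseteq> T \<Longrightarrow>
    smooth_on (\<lambda>x. f (g x)) S"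
  by (simp add: smooth_on_def Ck_on_compose)

lemma smooth_on_linear_family:
  fixes F :: "'a::real_normed_vector \<Rightarrow> 'b::euclidean_space \<Rightarrow> 'c::real_normed_vector"
  assumes "open S" "\<And>y. y \<in> S \<Longrightarrow> linear (F y)" "\<And>b. b \<in> Basis \<Longrightarrow> smooth_on (\<lambda>y. F y b) S" "smooth_on h S"
  shows "smooth_on (\<lambda>y. F y (h y)) S"
  using assms by (simp add: smooth_on_def Ck_on_linear_family)

lemma smooth_on_inverse_family:
  fixes F :: "'a::euclidean_space \<Rightarrow> 'b::euclidean_space \<Rightarrow> 'b"
  assumes "open S" "\<And>y. y \<in> S \<Longrightarrow> linear (F y)" "\<And>b. smooth_on (\<lambda>y. F y b) S"
    "\<And>y u. y \<in> S \<Longrightarrow> G y (F y u) = u" "\<And>y u. y \<in> S \<Longrightarrow> F y (G y u) = u"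
  shows "smooth_on (\<lambda>y. G y w) S"
  using Ck_on_inverse_family[of S F G] assms unfolding smooth_on_def by blast

lemma smooth_on_has_derivative:
  "smooth_on f S \<Longrightarrow> x \<in> S \<Longrightarrow> (f has_derivative frechet_derivative f (at x)) (at x)"
  unfolding smooth_on_def by (blast intro: Ck_on_SucD(1)[of 0])

lemma smooth_on_linear_derivative:
  "smooth_on f S \<Longrightarrow> x \<in> S \<Longrightarrow> linear (frechet_derivative f (at x))"
  by (rule has_derivative_linear[OF smooth_on_has_derivative])

lemma smooth_on_derivative:
  "smooth_on f S \<Longrightarrow> smooth_on (\<lambda>x. frechet_derivative f (at x) v) S"
  unfolding smooth_on_def using Ck_on_SucD(2) by blast

lemma smooth_on_imp_continuous_on: "smooth_on f S \<Longrightarrow> continuous_on S f"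
  unfolding smooth_on_def using Ck_on.simps(1) by blast

text \<open>Division by \<open>g x\<close> is the inverse of the one-dimensional linear map
  \<open>u \<mapsto> g x * u\<close>, so this is a case of
  \<open>smooth_on_inverse_family\<close>.\<close>

lemma smooth_on_divide:
  fixes f g :: "'a::euclidean_space \<Rightarrow> real"
  assumes "open S" "smooth_on f S" "smooth_on g S" "\<And>x. x \<in> S \<Longrightarrow> g x \<noteq> 0"
  shows "smooth_on (\<lambda>x. f x / g x) S"
proof -
  have "smooth_on (\<lambda>x. inverse (g x) * 1) S"
    by (rule smooth_on_inverse_family[where F="\<lambda>x u. g x * u" and G="\<lambda>x u. inverse (g x) * u"])
      (auto intro!: smooth_intros assms(1,3) linear_times simp: assms(4))
  then have "smooth_on (\<lambda>x. f x * (inverse (g x) * 1)) S"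
    by (rule smooth_on_mult[OF assms(1,2)])
  then show ?thesis by (simp add: divide_inverse)
qed

section \<open>Plateau functions\<close>

text \<open>\<open>n! exp s \<ge> s^n\<close> at \<open>s = 1/t\<close>.\<close>

lemma exp_minus_inverse_le_power:
  fixes t :: real
  assumes "t > 0"
  shows "exp (- 1 / t) \<le> fact n * t ^ n"
proof -
  have "(1 / t) ^ n / fact n \<le> exp (1 / t)"
  proof -
    have "(\<Sum>k\<in>{n}. (1 / t) ^ k / fact k) \<le> (\<Sum>k. (1 / t) ^ k / fact k)"
      using assms summable_exp_generic[of "1 / t"]
      by (intro sum_le_suminf) (auto simp: divide_inverse mult.commute)
    then show ?thesis by (simp add: exp_def divide_inverse mult.commute)
  qed
  then have "(1 / t) ^ n \<le> exp (1 / t) * fact n"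
    by (subst (asm) pos_divide_le_eq) auto
  then have "1 \<le> fact n * exp (1 / t) * t ^ n"
    using assms by (simp add: field_simps power_divide)
  then have "exp (- 1 / t) * 1 \<le> exp (- 1 / t) * (fact n * exp (1 / t) * t ^ n)"
    by (intro mult_left_mono) auto
  also have "\<dots> = (exp (- 1 / t) * exp (1 / t)) * (fact n * t ^ n)" by simp
  also have "exp (- 1 / t) * exp (1 / t) = 1" by (simp flip: exp_add)
  finally show ?thesis by simp
qed

text \<open>The powers in the denominator make the family closed under differentiation up to linear
  combinations, so one induction proves all members smooth at once.\<close>

definition flat_exp :: "nat \<Rightarrow> real \<Rightarrow> real" where
  "flat_exp n t = (if t > 0 then exp (- 1 / t) / t ^ n else 0)"

lemma flat_exp_has_derivative:
  "(flat_exp n has_derivative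
     (\<lambda>v. v * (flat_exp (n + 2) t - real n * flat_exp (Suc n) t))) (at t)"
proof -
  have "(flat_exp n has_field_derivative (flat_exp (n + 2) t - real n * flat_exp (Suc n) t)) (at t)"
  proof (cases t "0 :: real" rule: linorder_cases)
    case less
    have "((\<lambda>_. 0) has_field_derivative (0 :: real)) (at t)" by simp
    then have "(flat_exp n has_field_derivative 0) (at t)"
      by (rule has_field_derivative_transform_within_open[where S="{..<0}"])
        (use less in \<open>auto simp: flat_exp_def\<close>)
    then show ?thesis using less by (simp add: flat_exp_def)
  next
    case greater
    have "((\<lambda>t. exp (- 1 / t) / t ^ n) has_field_derivative
        (exp (- 1 / t) * (1 / t\<^sup>2) * t ^ n - exp (- 1 / t) * (real n * t ^ (n - 1))) / (t ^ n * t ^ n)) (at t)"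
      using greater
      by (auto intro!: derivative_eq_intros simp: power2_eq_square field_simps)
    then have "(flat_exp n has_field_derivative
        (exp (- 1 / t) * (1 / t\<^sup>2) * t ^ n - exp (- 1 / t) * (real n * t ^ (n - 1))) / (t ^ n * t ^ n)) (at t)"
      by (rule has_field_derivative_transform_within_open[where S="{0<..}"])
        (use greater in \<open>auto simp: flat_exp_def\<close>)
    moreover have "(exp (- 1 / t) * (1 / t\<^sup>2) * t ^ n - exp (- 1 / t) * (real n * t ^ (n - 1))) / (t ^ n * t ^ n)
        = flat_exp (n + 2) t - real n * flat_exp (Suc n) t"
      using greater by (cases n) (auto simp: flat_exp_def field_simps power2_eq_square)
    ultimately show ?thesis by simp
  next
    case equal
    \<comment> \<open>Of the \<open>n + 2\<close> powers of \<open>h\<close>, \<open>n\<close>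
      cancel the denominator of \<open>flat_exp\<close>, one cancels that of the difference
      quotient, and the last one tends to 0.\<close>
    have bound: "\<bar>flat_exp n h / h\<bar> \<le> fact (n + 2) * \<bar>h\<bar>" for h
    proof (cases "h > 0")
      case True
      have "exp (- 1 / h) / h ^ n / h \<le> fact (n + 2) * h ^ (n + 2) / h ^ n / h"
        using exp_minus_inverse_le_power[OF True, of "n + 2"] True
        by (intro divide_right_mono) auto
      also have "\<dots> = fact (n + 2) * h" using True by (simp add: field_simps)
      finally show ?thesis using True by (simp add: flat_exp_def)
    next
      case False
      then have "flat_exp n h = 0" by (simp add: flat_exp_def)
      then show ?thesis by (simp del: fact_Suc)
    qed
    have "(\<lambda>h. flat_exp n h / h) \<midarrow>0\<rightarrow> 0"
    proof (rule Lim_null_comparison)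
      show "\<forall>\<^sub>F h in at 0. norm (flat_exp n h / h) \<le> fact (n + 2) * \<bar>h\<bar>"
        using bound by (simp add: always_eventually)
      show "(\<lambda>h. fact (n + 2) * \<bar>h :: real\<bar>) \<midarrow>0\<rightarrow> 0"
        by (auto intro!: tendsto_eq_intros)
    qed
    then show ?thesis using equal by (simp add: DERIV_def flat_exp_def)
  qed
  then show ?thesis by (simp add: has_field_derivative_def mult_commute_abs)
qed

lemma smooth_on_flat_exp: "smooth_on (flat_exp n) UNIV"
proof -
  have "Ck_on k (flat_exp n) UNIV" for k
  proof (induction k arbitrary: n)
    case 0
    then show ?case
      using has_derivative_continuous[OF flat_exp_has_derivative]
      by (auto intro!: continuous_at_imp_continuous_on)
  next
    case (Suc k)
    have "Ck_on k (\<lambda>t. flat_exp (n + 2) t + (- real n) * flat_exp (Suc n) t) UNIV"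
      by (intro Ck_on_add Ck_on_bilinear[OF bounded_bilinear_mult] Ck_on_const Suc.IH) auto
    then have "Ck_on k (\<lambda>t. v * (flat_exp (n + 2) t - real n * flat_exp (Suc n) t)) UNIV" for v
      by (intro Ck_on_bilinear[OF bounded_bilinear_mult] Ck_on_const) auto
    then show ?case
      by (intro Ck_on_SucI[OF _ flat_exp_has_derivative]) auto
  qed
  then show ?thesis by (simp add: smooth_on_def)
qed

text \<open>The quotient \<open>?f / (?f + ?h)\<close>, where \<open>?f\<close> vanishes outside the
  ball of radius \<open>2 * r\<close> and \<open>?h\<close> inside the ball of radius
  \<open>r\<close>. Since \<open>r\<^sup>2 < 4 * r\<^sup>2\<close>, at every point at least one of
  the two is positive. The squared distance is used because, unlike the distance, it is smooth at
  the centre.\<close>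

lemma smooth_plateau:
  fixes c :: "'a::euclidean_space"
  assumes "r > 0"
  obtains \<psi> :: "'a \<Rightarrow> real"
  where "smooth_on \<psi> UNIV" "\<And>y. dist c y < r \<Longrightarrow> \<psi> y = 1"
    "\<And>y. dist c y \<ge> 2 * r \<Longrightarrow> \<psi> y = 0"
proof
  let ?s = "\<lambda>y. (y - c) \<bullet> (y - c)"
  let ?f = "\<lambda>y. flat_exp 0 (4 * r\<^sup>2 - ?s y)" and ?h = "\<lambda>y. flat_exp 0 (?s y - r\<^sup>2)"
  have s: "?s y = (dist c y)\<^sup>2" for y
    by (metis dist_commute dist_norm power2_norm_eq_inner)
  have "?f y + ?h y > 0" for y
  proof -
    have "4 * r\<^sup>2 - ?s y > 0 \<or> ?s y - r\<^sup>2 > 0" using assms by (smt (verit) zero_less_power)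
    then show ?thesis by (auto simp: flat_exp_def add_pos_nonneg add_nonneg_pos)
  qed
  then have ne: "?f y + ?h y \<noteq> 0" for y by (metis less_irrefl)
  have sm: "smooth_on ?f UNIV" "smooth_on ?h UNIV"
    by (intro smooth_on_compose[OF open_UNIV open_UNIV smooth_on_flat_exp] smooth_intros subset_UNIV open_UNIV)+
  show "smooth_on (\<lambda>y. ?f y / (?f y + ?h y)) UNIV"
    by (intro smooth_on_divide smooth_on_add open_UNIV sm ne)
  show "?f y / (?f y + ?h y) = 1" if "dist c y < r" for y
  proof -
    have "?s y < r\<^sup>2" unfolding s using that by (intro power_strict_mono) auto
    then have "?h y = 0" by (simp add: flat_exp_def)
    then show ?thesis using ne[of y] by simp
  qed
  show "?f y / (?f y + ?h y) = 0" if "dist c y \<ge> 2 * r" for y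
  proof -
    have "(2 * r)\<^sup>2 \<le> ?s y" unfolding s using that assms by (intro power_mono) auto
    then show ?thesis by (simp add: flat_exp_def power_mult_distrib)
  qed
qed

section \<open>Charts, tangent vectors and the manifold topology\<close>

lemma linear_on_range_iff:
  assumes "linear L" "V = range L"
  shows "linear_on V f \<longleftrightarrow> linear (\<lambda>u. f (L u))"
proof
  assume "linear_on V f"
  then show "linear (\<lambda>u. f (L u))"
    using assms by (intro linearI) (auto simp: linear_on_def linear_add linear_cmul)
next
  assume f: "linear (\<lambda>u. f (L u))"
  show "linear_on V f"
    unfolding linear_on_def assms(2)
    using linear_add[OF f] linear_cmul[OF f]
    by (auto simp flip: linear_add[OF assms(1)] linear_cmul[OF assms(1)])
qed

abbreviation jacobian ::
  "('i, 'm, 'e::euclidean_space) manifold \<Rightarrow> 'i \<Rightarrow> 'i \<Rightarrow> 'm \<Rightarrow> 'e \<Rightarrow> 'e" where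
  "jacobian M i j x \<equiv> frechet_derivative (transition M i j) (at (chart M i x))"

text \<open>The domain of \<open>transition M i j\<close>, described by a condition on
  \<open>param\<close> instead of as an image. For injective charts it is the chart image of the
  intersection of the two patches.\<close>

definition overlap :: "('i, 'm, 'e::euclidean_space) manifold \<Rightarrow> 'i \<Rightarrow> 'i \<Rightarrow> 'e set" where
  "overlap M i j = {y \<in> image_of M i. param M i y \<in> patch M j}"

lemma mem_charts_at: "i \<in> charts_at M x \<longleftrightarrow> i \<in> indices M \<and> x \<in> patch M i"
  by (simp add: charts_at_def)

lemma points_iff: "x \<in> points M \<longleftrightarrow> (\<exists>i. i \<in> charts_at M x)"
  by (auto simp: points_def charts_at_def)

lemma chart_param: "y \<in> image_of M i \<Longrightarrow> chart M i (param M i y) = y"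
  by (simp add: image_of_def param_def f_inv_into_f)

lemma param_in_patch: "y \<in> image_of M i \<Longrightarrow> param M i y \<in> patch M i"
  by (simp add: image_of_def param_def inv_into_into)

lemma chart_in_image: "x \<in> patch M i \<Longrightarrow> chart M i x \<in> image_of M i"
  by (simp add: image_of_def)

lemma param_charts_at: "i \<in> indices M \<Longrightarrow> y \<in> image_of M i \<Longrightarrow> i \<in> charts_at M (param M i y)"
  by (simp add: mem_charts_at param_in_patch)

lemma param_in_points: "i \<in> indices M \<Longrightarrow> y \<in> image_of M i \<Longrightarrow> param M i y \<in> points M"
  by (auto simp: points_iff intro: param_charts_at)

lemma overlap_self: "overlap M i i = image_of M i"
  by (auto simp: overlap_def param_in_patch)

text \<open>Kept separate from the Hausdorff and countability axioms: for the cotangent bundle those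
  are derived from a description of its open sets, which already needs the atlas properties.\<close>

locale smooth_atlas =
  fixes M :: "('i, 'm, 'e::euclidean_space) manifold"
  assumes inj_chart: "i \<in> indices M \<Longrightarrow> inj_on (chart M i) (patch M i)"
    and open_overlap: "i \<in> indices M \<Longrightarrow> j \<in> indices M \<Longrightarrow> open (overlap M i j)"
    and smooth_transition:
      "i \<in> indices M \<Longrightarrow> j \<in> indices M \<Longrightarrow> smooth_on (transition M i j) (overlap M i j)"
begin

lemma param_chart: "i \<in> charts_at M x \<Longrightarrow> param M i (chart M i x) = x"
  by (simp add: param_def mem_charts_at inv_into_f_f inj_chart)

lemma open_image: "i \<in> indices M \<Longrightarrow> open (image_of M i)"
  using open_overlap[of i i] by (simp add: overlap_self)

lemma chart_in_overlap: "i \<in> charts_at M x \<Longrightarrow> j \<in> charts_at M x \<Longrightarrow> chart M i x \<in> overlap M i j"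
  by (auto simp: overlap_def param_chart mem_charts_at chart_in_image)

lemma transition_chart: "i \<in> charts_at M x \<Longrightarrow> transition M i j (chart M i x) = chart M j x"
  by (simp add: transition_def param_chart)

lemma transition_in_image:
  "y \<in> overlap M i j \<Longrightarrow> transition M i j y \<in> image_of M j"
  by (simp add: transition_def overlap_def chart_in_image)

lemma param_transition:
  "j \<in> indices M \<Longrightarrow> y \<in> overlap M i j \<Longrightarrow> param M j (transition M i j y) = param M i y"
  by (simp add: transition_def overlap_def param_chart mem_charts_at)

lemma has_derivative_transition:
  "i \<in> charts_at M x \<Longrightarrow> j \<in> charts_at M x \<Longrightarrow>
    (transition M i j has_derivative jacobian M i j x) (at (chart M i x))"
  by (rule smooth_on_has_derivative[OF smooth_transition chart_in_overlap]) (auto simp: mem_charts_at)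

lemma linear_jacobian: "i \<in> charts_at M x \<Longrightarrow> j \<in> charts_at M x \<Longrightarrow> linear (jacobian M i j x)"
  by (rule has_derivative_linear[OF has_derivative_transition])

lemma jacobian_unique:
  assumes "i \<in> charts_at M x" "(f has_derivative f') (at (chart M i x))" "open U" "chart M i x \<in> U"
    "\<And>y. y \<in> U \<Longrightarrow> f y = transition M i j y"
  shows "jacobian M i j x = f'"
  using frechet_derivative_at[OF has_derivative_transform_within_open[OF assms(2-5)]] by simp

lemma jacobian_self: "i \<in> charts_at M x \<Longrightarrow> jacobian M i i x u = u"
  by (subst jacobian_unique[where f="\<lambda>x. x" and f'="\<lambda>x. x" and U="image_of M i"])
    (auto simp: transition_def chart_param mem_charts_at open_image chart_in_image)

text \<open>The chain rule for the cocycle identity of transition maps. It is what makes every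
  \<open>coord_vector\<close> a consistent family of components.\<close>

lemma jacobian_jacobian:
  assumes "i \<in> charts_at M x" "j \<in> charts_at M x" "k \<in> charts_at M x"
  shows "jacobian M j k x (jacobian M i j x u) = jacobian M i k x u"
proof -
  have "((\<lambda>y. transition M j k (transition M i j y)) has_derivative
      (\<lambda>u. jacobian M j k x (jacobian M i j x u))) (at (chart M i x))"
    by (rule has_derivative_compose[OF has_derivative_transition])
      (simp_all add: transition_chart has_derivative_transition assms)
  from jacobian_unique[OF assms(1) this open_overlap[of i j] chart_in_overlap] assms
  have "jacobian M i k x = (\<lambda>u. jacobian M j k x (jacobian M i j x u))"
    by (auto simp: mem_charts_at transition_def overlap_def param_chart)
  then show ?thesis by simp
qed

lemma coord_vector_apply:
  "j \<in> charts_at M x \<Longrightarrow> coord_vector M i x u j = jacobian M i j x u"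
  by (simp add: coord_vector_def)

lemma coord_vector_self: "i \<in> charts_at M x \<Longrightarrow> coord_vector M i x u i = u"
  by (simp add: coord_vector_def jacobian_self)

lemma coord_vector_tangent: "i \<in> charts_at M x \<Longrightarrow> coord_vector M i x u \<in> tangent_space M x"
  by (simp add: tangent_space_def coord_vector_def jacobian_jacobian)

lemma tangent_jacobian:
  "i \<in> charts_at M x \<Longrightarrow> j \<in> charts_at M x \<Longrightarrow> v \<in> tangent_space M x \<Longrightarrow> v j = jacobian M i j x (v i)"
  unfolding tangent_space_def by blast

text \<open>Together with \<open>coord_vector_self\<close> this identifies the tangent space with
  the model space by evaluation at \<open>i\<close>. Off the charts around \<open>x\<close> both
  sides vanish by convention.\<close>

lemma coord_vector_component:
  assumes "i \<in> charts_at M x" "v \<in> tangent_space M x"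
  shows "coord_vector M i x (v i) = v"
proof
  fix j
  show "coord_vector M i x (v i) j = v j"
  proof (cases "j \<in> charts_at M x")
    case True
    then show ?thesis using tangent_jacobian[OF assms(1) True assms(2)] by (simp only: coord_vector_apply)
  next
    case False
    then have "v j = 0" using assms(2) unfolding tangent_space_def by blast
    then show ?thesis using False by (simp add: coord_vector_def)
  qed
qed

lemma tangent_eqI:
  assumes i: "i \<in> charts_at M x" and v: "v \<in> tangent_space M x" and w: "w \<in> tangent_space M x"
    and "v i = w i"
  shows "v = w"
proof -
  have "v = coord_vector M i x (v i)" by (rule coord_vector_component[OF i v, symmetric])
  also have "\<dots> = coord_vector M i x (w i)" by (simp only: assms(4))
  also have "\<dots> = w" by (rule coord_vector_component[OF i w])
  finally show ?thesis .
qed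

lemma linear_coord_vector: "i \<in> charts_at M x \<Longrightarrow> linear (coord_vector M i x)"
  by (rule linearI)
    (auto simp: coord_vector_def fun_eq_iff linear_add[OF linear_jacobian] linear_cmul[OF linear_jacobian])

lemma tangent_space_eq_range:
  assumes "i \<in> charts_at M x"
  shows "tangent_space M x = range (coord_vector M i x)"
proof
  show "tangent_space M x \<subseteq> range (coord_vector M i x)"
  proof
    fix v assume "v \<in> tangent_space M x"
    then show "v \<in> range (coord_vector M i x)"
      by (intro range_eqI[where x="v i"]) (simp only: coord_vector_component[OF assms])
  qed
qed (auto intro: coord_vector_tangent[OF assms])

lemma subspace_tangent_space: "x \<in> points M \<Longrightarrow> subspace (tangent_space M x)"
  by (auto simp: points_iff tangent_space_eq_range intro!: linear_subspace_image[OF linear_coord_vector subspace_UNIV])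

lemma linear_on_tangent_iff:
  "i \<in> charts_at M x \<Longrightarrow> linear_on (tangent_space M x) f \<longleftrightarrow> linear (\<lambda>u. f (coord_vector M i x u))"
  by (rule linear_on_range_iff[OF linear_coord_vector tangent_space_eq_range])

lemma has_derivative_chart_change:
  assumes "i \<in> charts_at M x" "j \<in> charts_at M x"
    and "(f \<circ> param M i has_derivative f') (at (chart M i x))"
  shows "(f \<circ> param M j has_derivative (\<lambda>u. f' (jacobian M j i x u))) (at (chart M j x))"
proof -
  have "((\<lambda>y. (f \<circ> param M i) (transition M j i y)) has_derivative (\<lambda>u. f' (jacobian M j i x u)))
      (at (chart M j x))"
    by (rule has_derivative_compose[OF has_derivative_transition])
      (use assms in \<open>simp_all add: transition_chart comp_def\<close>)
  then show ?thesis
    by (rule has_derivative_transform_within_open[OF _ open_overlap[of j i] chart_in_overlap])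
      (use assms in \<open>auto simp: param_transition mem_charts_at\<close>)
qed

lemma some_chart: "x \<in> points M \<Longrightarrow> (SOME i. i \<in> charts_at M x) \<in> charts_at M x"
  by (simp add: points_iff some_in_eq ex_in_conv)

text \<open>\<open>deriv_along\<close> picks some chart. Passing to the chart \<open>i\<close>
  changes the derivative of \<open>f\<close> by a Jacobian that is absorbed by the components of
  \<open>v\<close>, so any chart may be used.\<close>

lemma deriv_along_chart:
  assumes "i \<in> charts_at M x" "v \<in> tangent_space M x"
    and "(f \<circ> param M i has_derivative f') (at (chart M i x))"
  shows "deriv_along M x v f = f' (v i)"
proof -
  define j where "j = (SOME j. j \<in> charts_at M x)"
  have j: "j \<in> charts_at M x" unfolding j_def using assms(1) by (metis points_iff some_chart)
  have "jacobian M j i x (v j) = v i"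
    using tangent_jacobian[OF j assms(1,2)] by simp
  with frechet_derivative_at[OF has_derivative_chart_change[OF assms(1) j assms(3)], symmetric]
  show ?thesis by (simp add: deriv_along_def j_def[symmetric])
qed

lemma vector_field_tangent: "X \<in> vector_fields M \<Longrightarrow> x \<in> points M \<Longrightarrow> X x \<in> tangent_space M x"
  and vector_field_smooth:
    "X \<in> vector_fields M \<Longrightarrow> i \<in> indices M \<Longrightarrow> smooth_on (\<lambda>y. X (param M i y) i) (image_of M i)"
  by (auto simp: vector_fields_def)

lemma vector_fields_zero: "0 \<in> vector_fields M"
  by (auto simp: vector_fields_def open_image intro!: smooth_intros subspace_0 subspace_tangent_space)

lemma vector_fields_add: "X \<in> vector_fields M \<Longrightarrow> Y \<in> vector_fields M \<Longrightarrow> X + Y \<in> vector_fields M"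
  by (auto simp: vector_fields_def open_image intro!: smooth_intros subspace_add[OF subspace_tangent_space])

lemma vector_fields_scale:
  "f \<in> smooth_functions M \<Longrightarrow> X \<in> vector_fields M \<Longrightarrow> (\<lambda>x. f x *\<^sub>R X x) \<in> vector_fields M"
  by (auto simp: vector_fields_def smooth_functions_def comp_def open_image
      intro!: smooth_intros subspace_scale[OF subspace_tangent_space])

lemma vector_fields_sum:
  "(\<And>b. b \<in> B \<Longrightarrow> X b \<in> vector_fields M) \<Longrightarrow> (\<Sum>b\<in>B. X b) \<in> vector_fields M"
  by (induction B rule: infinite_finite_induct) (auto intro: vector_fields_zero vector_fields_add)

section \<open>The manifold topology\<close>

lemma istopology_manifold:
  "istopology (\<lambda>W. W \<subseteq> points M \<and> (\<forall>i\<in>indices M. open (chart M i ` (W \<inter> patch M i))))"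
  unfolding istopology_def
proof (intro conjI allI impI)
  fix S T assume S: "S \<subseteq> points M \<and> (\<forall>i\<in>indices M. open (chart M i ` (S \<inter> patch M i)))"
    and T: "T \<subseteq> points M \<and> (\<forall>i\<in>indices M. open (chart M i ` (T \<inter> patch M i)))"
  show "S \<inter> T \<subseteq> points M" using S by auto
  show "\<forall>i\<in>indices M. open (chart M i ` (S \<inter> T \<inter> patch M i))"
  proof
    fix i assume i: "i \<in> indices M"
    have "chart M i ` (S \<inter> T \<inter> patch M i) = chart M i ` ((S \<inter> patch M i) \<inter> (T \<inter> patch M i))"
      by (rule arg_cong[where f="(`) (chart M i)"]) auto
    \<comment> \<open>Images commute with intersections here because the chart is injective on its
      patch.\<close>
    also have "\<dots> = chart M i ` (S \<inter> patch M i) \<inter> chart M i ` (T \<inter> patch M i)"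
      by (rule inj_on_image_Int[OF inj_chart[OF i]]) auto
    finally show "open (chart M i ` (S \<inter> T \<inter> patch M i))" using S T i by auto
  qed
next
  fix \<K> assume K: "\<forall>K\<in>\<K>. K \<subseteq> points M \<and> (\<forall>i\<in>indices M. open (chart M i ` (K \<inter> patch M i)))"
  show "\<Union> \<K> \<subseteq> points M" using K by auto
  have "chart M i ` (\<Union> \<K> \<inter> patch M i) = (\<Union>K\<in>\<K>. chart M i ` (K \<inter> patch M i))" for i by auto
  then show "\<forall>i\<in>indices M. open (chart M i ` (\<Union> \<K> \<inter> patch M i))" using K by auto
qed

lemma openin_manifold:
  "openin (manifold_topology M) W \<longleftrightarrow>
    W \<subseteq> points M \<and> (\<forall>i\<in>indices M. open (chart M i ` (W \<inter> patch M i)))"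
  unfolding manifold_topology_def topology_inverse'[OF istopology_manifold] ..

lemma chart_image_Int_patch:
  assumes "i \<in> indices M"
  shows "chart M i ` (W \<inter> patch M i) = {y \<in> image_of M i. param M i y \<in> W}"
proof
  show "chart M i ` (W \<inter> patch M i) \<subseteq> {y \<in> image_of M i. param M i y \<in> W}"
    using param_chart[of i] assms by (auto simp: mem_charts_at chart_in_image)
  show "{y \<in> image_of M i. param M i y \<in> W} \<subseteq> chart M i ` (W \<inter> patch M i)"
    using chart_param param_in_patch by (metis (no_types, lifting) IntI image_eqI mem_Collect_eq subsetI)
qed

lemma topspace_manifold: "topspace (manifold_topology M) = points M"
proof -
  have "{y \<in> image_of M i. param M i y \<in> points M} = image_of M i" if "i \<in> indices M" for i
    using param_in_points[OF that] by auto
  then have "openin (manifold_topology M) (points M)"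
    by (simp add: openin_manifold chart_image_Int_patch open_image)
  then show ?thesis
    by (metis openin_manifold openin_subset openin_topspace subset_antisym)
qed

lemma openin_patch: "i \<in> indices M \<Longrightarrow> openin (manifold_topology M) (patch M i)"
  using open_overlap by (auto simp: openin_manifold points_def chart_image_Int_patch overlap_def)

text \<open>Seen in another chart \<open>j\<close>, the set is the preimage of \<open>U\<close>
  under the transition map, which is continuous on the open overlap.\<close>

lemma openin_param_image:
  assumes "i \<in> indices M" "open U" "U \<subseteq> image_of M i"
  shows "openin (manifold_topology M) (param M i ` U)"
  unfolding openin_manifold
proof (intro conjI ballI)
  show "param M i ` U \<subseteq> points M" using assms(3) by (auto intro!: param_in_points[OF assms(1)])
  fix j assume j: "j \<in> indices M"
  have "chart M j ` (param M i ` U \<inter> patch M j) = {z \<in> overlap M j i. transition M j i z \<in> U}"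
    unfolding chart_image_Int_patch[OF j]
  proof (intro Collect_cong)
    fix z
    show "z \<in> image_of M j \<and> param M j z \<in> param M i ` U \<longleftrightarrow> z \<in> overlap M j i \<and> transition M j i z \<in> U"
    proof
      assume z: "z \<in> image_of M j \<and> param M j z \<in> param M i ` U"
      then obtain u where u: "u \<in> U" "param M j z = param M i u" by auto
      then show "z \<in> overlap M j i \<and> transition M j i z \<in> U"
        using z assms(3) by (auto simp: overlap_def transition_def param_in_patch chart_param subset_iff)
    next
      assume z: "z \<in> overlap M j i \<and> transition M j i z \<in> U"
      then have "param M j z = param M i (transition M j i z)" by (simp add: param_transition assms(1))
      then show "z \<in> image_of M j \<and> param M j z \<in> param M i ` U"
        using z by (auto simp: overlap_def)
    qed
  qed
  moreover have "{z \<in> overlap M j i. transition M j i z \<in> U} = overlap M j i \<inter> transition M j i -` U"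
    by auto
  moreover have "open (overlap M j i \<inter> transition M j i -` U)"
    by (intro continuous_open_preimage smooth_on_imp_continuous_on smooth_transition open_overlap j assms)
  ultimately show "open (chart M j ` (param M i ` U \<inter> patch M j))" by simp
qed

lemma continuous_map_param:
  assumes "i \<in> indices M"
  shows "continuous_map (top_of_set (image_of M i)) (manifold_topology M) (param M i)"
  unfolding continuous_map_def
proof (intro conjI allI impI)
  show "param M i \<in> topspace (top_of_set (image_of M i)) \<rightarrow> topspace (manifold_topology M)"
    using param_in_points[OF assms] by (auto simp: topspace_manifold)
  fix W assume "openin (manifold_topology M) W"
  then have "open {y \<in> image_of M i. param M i y \<in> W}"
    using assms by (auto simp: openin_manifold chart_image_Int_patch)
  then show "openin (top_of_set (image_of M i)) {y \<in> topspace (top_of_set (image_of M i)). param M i y \<in> W}"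
    by (simp add: openin_open_eq open_image assms)
qed

text \<open>Points of a common patch can be separated inside the chart image, from the atlas alone.
  This handles two covectors over the same base point.\<close>

lemma separate_in_patch:
  assumes a: "i \<in> charts_at M a" and b: "i \<in> charts_at M b" and "a \<noteq> b"
  obtains U V where "openin (manifold_topology M) U" "openin (manifold_topology M) V"
    "a \<in> U" "b \<in> V" "disjnt U V"
proof -
  have i: "i \<in> indices M" using a by (simp add: mem_charts_at)
  have "chart M i a \<noteq> chart M i b" using param_chart[OF a] param_chart[OF b] \<open>a \<noteq> b\<close> by metis
  then obtain A B where AB: "open A" "open B" "chart M i a \<in> A" "chart M i b \<in> B" "A \<inter> B = {}"
    by (auto dest: hausdorff)
  show thesis
  proof
    show "openin (manifold_topology M) (param M i ` (A \<inter> image_of M i))"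
      "openin (manifold_topology M) (param M i ` (B \<inter> image_of M i))"
      using AB i by (auto intro!: openin_param_image open_Int open_image)
    show "a \<in> param M i ` (A \<inter> image_of M i)"
      by (rule rev_image_eqI[of "chart M i a"]) (use a AB param_chart[OF a] in \<open>auto simp: mem_charts_at chart_in_image\<close>)
    show "b \<in> param M i ` (B \<inter> image_of M i)"
      by (rule rev_image_eqI[of "chart M i b"]) (use b AB param_chart[OF b] in \<open>auto simp: mem_charts_at chart_in_image\<close>)
    have "u = v" if "u \<in> image_of M i" "v \<in> image_of M i" "param M i u = param M i v" for u v
      using that chart_param by metis
    then show "disjnt (param M i ` (A \<inter> image_of M i)) (param M i ` (B \<inter> image_of M i))"
      using AB(5) by (auto simp: disjnt_iff)
  qed
qed

text \<open>A countable basis of the model space, restricted to members inside chart images and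
  transported by countably many charts, is a basis of the manifold.\<close>

lemma second_countable_countable_cover:
  assumes "countable C" "C \<subseteq> indices M" "points M \<subseteq> (\<Union>i\<in>C. patch M i)"
  shows "second_countable (manifold_topology M)"
proof -
  obtain B :: "'e set set" where B: "countable B" "topological_basis B"
    using ex_countable_basis by auto
  define \<B> where "\<B> = {param M i ` U |i U. i \<in> C \<and> U \<in> B \<and> U \<subseteq> image_of M i}"
  have "\<B> \<subseteq> (\<lambda>(i, U). param M i ` U) ` (C \<times> B)" by (auto simp: \<B>_def)
  then have "countable \<B>"
    by (rule countable_subset) (simp add: assms(1) B(1))
  moreover have "openin (manifold_topology M) V" if "V \<in> \<B>" for V
    using that assms(2) topological_basis_open[OF B(2)]
    by (auto simp: \<B>_def intro!: openin_param_image)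
  moreover have "\<exists>V\<in>\<B>. x \<in> V \<and> V \<subseteq> W" if W: "openin (manifold_topology M) W" "x \<in> W" for W x
  proof -
    have "x \<in> points M" using W by (auto simp: openin_manifold)
    then obtain i where i: "i \<in> C" "x \<in> patch M i" using assms(3) by auto
    then have iI: "i \<in> indices M" using assms(2) by auto
    then have ix: "i \<in> charts_at M x" using i by (simp add: mem_charts_at)
    have "open {y \<in> image_of M i. param M i y \<in> W}"
      using W iI by (simp add: openin_manifold chart_image_Int_patch)
    moreover have "chart M i x \<in> {y \<in> image_of M i. param M i y \<in> W}"
      using W i by (simp add: chart_in_image param_chart[OF ix])
    ultimately obtain U where U: "U \<in> B" "chart M i x \<in> U" "U \<subseteq> {y \<in> image_of M i. param M i y \<in> W}"
      by (rule topological_basisE[OF B(2)])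
    show ?thesis
    proof (intro bexI conjI)
      show "x \<in> param M i ` U" using U(2) by (rule rev_image_eqI) (simp add: param_chart[OF ix])
      show "param M i ` U \<subseteq> W" using U(3) by auto
      show "param M i ` U \<in> \<B>" using U i by (auto simp: \<B>_def)
    qed
  qed
  ultimately show ?thesis unfolding second_countable_def by blast
qed

end

locale smooth_mfd = smooth_atlas M for M :: "('i, 'm, 'e::euclidean_space) manifold" +
  assumes hausdorff: "Hausdorff_space (manifold_topology M)"
    and second_countable: "second_countable (manifold_topology M)"

lemma smooth_manifold_iff: "smooth_manifold M \<longleftrightarrow> smooth_mfd M"
proof -
  have ov: "chart M i ` (patch M i \<inter> patch M j) = overlap M i j" if "inj_on (chart M i) (patch M i)" for i j
    unfolding overlap_def image_of_def param_def
    using that by (auto simp: inv_into_f_f)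
  show ?thesis
    unfolding smooth_manifold_def smooth_mfd_def smooth_mfd_axioms_def smooth_atlas_def
    by (auto simp: ov)
qed

section \<open>Countable covers and extension by zero from a chart\<close>

context smooth_mfd
begin

text \<open>A Lindelof argument: the atlas may be uncountable, so one patch is chosen for each
  member of a countable basis that fits into some patch.\<close>

lemma countable_cover:
  obtains C where "countable C" "C \<subseteq> indices M" "points M \<subseteq> (\<Union>i\<in>C. patch M i)"
proof -
  obtain B where "countable B \<and> (\<forall>V\<in>B. openin (manifold_topology M) V) \<and>
      (\<forall>U x. openin (manifold_topology M) U \<and> x \<in> U \<longrightarrow> (\<exists>V\<in>B. x \<in> V \<and> V \<subseteq> U))"
    using second_countable unfolding second_countable_def by (rule exE)
  then have B: "countable B"
    and base: "\<And>U x. openin (manifold_topology M) U \<Longrightarrow> x \<in> U \<Longrightarrow> \<exists>V\<in>B. x \<in> V \<and> V \<subseteq> U"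
    by auto
  define c where "c = (\<lambda>V. SOME i. i \<in> indices M \<and> V \<subseteq> patch M i)"
  have c: "c V \<in> indices M \<and> V \<subseteq> patch M (c V)" if "i \<in> indices M" "V \<subseteq> patch M i" for i V
    unfolding c_def using that by (intro someI[where P="\<lambda>i. i \<in> indices M \<and> V \<subseteq> patch M i"]) auto
  show thesis
  proof
    let ?C = "c ` {V \<in> B. \<exists>i\<in>indices M. V \<subseteq> patch M i}"
    show "countable ?C" using B by auto
    show "?C \<subseteq> indices M" using c by auto
    show "points M \<subseteq> (\<Union>i\<in>?C. patch M i)"
    proof
      fix x assume "x \<in> points M"
      then obtain i where i: "i \<in> indices M" "x \<in> patch M i" by (auto simp: points_def)
      then obtain V where "V \<in> B" "x \<in> V" "V \<subseteq> patch M i"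
        using base[OF openin_patch[OF i(1)] i(2)] by auto
      then show "x \<in> (\<Union>i\<in>?C. patch M i)" using c[of i V] i by auto
    qed
  qed
qed

text \<open>The Hausdorff property makes extension by zero legitimate: the complement of the support
  is open in \<open>M\<close>, not merely in the patch.\<close>

lemma closedin_param_image:
  assumes "i \<in> indices M" "compact K" "K \<subseteq> image_of M i"
  shows "closedin (manifold_topology M) (param M i ` K)"
proof (rule compactin_imp_closedin)
  show "Hausdorff_space (manifold_topology M)" by (rule hausdorff)
  show "compactin (manifold_topology M) (param M i ` K)"
    by (rule image_compactin[OF _ continuous_map_param[OF assms(1)]])
      (simp add: compactin_subtopology assms)
qed

text \<open>The chart image of \<open>j\<close> is covered by the overlap with \<open>i\<close>,
  where \<open>h\<close> is smooth by assumption, and the open set off \<open>K\<close>, where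
  \<open>h\<close> vanishes. The codomain is left general so that both functions and components of
  vector fields are covered.\<close>

lemma smooth_on_image_extend:
  assumes i: "i \<in> indices M" and K: "compact K" "K \<subseteq> image_of M i" and j: "j \<in> indices M"
    and h: "smooth_on h (overlap M j i)"
    and off: "\<And>y. y \<in> image_of M j \<Longrightarrow> param M j y \<notin> param M i ` K \<Longrightarrow> h y = 0"
  shows "smooth_on h (image_of M j)"
proof (rule smooth_on_local)
  fix y assume y: "y \<in> image_of M j"
  define B where "B = {y \<in> image_of M j. param M j y \<notin> param M i ` K}"
  have "openin (manifold_topology M) (points M - param M i ` K)"
    using closedin_param_image[OF i K] by (simp add: closedin_def topspace_manifold)
  then have "open (chart M j ` ((points M - param M i ` K) \<inter> patch M j))"
    using j by (auto simp: openin_manifold)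
  moreover have "chart M j ` ((points M - param M i ` K) \<inter> patch M j) = B"
    using param_in_points[OF j] by (auto simp: chart_image_Int_patch j B_def)
  ultimately have "open B" by simp
  show "\<exists>U. open U \<and> y \<in> U \<and> smooth_on h U"
  proof (cases "y \<in> B")
    case True
    have "smooth_on h B"
      by (rule smooth_on_cong[OF \<open>open B\<close> _ smooth_on_const[OF \<open>open B\<close>, of 0]])
        (auto simp: B_def off)
    then show ?thesis using True \<open>open B\<close> by blast
  next
    case False
    then have "y \<in> overlap M j i" using y K(2) by (auto simp: B_def overlap_def param_in_patch)
    then show ?thesis using h open_overlap[OF j i] by blast
  qed
qed

lemma smooth_functions_extend:
  assumes i: "i \<in> indices M" and K: "compact K" "K \<subseteq> image_of M i"
    and f: "smooth_on f (image_of M i)" "\<And>y. y \<in> image_of M i - K \<Longrightarrow> f y = 0"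
  shows "(\<lambda>x. if x \<in> patch M i then f (chart M i x) else 0) \<in> smooth_functions M" (is "?F \<in> _")
  unfolding smooth_functions_def comp_def
proof (intro CollectI ballI smooth_on_image_extend[OF i K])
  fix j assume j: "j \<in> indices M"
  show "smooth_on (\<lambda>y. ?F (param M j y)) (overlap M j i)"
  proof (rule smooth_on_cong[OF open_overlap[OF j i]])
    show "smooth_on (\<lambda>y. f (transition M j i y)) (overlap M j i)"
      by (rule smooth_on_compose[OF open_overlap[OF j i] open_image[OF i] f(1) smooth_transition[OF j i]])
        (auto intro: transition_in_image)
  qed (simp add: transition_def overlap_def)
  fix y assume y: "y \<in> image_of M j" "param M j y \<notin> param M i ` K"
  show "?F (param M j y) = 0"
  proof (cases "param M j y \<in> patch M i")
    case True
    then have "chart M i (param M j y) \<in> image_of M i - K"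
      using y(2) param_chart[of i "param M j y"] i by (auto simp: chart_in_image mem_charts_at image_iff)
    then show ?thesis using f(2) True by simp
  qed simp
qed

lemma vector_fields_extend:
  assumes i: "i \<in> indices M" and K: "compact K" "K \<subseteq> image_of M i"
    and f: "smooth_on f (image_of M i)" "\<And>y. y \<in> image_of M i - K \<Longrightarrow> f y = 0"
  shows "(\<lambda>x. if x \<in> patch M i then coord_vector M i x (f (chart M i x)) else 0) \<in> vector_fields M"
    (is "?F \<in> _")
  unfolding vector_fields_def
proof (intro CollectI ballI conjI allI impI smooth_on_image_extend[OF i K])
  show "?F x \<in> tangent_space M x" if "x \<in> points M" for x
    using that i by (auto simp: mem_charts_at intro!: coord_vector_tangent subspace_0 subspace_tangent_space)
  show "?F x = 0" if "x \<notin> points M" for x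
    using that i by (auto simp: points_def)
  fix j assume j: "j \<in> indices M"
  have f': "smooth_on (\<lambda>y. f (transition M j i y)) (overlap M j i)"
    by (rule smooth_on_compose[OF open_overlap[OF j i] open_image[OF i] f(1) smooth_transition[OF j i]])
      (auto intro: transition_in_image)
  have tr: "transition M j i ` overlap M j i \<subseteq> overlap M i j"
    using i by (auto simp: overlap_def transition_in_image param_transition[unfolded overlap_def] param_in_patch)
  show "smooth_on (\<lambda>y. ?F (param M j y) j) (overlap M j i)"
  proof (rule smooth_on_cong[OF open_overlap[OF j i]])
    \<comment> \<open>In the chart \<open>j\<close> the field has as component the Jacobian from
      \<open>i\<close> to \<open>j\<close> applied to \<open>f\<close>, both evaluated at the
      transported point.\<close>
    show "smooth_on (\<lambda>y. frechet_derivative (transition M i j) (at (transition M j i y))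
        (f (transition M j i y))) (overlap M j i)"
      by (rule smooth_on_linear_family[OF open_overlap[OF j i] _ _ f'],
          rule smooth_on_linear_derivative[OF smooth_transition[OF i j]], use tr in blast,
          rule smooth_on_compose[OF open_overlap[OF j i] open_overlap[OF i j]
            smooth_on_derivative[OF smooth_transition[OF i j]] smooth_transition[OF j i] tr])
  qed (auto simp: coord_vector_def transition_def overlap_def mem_charts_at j param_in_patch)
  fix y assume y: "y \<in> image_of M j" "param M j y \<notin> param M i ` K"
  show "?F (param M j y) j = 0"
  proof (cases "param M j y \<in> patch M i")
    case True
    then have "chart M i (param M j y) \<in> image_of M i - K"
      using y(2) param_chart[of i "param M j y"] i by (auto simp: chart_in_image mem_charts_at image_iff)
    then show ?thesis
      using f(2) True i linear_0[OF linear_coord_vector[of i "param M j y"]] by (simp add: mem_charts_at)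
  qed simp
qed

text \<open>The value 1 on a whole neighbourhood makes derivatives of the cut-off vanish there; the
  compact \<open>K\<close> is the support required for extension by zero.\<close>

lemma plateau_in_chart:
  assumes "i \<in> indices M" "y \<in> image_of M i"
  obtains \<psi> :: "'e \<Rightarrow> real" and K U where "smooth_on \<psi> UNIV" "compact K" "K \<subseteq> image_of M i"
    "\<And>z. z \<notin> K \<Longrightarrow> \<psi> z = 0" "open U" "y \<in> U" "U \<subseteq> image_of M i" "\<And>z. z \<in> U \<Longrightarrow> \<psi> z = 1"
proof -
  obtain e where e: "e > 0" "ball y e \<subseteq> image_of M i"
    using open_image[OF assms(1)] assms(2) open_contains_ball by blast
  \<comment> \<open>With plateau radius \<open>e / 3\<close> the support has radius at most
    \<open>2 * (e / 3)\<close>, so its closed ball still fits into the ball of radius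
    \<open>e\<close>.\<close>
  then have r: "e / 3 > 0" by simp
  obtain \<psi> :: "'e \<Rightarrow> real" where \<psi>: "smooth_on \<psi> UNIV" "\<And>z. dist y z < e / 3 \<Longrightarrow> \<psi> z = 1"
    "\<And>z. dist y z \<ge> 2 * (e / 3) \<Longrightarrow> \<psi> z = 0"
    by (rule smooth_plateau[OF r, of y]) blast
  show thesis
  proof (rule that[OF \<psi>(1), of "cball y (2 * (e / 3))" "ball y (e / 3)"])
    have "cball y (2 * (e / 3)) \<subseteq> ball y e" using e(1) by auto
    then show "cball y (2 * (e / 3)) \<subseteq> image_of M i" using e(2) by blast
    have "ball y (e / 3) \<subseteq> ball y e" using e(1) by auto
    then show "ball y (e / 3) \<subseteq> image_of M i" using e(2) by blast
  qed (use \<psi> e in \<open>auto simp: not_le\<close>)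
qed

end

section \<open>Christoffel symbols\<close>

text \<open>The components of $\nabla_u v$ for \<open>u\<close>, \<open>v\<close> with constant components in the chart \<open>i\<close>.\<close>

definition christoffel ::
  "('i, 'm, 'e::euclidean_space) manifold \<Rightarrow>
   (('m \<Rightarrow> 'i \<Rightarrow> 'e) \<Rightarrow> ('m \<Rightarrow> 'i \<Rightarrow> 'e) \<Rightarrow> 'm \<Rightarrow> 'i \<Rightarrow> 'e) \<Rightarrow> 'i \<Rightarrow> 'e \<Rightarrow> 'e \<Rightarrow> 'e \<Rightarrow> 'e" where
  "christoffel M D i y u v =
     (THE w. \<forall>X\<in>vector_fields M. \<forall>Y\<in>vector_fields M.
        X (param M i y) i = u \<longrightarrow> Y (param M i y) i = v \<longrightarrow>
        D X Y (param M i y) i = frechet_derivative (\<lambda>z. Y (param M i z) i) (at y) u + w)"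

lemma sum_fun_apply: "(\<Sum>i\<in>I. f i) x = (\<Sum>i\<in>I. f i x)"
  by (induction I rule: infinite_finite_induct) simp_all

context smooth_mfd
begin

text \<open>A coordinate field with constant components, cut off by a plateau function. It lets
  conditions quantified over global fields be tested at a single tangent vector.\<close>

lemma vector_field_through:
  assumes "x \<in> points M" "v \<in> tangent_space M x"
  obtains X where "X \<in> vector_fields M" "X x = v"
proof -
  obtain i where i: "i \<in> charts_at M x" using assms(1) by (auto simp: points_iff)
  then have "i \<in> indices M" "x \<in> patch M i" by (auto simp: mem_charts_at)
  then obtain \<psi> :: "'e \<Rightarrow> real" and K U where \<psi>: "smooth_on \<psi> UNIV" "compact K" "K \<subseteq> image_of M i"
    "\<And>z. z \<notin> K \<Longrightarrow> \<psi> z = 0" "chart M i x \<in> U" "\<And>z. z \<in> U \<Longrightarrow> \<psi> z = 1"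
    using plateau_in_chart[of i "chart M i x"] by (metis chart_in_image)
  show thesis
  proof
    show "(\<lambda>x. if x \<in> patch M i then coord_vector M i x (\<psi> (chart M i x) *\<^sub>R v i) else 0) \<in> vector_fields M"
      by (rule vector_fields_extend[where f="\<lambda>y. \<psi> y *\<^sub>R v i", OF \<open>i \<in> indices M\<close> \<psi>(2,3)])
        (auto intro!: smooth_intros open_image \<open>i \<in> indices M\<close> smooth_on_subset[OF \<psi>(1)] simp: \<psi>(4))
    show "(if x \<in> patch M i then coord_vector M i x (\<psi> (chart M i x) *\<^sub>R v i) else 0) = v"
      using \<open>x \<in> patch M i\<close> by (simp add: \<psi>(5,6) coord_vector_component[OF i assms(2)])
  qed
qed

lemma vector_field_through_chart:
  assumes "i \<in> indices M" "y \<in> image_of M i"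
  obtains X where "X \<in> vector_fields M" "X (param M i y) i = u"
proof -
  have i: "i \<in> charts_at M (param M i y)" using assms by (rule param_charts_at)
  obtain X where "X \<in> vector_fields M" "X (param M i y) = coord_vector M i (param M i y) u"
    using vector_field_through[OF param_in_points[OF assms] coord_vector_tangent[OF i]] .
  then show thesis using that by (simp add: coord_vector_self[OF i])
qed

end

locale connection_mfd = smooth_mfd M for M :: "('i, 'm, 'e::euclidean_space) manifold" +
  fixes D :: "('m \<Rightarrow> 'i \<Rightarrow> 'e) \<Rightarrow> ('m \<Rightarrow> 'i \<Rightarrow> 'e) \<Rightarrow> 'm \<Rightarrow> 'i \<Rightarrow> 'e"
  assumes connection: "linear_connection M D"
begin

lemma connection_field:
  "X \<in> vector_fields M \<Longrightarrow> Y \<in> vector_fields M \<Longrightarrow> D X Y \<in> vector_fields M"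
  using connection by (simp add: linear_connection_def)

lemma connection_add_left:
  "X \<in> vector_fields M \<Longrightarrow> X' \<in> vector_fields M \<Longrightarrow> Y \<in> vector_fields M \<Longrightarrow> D (X + X') Y = D X Y + D X' Y"
  using connection unfolding linear_connection_def by blast

lemma connection_add_right:
  "X \<in> vector_fields M \<Longrightarrow> Y \<in> vector_fields M \<Longrightarrow> Y' \<in> vector_fields M \<Longrightarrow> D X (Y + Y') = D X Y + D X Y'"
  using connection unfolding linear_connection_def by blast

lemma connection_scale_left:
  "f \<in> smooth_functions M \<Longrightarrow> X \<in> vector_fields M \<Longrightarrow> Y \<in> vector_fields M \<Longrightarrow>
    D (\<lambda>x. f x *\<^sub>R X x) Y = (\<lambda>x. f x *\<^sub>R D X Y x)"
  using connection unfolding linear_connection_def by blast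

lemma connection_scale_right:
  "f \<in> smooth_functions M \<Longrightarrow> X \<in> vector_fields M \<Longrightarrow> Y \<in> vector_fields M \<Longrightarrow>
    D X (\<lambda>x. f x *\<^sub>R Y x) = (\<lambda>x. deriv_along M x (X x) f *\<^sub>R Y x + f x *\<^sub>R D X Y x)"
  using connection unfolding linear_connection_def by blast

lemma connection_zero:
  assumes "X \<in> vector_fields M"
  shows "D 0 X = 0" "D X 0 = 0"
  using connection_add_left[OF vector_fields_zero vector_fields_zero assms]
    connection_add_right[OF assms vector_fields_zero vector_fields_zero] by simp_all

lemma connection_sum_left:
  assumes "Y \<in> vector_fields M" "\<And>b. b \<in> B \<Longrightarrow> X b \<in> vector_fields M"
  shows "D (\<Sum>b\<in>B. X b) Y = (\<Sum>b\<in>B. D (X b) Y)"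
  using assms(2)
  by (induction B rule: infinite_finite_induct)
    (simp_all add: connection_zero connection_add_left assms(1) vector_fields_sum)

lemma connection_sum_right:
  assumes "X \<in> vector_fields M" "\<And>b. b \<in> B \<Longrightarrow> Y b \<in> vector_fields M"
  shows "D X (\<Sum>b\<in>B. Y b) = (\<Sum>b\<in>B. D X (Y b))"
  using assms(2)
  by (induction B rule: infinite_finite_induct)
    (simp_all add: connection_zero connection_add_right assms(1) vector_fields_sum)

text \<open>
  Multiplying a field by the square of a plateau function writes it globally as a combination of
  local frame fields, so that the global axioms determine \<open>D\<close> near a point.
\<close>

lemma connection_local_form:
  assumes i: "i \<in> indices M" and y0: "y0 \<in> image_of M i"
  obtains U and G :: "'e \<Rightarrow> 'e \<Rightarrow> 'e \<Rightarrow> 'e"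
  where "open U" "y0 \<in> U" "U \<subseteq> image_of M i" "\<And>b c. smooth_on (\<lambda>y. G y b c) U"
    "\<And>y X Y. y \<in> U \<Longrightarrow> X \<in> vector_fields M \<Longrightarrow> Y \<in> vector_fields M \<Longrightarrow>
      D X Y (param M i y) i = frechet_derivative (\<lambda>z. Y (param M i z) i) (at y) (X (param M i y) i)
        + (\<Sum>c\<in>Basis. (Y (param M i y) i \<bullet> c) *\<^sub>R
            (\<Sum>b\<in>Basis. (X (param M i y) i \<bullet> b) *\<^sub>R G y b c))"
proof -
  obtain \<psi> :: "'e \<Rightarrow> real" and K U where \<psi>: "smooth_on \<psi> UNIV" "compact K" "K \<subseteq> image_of M i"
    "\<And>z. z \<notin> K \<Longrightarrow> \<psi> z = 0" and U: "open U" "y0 \<in> U" "U \<subseteq> image_of M i" and \<psi>1: "\<And>z. z \<in> U \<Longrightarrow> \<psi> z = 1"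
    using plateau_in_chart[OF i y0] by metis
  have \<psi>i: "smooth_on \<psi> (image_of M i)" using smooth_on_subset[OF \<psi>(1)] by auto
  note oi = open_image[OF i]
  define E where "E b = (\<lambda>x. if x \<in> patch M i then coord_vector M i x (\<psi> (chart M i x) *\<^sub>R b) else 0)" for b
  \<comment> \<open>Writing \<open>param M i (chart M i x)\<close> in place of \<open>x\<close>
    presents the function as a pullback from the chart, as \<open>smooth_functions_extend\<close>
    requires.\<close>
  define f where "f X b = (\<lambda>x. if x \<in> patch M i
      then \<psi> (chart M i x) * (X (param M i (chart M i x)) i \<bullet> b) else 0)" for X :: "'m \<Rightarrow> 'i \<Rightarrow> 'e" and b
  define \<psi>2 where "\<psi>2 = (\<lambda>x. if x \<in> patch M i then \<psi> (chart M i x) * \<psi> (chart M i x) else 0)"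
  have E: "E b \<in> vector_fields M" for b
    unfolding E_def
    by (rule vector_fields_extend[where f="\<lambda>y. \<psi> y *\<^sub>R b", OF i \<psi>(2,3)])
      (auto intro!: smooth_intros oi \<psi>i simp: \<psi>(4))
  have f: "f X b \<in> smooth_functions M" if "X \<in> vector_fields M" for X b
    unfolding f_def
    by (rule smooth_functions_extend[where f="\<lambda>y. \<psi> y * (X (param M i y) i \<bullet> b)", OF i \<psi>(2,3)])
      (auto intro!: smooth_intros oi \<psi>i vector_field_smooth[OF that i] simp: \<psi>(4))
  have \<psi>2: "\<psi>2 \<in> smooth_functions M"
    unfolding \<psi>2_def
    by (rule smooth_functions_extend[where f="\<lambda>y. \<psi> y * \<psi> y", OF i \<psi>(2,3)])
      (auto intro!: smooth_intros oi \<psi>i simp: \<psi>(4))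
  have decomp: "(\<lambda>x. \<psi>2 x *\<^sub>R X x) = (\<Sum>b\<in>Basis. (\<lambda>x. f X b x *\<^sub>R E b x))"
    if X: "X \<in> vector_fields M" for X
  proof
    fix x
    show "\<psi>2 x *\<^sub>R X x = (\<Sum>b\<in>Basis. (\<lambda>x. f X b x *\<^sub>R E b x)) x"
    proof (cases "x \<in> patch M i")
      case True
      then have ix: "i \<in> charts_at M x" using i by (simp add: mem_charts_at)
      then have x: "x \<in> points M" by (auto simp: points_iff)
      have "X x = coord_vector M i x (\<Sum>b\<in>Basis. (X x i \<bullet> b) *\<^sub>R b)"
        by (simp only: euclidean_representation coord_vector_component[OF ix vector_field_tangent[OF X x]])
      also have "\<dots> = (\<Sum>b\<in>Basis. (X x i \<bullet> b) *\<^sub>R coord_vector M i x b)"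
        by (simp add: linear_sum[OF linear_coord_vector[OF ix]] linear_cmul[OF linear_coord_vector[OF ix]])
      finally have "\<psi>2 x *\<^sub>R X x = \<psi>2 x *\<^sub>R (\<Sum>b\<in>Basis. (X x i \<bullet> b) *\<^sub>R coord_vector M i x b)"
        by (rule arg_cong)
      also have "\<dots> = (\<Sum>b\<in>Basis. f X b x *\<^sub>R E b x)"
        unfolding scaleR_sum_right
        by (rule sum.cong) (simp_all add: f_def E_def \<psi>2_def True param_chart[OF ix]
            linear_cmul[OF linear_coord_vector[OF ix]] mult_ac)
      finally show ?thesis by (simp add: sum_fun_apply)
    qed (simp add: \<psi>2_def f_def E_def sum_fun_apply)
  qed
  \<comment> \<open>On \<open>U\<close> the fields \<open>E b\<close> have constant components
    \<open>b\<close>, so these are the Christoffel symbols. They are smooth as components of the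
    global fields \<open>D (E b) (E c)\<close>.\<close>
  define G where "G y b c = D (E b) (E c) (param M i y) i" for y b c
  show thesis
  proof (rule that[OF U, of G])
    show "smooth_on (\<lambda>y. G y b c) U" for b c
      unfolding G_def
      by (rule smooth_on_subset[OF vector_field_smooth[OF connection_field[OF E E] i] U(3)])
  next
    fix y X Y assume y: "y \<in> U" and X: "X \<in> vector_fields M" and Y: "Y \<in> vector_fields M"
    define x where "x = param M i y"
    have yi: "y \<in> image_of M i" using y U by auto
    have ix: "i \<in> charts_at M x" unfolding x_def using i yi by (rule param_charts_at)
    have xp: "x \<in> patch M i" and xM: "x \<in> points M" using ix by (auto simp: mem_charts_at points_iff)
    have cx: "chart M i x = y" unfolding x_def by (rule chart_param[OF yi])
    have v2: "\<psi>2 x = 1" using xp cx y by (simp add: \<psi>2_def \<psi>1)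
    have fX: "f Z b x = Z x i \<bullet> b" for Z b using xp cx y by (simp add: f_def \<psi>1 x_def)
    have Ei: "E b x i = b" for b using xp cx y by (simp add: E_def \<psi>1 coord_vector_self[OF ix])
    \<comment> \<open>As \<open>\<psi>2\<close> is constantly 1 near \<open>x\<close>, the Leibniz
      term of \<open>\<psi>2\<close> disappears.\<close>
    have d2: "deriv_along M x (X x) \<psi>2 = 0"
    proof -
      have "(\<psi>2 \<circ> param M i has_derivative (\<lambda>_. 0)) (at (chart M i x))"
        unfolding cx
        by (rule has_derivative_transform_within_open[OF has_derivative_const U(1) y, of 1])
          (use U in \<open>auto simp: \<psi>2_def \<psi>1 chart_param param_in_patch subset_iff\<close>)
      from deriv_along_chart[OF ix vector_field_tangent[OF X xM] this] show ?thesis .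
    qed
    define Y' where "Y' = frechet_derivative (\<lambda>z. Y (param M i z) i) (at y)"
    have dY: "((\<lambda>z. Y (param M i z) i) has_derivative Y') (at y)"
      unfolding Y'_def by (rule smooth_on_has_derivative[OF vector_field_smooth[OF Y i] yi])
    have df: "deriv_along M x (X x) (f Y b) = Y' (X x i) \<bullet> b" for b
    proof -
      have "(f Y b \<circ> param M i has_derivative (\<lambda>u. Y' u \<bullet> b)) (at (chart M i x))"
        unfolding cx
        by (rule has_derivative_transform_within_open[OF has_derivative_inner_left[OF dY] U(1) y])
          (use U in \<open>auto simp: f_def \<psi>1 chart_param param_in_patch subset_iff\<close>)
      from deriv_along_chart[OF ix vector_field_tangent[OF X xM] this] show ?thesis .
    qed
    \<comment> \<open>Tensoriality in the first argument: all coefficients come out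
      undifferentiated, and \<open>\<psi>2\<close> has the value 1 at \<open>x\<close>.\<close>
    have left: "D X (E c) x = (\<Sum>b\<in>Basis. (X x i \<bullet> b) *\<^sub>R D (E b) (E c) x)" for c
    proof -
      have "(\<lambda>x. \<psi>2 x *\<^sub>R D X (E c) x) = D (\<lambda>x. \<psi>2 x *\<^sub>R X x) (E c)"
        by (rule connection_scale_left[OF \<psi>2 X E, symmetric])
      also have "\<dots> = (\<Sum>b\<in>Basis. D (\<lambda>x. f X b x *\<^sub>R E b x) (E c))"
        unfolding decomp[OF X] by (rule connection_sum_left[OF E vector_fields_scale[OF f[OF X] E]])
      also have "\<dots> = (\<Sum>b\<in>Basis. (\<lambda>x. f X b x *\<^sub>R D (E b) (E c) x))"
        by (simp only: connection_scale_left[OF f[OF X] E E])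
      finally have "\<psi>2 x *\<^sub>R D X (E c) x = (\<Sum>b\<in>Basis. (\<lambda>x. f X b x *\<^sub>R D (E b) (E c) x)) x"
        by (rule fun_cong)
      then show ?thesis by (simp add: v2 fX sum_fun_apply)
    qed
    \<comment> \<open>In the second argument each coefficient contributes a derivative. These
      derivatives are the coordinates of \<open>Y' (X x i)\<close>, so their sum against the frame
      becomes the coordinate derivative of \<open>Y\<close>.\<close>
    have right: "D X Y x = (\<Sum>c\<in>Basis. (Y' (X x i) \<bullet> c) *\<^sub>R E c x + (Y x i \<bullet> c) *\<^sub>R D X (E c) x)"
    proof -
      have "(\<lambda>x. deriv_along M x (X x) \<psi>2 *\<^sub>R Y x + \<psi>2 x *\<^sub>R D X Y x) = D X (\<lambda>x. \<psi>2 x *\<^sub>R Y x)"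
        by (rule connection_scale_right[OF \<psi>2 X Y, symmetric])
      also have "\<dots> = (\<Sum>c\<in>Basis. D X (\<lambda>x. f Y c x *\<^sub>R E c x))"
        unfolding decomp[OF Y] by (rule connection_sum_right[OF X vector_fields_scale[OF f[OF Y] E]])
      also have "\<dots> = (\<Sum>c\<in>Basis. (\<lambda>x. deriv_along M x (X x) (f Y c) *\<^sub>R E c x + f Y c x *\<^sub>R D X (E c) x))"
        by (simp only: connection_scale_right[OF f[OF Y] X E])
      finally have "deriv_along M x (X x) \<psi>2 *\<^sub>R Y x + \<psi>2 x *\<^sub>R D X Y x =
          (\<Sum>c\<in>Basis. (\<lambda>x. deriv_along M x (X x) (f Y c) *\<^sub>R E c x + f Y c x *\<^sub>R D X (E c) x)) x"
        by (rule fun_cong)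
      then show ?thesis by (simp add: v2 d2 fX df sum_fun_apply)
    qed
    have "D X Y x i = (\<Sum>c\<in>Basis. (Y' (X x i) \<bullet> c) *\<^sub>R c + (Y x i \<bullet> c) *\<^sub>R D X (E c) x i)"
      unfolding right by (simp add: sum_fun_apply Ei)
    also have "\<dots> = Y' (X x i) + (\<Sum>c\<in>Basis. (Y x i \<bullet> c) *\<^sub>R (\<Sum>b\<in>Basis. (X x i \<bullet> b) *\<^sub>R G y b c))"
      unfolding left by (simp add: sum.distrib euclidean_representation sum_fun_apply G_def x_def)
    finally show "D X Y (param M i y) i = frechet_derivative (\<lambda>z. Y (param M i z) i) (at y) (X (param M i y) i)
        + (\<Sum>c\<in>Basis. (Y (param M i y) i \<bullet> c) *\<^sub>R
            (\<Sum>b\<in>Basis. (X (param M i y) i \<bullet> b) *\<^sub>R G y b c))"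
      by (simp add: x_def Y'_def)
  qed
qed

text \<open>The local form was built with a cut-off depending on \<open>y0\<close>. Any two vectors
  \<open>u\<close>, \<open>v\<close> are components of global fields, so the form determines its
  last term uniquely; \<open>christoffel\<close>, which mentions no cut-off, must agree with it on
  \<open>U\<close>.\<close>

lemma christoffel_local_form:
  assumes i: "i \<in> indices M" and y0: "y0 \<in> image_of M i"
  obtains U and G :: "'e \<Rightarrow> 'e \<Rightarrow> 'e \<Rightarrow> 'e"
  where "open U" "y0 \<in> U" "U \<subseteq> image_of M i" "\<And>b c. smooth_on (\<lambda>y. G y b c) U"
    "\<And>y u v. y \<in> U \<Longrightarrow> christoffel M D i y u v =
      (\<Sum>c\<in>Basis. (v \<bullet> c) *\<^sub>R (\<Sum>b\<in>Basis. (u \<bullet> b) *\<^sub>R G y b c))"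
    "\<And>y X Y. y \<in> U \<Longrightarrow> X \<in> vector_fields M \<Longrightarrow> Y \<in> vector_fields M \<Longrightarrow>
      D X Y (param M i y) i = frechet_derivative (\<lambda>z. Y (param M i z) i) (at y) (X (param M i y) i)
        + christoffel M D i y (X (param M i y) i) (Y (param M i y) i)"
proof (rule connection_local_form[OF assms])
  fix U and G :: "'e \<Rightarrow> 'e \<Rightarrow> 'e \<Rightarrow> 'e"
  assume U: "open U" "y0 \<in> U" "U \<subseteq> image_of M i" and G: "\<And>b c. smooth_on (\<lambda>y. G y b c) U"
    and form: "\<And>y X Y. y \<in> U \<Longrightarrow> X \<in> vector_fields M \<Longrightarrow> Y \<in> vector_fields M \<Longrightarrow>
      D X Y (param M i y) i = frechet_derivative (\<lambda>z. Y (param M i z) i) (at y) (X (param M i y) i)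
        + (\<Sum>c\<in>Basis. (Y (param M i y) i \<bullet> c) *\<^sub>R
            (\<Sum>b\<in>Basis. (X (param M i y) i \<bullet> b) *\<^sub>R G y b c))"
  have chr: "christoffel M D i y u v = (\<Sum>c\<in>Basis. (v \<bullet> c) *\<^sub>R (\<Sum>b\<in>Basis. (u \<bullet> b) *\<^sub>R G y b c))"
    if y: "y \<in> U" for y u v
    unfolding christoffel_def
  proof (rule the_equality)
    have yi: "y \<in> image_of M i" using U y by auto
    fix w
    assume w: "\<forall>X\<in>vector_fields M. \<forall>Y\<in>vector_fields M.
        X (param M i y) i = u \<longrightarrow> Y (param M i y) i = v \<longrightarrow>
        D X Y (param M i y) i = frechet_derivative (\<lambda>z. Y (param M i z) i) (at y) u + w"
    obtain X where X: "X \<in> vector_fields M" "X (param M i y) i = u"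
      using vector_field_through_chart[OF i yi] .
    obtain Y where Y: "Y \<in> vector_fields M" "Y (param M i y) i = v"
      using vector_field_through_chart[OF i yi] .
    show "w = (\<Sum>c\<in>Basis. (v \<bullet> c) *\<^sub>R (\<Sum>b\<in>Basis. (u \<bullet> b) *\<^sub>R G y b c))"
      using w X Y form[OF y X(1) Y(1)] by fastforce
  qed (use form[OF y] in simp)
  show thesis
    by (rule that[OF U G chr]) (simp_all add: form chr)
qed

lemma connection_chart:
  "i \<in> indices M \<Longrightarrow> y \<in> image_of M i \<Longrightarrow> X \<in> vector_fields M \<Longrightarrow> Y \<in> vector_fields M \<Longrightarrow>
    D X Y (param M i y) i = frechet_derivative (\<lambda>z. Y (param M i z) i) (at y) (X (param M i y) i)
      + christoffel M D i y (X (param M i y) i) (Y (param M i y) i)"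
  by (rule christoffel_local_form) assumption+

lemma linear_christoffel:
  assumes "i \<in> indices M" "y \<in> image_of M i"
  shows "linear (\<lambda>u. christoffel M D i y u v)" "linear (christoffel M D i y u)"
proof -
  obtain U and G :: "'e \<Rightarrow> 'e \<Rightarrow> 'e \<Rightarrow> 'e" where "y \<in> U"
    and G: "\<And>y u v. y \<in> U \<Longrightarrow> christoffel M D i y u v =
      (\<Sum>c\<in>Basis. (v \<bullet> c) *\<^sub>R (\<Sum>b\<in>Basis. (u \<bullet> b) *\<^sub>R G y b c))"
    by (rule christoffel_local_form[OF assms]) (rule that)
  note G = G[OF \<open>y \<in> U\<close>]
  show "linear (\<lambda>u. christoffel M D i y u v)" "linear (christoffel M D i y u)"
    by (rule linearI; simp add: G inner_add_left scaleR_add_left scaleR_add_right sum.distrib scaleR_sum_right mult_ac ring_distribs)+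
qed

lemma smooth_christoffel:
  assumes i: "i \<in> indices M"
  shows "smooth_on (\<lambda>y. christoffel M D i y u v) (image_of M i)"
proof (rule smooth_on_local)
  fix y assume "y \<in> image_of M i"
  then obtain U and G :: "'e \<Rightarrow> 'e \<Rightarrow> 'e \<Rightarrow> 'e" where U: "open U" "y \<in> U" "\<And>b c. smooth_on (\<lambda>y. G y b c) U"
    and G: "\<And>y u v. y \<in> U \<Longrightarrow> christoffel M D i y u v =
      (\<Sum>c\<in>Basis. (v \<bullet> c) *\<^sub>R (\<Sum>b\<in>Basis. (u \<bullet> b) *\<^sub>R G y b c))"
    by (rule christoffel_local_form[OF i]) (rule that)
  have "smooth_on (\<lambda>y. \<Sum>c\<in>Basis. (v \<bullet> c) *\<^sub>R (\<Sum>b\<in>Basis. (u \<bullet> b) *\<^sub>R G y b c)) U"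
    by (intro smooth_intros U)
  then have "smooth_on (\<lambda>y. christoffel M D i y u v) U"
    by (rule smooth_on_cong[OF U(1), rotated]) (simp add: G)
  then show "\<exists>U. open U \<and> y \<in> U \<and> smooth_on (\<lambda>y. christoffel M D i y u v) U"
    using U by blast
qed

end

section \<open>The cotangent bundle as a manifold\<close>

text \<open>The inverse of \<open>covector_coords\<close> on the fibre: the coordinate row acts
  through the inner product of the model space. The value 0 off the tangent space follows the
  convention of \<open>cotangent_space\<close>.\<close>

definition covector ::
  "('i, 'm, 'e::euclidean_space) manifold \<Rightarrow> 'i \<Rightarrow> 'm \<Rightarrow> 'e \<Rightarrow> ('i \<Rightarrow> 'e) \<Rightarrow> real" where
  "covector M i x \<eta> = (\<lambda>v. if v \<in> tangent_space M x then \<eta> \<bullet> v i else 0)"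

lemma inner_sum_Basis: "(\<Sum>b\<in>Basis. f b *\<^sub>R b) \<bullet> u = (\<Sum>b\<in>Basis. f b * (u \<bullet> b))"
  unfolding inner_sum_left by (simp add: inner_commute)

text \<open>The Riesz representative of a functional, the common pattern behind
  \<open>covector_coords\<close> and \<open>horizontal_part\<close>.\<close>

lemma sum_linear_Basis:
  fixes f :: "'a::euclidean_space \<Rightarrow> real"
  assumes "linear f"
  shows "(\<Sum>b\<in>Basis. f b *\<^sub>R b) \<bullet> u = f u"
proof -
  have "f u = f (\<Sum>b\<in>Basis. (u \<bullet> b) *\<^sub>R b)" by (simp add: euclidean_representation)
  also have "\<dots> = (\<Sum>b\<in>Basis. (u \<bullet> b) * f b)"
    by (simp add: linear_sum[OF assms] linear_cmul[OF assms])
  finally show ?thesis by (simp add: inner_sum_Basis mult.commute)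
qed

lemma linear_covector_coords: "linear (covector_coords M i x)"
  by (rule linearI) (simp_all add: covector_coords_def scaleR_add_left sum.distrib scaleR_sum_right)

lemma covector_linear_on: "\<alpha> \<in> cotangent_space M x \<Longrightarrow> linear_on (tangent_space M x) \<alpha>"
  by (simp add: cotangent_space_def)

lemma covector_off: "\<alpha> \<in> cotangent_space M x \<Longrightarrow> v \<notin> tangent_space M x \<Longrightarrow> \<alpha> v = 0"
  by (simp add: cotangent_space_def)

lemma subspace_cotangent_space: "subspace (cotangent_space M x)"
  by (rule subspaceI) (auto simp: cotangent_space_def linear_on_def algebra_simps)

context smooth_atlas
begin

lemma covector_cotangent:
  assumes "i \<in> charts_at M x"
  shows "covector M i x \<eta> \<in> cotangent_space M x"
proof -
  have "subspace (tangent_space M x)" using assms by (auto simp: points_iff intro!: subspace_tangent_space)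
  from subspace_add[OF this] subspace_scale[OF this] show ?thesis
    by (auto simp: cotangent_space_def covector_def linear_on_def inner_add_right)
qed

lemma covector_coords_covector: "i \<in> charts_at M x \<Longrightarrow> covector_coords M i x (covector M i x \<eta>) = \<eta>"
  by (simp add: covector_coords_def covector_def coord_vector_tangent coord_vector_self euclidean_representation)

lemma covector_apply:
  assumes "i \<in> charts_at M x" "\<alpha> \<in> cotangent_space M x" "v \<in> tangent_space M x"
  shows "\<alpha> v = covector_coords M i x \<alpha> \<bullet> v i"
proof -
  have "linear (\<lambda>u. \<alpha> (coord_vector M i x u))"
    using covector_linear_on[OF assms(2)] linear_on_tangent_iff[OF assms(1)] by blast
  from sum_linear_Basis[OF this, of "v i"] show ?thesis
    by (simp only: covector_coords_def coord_vector_component[OF assms(1,3)])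
qed

lemma covector_component:
  assumes "i \<in> charts_at M x" "\<alpha> \<in> cotangent_space M x"
  shows "covector M i x (covector_coords M i x \<alpha>) = \<alpha>"
proof
  fix v
  show "covector M i x (covector_coords M i x \<alpha>) v = \<alpha> v"
    by (cases "v \<in> tangent_space M x")
      (simp_all add: covector_def covector_apply[OF assms] covector_off[OF assms(2)])
qed

lemma cotangent_eqI:
  assumes "i \<in> charts_at M x" "\<alpha> \<in> cotangent_space M x" "\<beta> \<in> cotangent_space M x"
    and "covector_coords M i x \<alpha> = covector_coords M i x \<beta>"
  shows "\<alpha> = \<beta>"
  using covector_component[OF assms(1,2)] covector_component[OF assms(1,3)] assms(4) by metis

section \<open>Canonical charts of the cotangent bundle\<close>

lemma indices_cotangent: "indices (cotangent_bundle M) = indices M"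
  by (simp add: cotangent_bundle_def)

lemma patch_cotangent: "a \<in> patch (cotangent_bundle M) i \<longleftrightarrow> fst a \<in> patch M i \<and> snd a \<in> cotangent_space M (fst a)"
  by (cases a) (simp add: cotangent_bundle_def)

lemma chart_cotangent: "chart (cotangent_bundle M) i a = (chart M i (fst a), covector_coords M i (fst a) (snd a))"
  by (cases a) (simp add: cotangent_bundle_def)

lemma charts_at_cotangent:
  "i \<in> charts_at (cotangent_bundle M) a \<longleftrightarrow> i \<in> charts_at M (fst a) \<and> snd a \<in> cotangent_space M (fst a)"
  by (auto simp: mem_charts_at indices_cotangent patch_cotangent)

lemma points_cotangent:
  "a \<in> points (cotangent_bundle M) \<longleftrightarrow> fst a \<in> points M \<and> snd a \<in> cotangent_space M (fst a)"
  by (auto simp: points_iff charts_at_cotangent)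

lemma inj_chart_cotangent:
  assumes "i \<in> indices M"
  shows "inj_on (chart (cotangent_bundle M) i) (patch (cotangent_bundle M) i)"
proof (rule inj_onI)
  fix a b
  assume a: "a \<in> patch (cotangent_bundle M) i" and b: "b \<in> patch (cotangent_bundle M) i"
    and eq: "chart (cotangent_bundle M) i a = chart (cotangent_bundle M) i b"
  then have "fst a = fst b"
    using inj_chart[OF assms] by (auto simp: chart_cotangent patch_cotangent inj_on_def)
  then show "a = b"
    using a b eq assms cotangent_eqI[of i "fst a" "snd a" "snd b"]
    by (simp add: chart_cotangent patch_cotangent mem_charts_at prod_eq_iff)
qed

lemma image_cotangent:
  assumes "i \<in> indices M"
  shows "image_of (cotangent_bundle M) i = image_of M i \<times> UNIV"
proof
  show "image_of (cotangent_bundle M) i \<subseteq> image_of M i \<times> UNIV"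
    by (auto simp: image_of_def chart_cotangent patch_cotangent)
  show "image_of M i \<times> UNIV \<subseteq> image_of (cotangent_bundle M) i"
  proof
    fix z :: "'e \<times> 'e" assume "z \<in> image_of M i \<times> UNIV"
    then have y: "fst z \<in> image_of M i" by auto
    have i: "i \<in> charts_at M (param M i (fst z))" using assms y by (rule param_charts_at)
    show "z \<in> image_of (cotangent_bundle M) i"
      unfolding image_of_def
      by (rule rev_image_eqI[of "(param M i (fst z), covector M i (param M i (fst z)) (snd z))"])
        (simp_all add: patch_cotangent chart_cotangent param_in_patch y covector_cotangent[OF i]
          covector_coords_covector[OF i] chart_param)
  qed
qed

lemma param_cotangent:
  assumes "i \<in> indices M" "y \<in> image_of M i"
  shows "param (cotangent_bundle M) i (y, \<eta>) = (param M i y, covector M i (param M i y) \<eta>)"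
  unfolding param_def[of "cotangent_bundle M"]
proof (rule inv_into_f_eq[OF inj_chart_cotangent[OF assms(1)]])
  have i: "i \<in> charts_at M (param M i y)" using assms by (rule param_charts_at)
  show "(param M i y, covector M i (param M i y) \<eta>) \<in> patch (cotangent_bundle M) i"
    by (simp add: patch_cotangent param_in_patch assms(2) covector_cotangent[OF i])
  show "chart (cotangent_bundle M) i (param M i y, covector M i (param M i y) \<eta>) = (y, \<eta>)"
    by (simp add: chart_cotangent chart_param assms(2) covector_coords_covector[OF i])
qed

lemma overlap_cotangent:
  assumes "i \<in> indices M"
  shows "overlap (cotangent_bundle M) i j = overlap M i j \<times> UNIV"
  using assms
  by (auto simp: overlap_def image_cotangent param_cotangent patch_cotangent intro!: covector_cotangent param_charts_at)

text \<open>Covector components change by the transpose of the inverse Jacobian. The inverse appears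
  as the Jacobian of the reverse transition from \<open>j\<close> to \<open>i\<close>, and the
  transpose as pairing \<open>\<eta>\<close> with its values on basis vectors.\<close>

lemma transition_cotangent:
  assumes "i \<in> indices M" "j \<in> indices M" "y \<in> overlap M i j"
  shows "transition (cotangent_bundle M) i j (y, \<eta>) =
    (transition M i j y,
     \<Sum>b\<in>Basis. (\<eta> \<bullet> frechet_derivative (transition M j i) (at (transition M i j y)) b) *\<^sub>R b)"
proof -
  define x where "x = param M i y"
  have y: "y \<in> image_of M i" "x \<in> patch M j" using assms(3) by (auto simp: overlap_def x_def)
  then have ij: "i \<in> charts_at M x" "j \<in> charts_at M x"
    using assms by (auto simp: mem_charts_at x_def param_in_patch)
  have t: "transition M i j y = chart M j x" by (simp add: transition_def x_def)
  show ?thesis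
    unfolding transition_def[of "cotangent_bundle M"] comp_def param_cotangent[OF assms(1) y(1)]
    by (simp add: chart_cotangent t flip: x_def)
      (simp add: covector_coords_def covector_def coord_vector_tangent[OF ij(2)] coord_vector_apply[OF ij(1)])
qed

lemma transition_in_overlap:
  "i \<in> indices M \<Longrightarrow> j \<in> indices M \<Longrightarrow> transition M i j ` overlap M i j \<subseteq> overlap M j i"
  by (auto simp: overlap_def transition_in_image param_transition[unfolded overlap_def] param_in_patch)

lemma smooth_transition_cotangent:
  assumes "i \<in> indices M" "j \<in> indices M"
  shows "smooth_on (transition (cotangent_bundle M) i j) (overlap (cotangent_bundle M) i j)"
proof -
  let ?S = "overlap M i j \<times> (UNIV :: 'e set)"
  have S: "open ?S" by (simp add: open_Times open_overlap assms)
  have t: "smooth_on (\<lambda>z. transition M i j (fst z)) ?S"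
    by (rule smooth_on_compose[OF S open_overlap[OF assms] smooth_transition[OF assms]])
      (auto intro!: smooth_intros S)
  have d: "smooth_on (\<lambda>z. frechet_derivative (transition M j i) (at (transition M i j (fst z))) b) ?S" for b
    by (rule smooth_on_compose[OF S open_overlap[OF assms(2,1)]
          smooth_on_derivative[OF smooth_transition[OF assms(2,1)]] t])
      (use transition_in_overlap[OF assms] in auto)
  have "smooth_on (\<lambda>z. (transition M i j (fst z),
      \<Sum>b\<in>Basis. (snd z \<bullet> frechet_derivative (transition M j i) (at (transition M i j (fst z))) b) *\<^sub>R b)) ?S"
    by (intro smooth_intros t d S)
  then show ?thesis
    unfolding overlap_cotangent[OF assms(1)]
    by (rule smooth_on_cong[OF S, rotated]) (auto simp: transition_cotangent[OF assms])
qed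

lemma smooth_atlas_cotangent: "smooth_atlas (cotangent_bundle M)"
proof
  show "i \<in> indices (cotangent_bundle M) \<Longrightarrow>
      inj_on (chart (cotangent_bundle M) i) (patch (cotangent_bundle M) i)" for i
    by (simp add: indices_cotangent inj_chart_cotangent)
  show "i \<in> indices (cotangent_bundle M) \<Longrightarrow> j \<in> indices (cotangent_bundle M) \<Longrightarrow>
      open (overlap (cotangent_bundle M) i j)" for i j
    by (simp add: indices_cotangent overlap_cotangent open_Times open_overlap)
  show "i \<in> indices (cotangent_bundle M) \<Longrightarrow> j \<in> indices (cotangent_bundle M) \<Longrightarrow>
      smooth_on (transition (cotangent_bundle M) i j) (overlap (cotangent_bundle M) i j)" for i j
    by (simp add: indices_cotangent smooth_transition_cotangent)
qed

text \<open>Continuity of the projection: in a canonical chart the preimage is the coordinate image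
  of \<open>V\<close> times the whole fibre.\<close>

lemma openin_cotangent_preimage:
  assumes "openin (manifold_topology M) V"
  shows "openin (manifold_topology (cotangent_bundle M)) {a \<in> points (cotangent_bundle M). fst a \<in> V}"
proof -
  interpret T: smooth_atlas "cotangent_bundle M" by (rule smooth_atlas_cotangent)
  show ?thesis
    unfolding T.openin_manifold
  proof (intro conjI ballI)
    fix i assume "i \<in> indices (cotangent_bundle M)"
    then have i: "i \<in> indices M" by (simp add: indices_cotangent)
    have "chart (cotangent_bundle M) i ` ({a \<in> points (cotangent_bundle M). fst a \<in> V} \<inter> patch (cotangent_bundle M) i)
        = {z \<in> image_of M i \<times> UNIV. param (cotangent_bundle M) i z \<in> {a \<in> points (cotangent_bundle M). fst a \<in> V}}"
      by (subst T.chart_image_Int_patch) (simp_all add: indices_cotangent i image_cotangent)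
    also have "\<dots> = {y \<in> image_of M i. param M i y \<in> V} \<times> UNIV"
      using i by (auto simp: param_cotangent points_cotangent param_in_points
          intro!: covector_cotangent param_charts_at)
    also have "open \<dots>"
      using assms i by (simp add: openin_manifold chart_image_Int_patch open_Times)
    finally show "open (chart (cotangent_bundle M) i `
        ({a \<in> points (cotangent_bundle M). fst a \<in> V} \<inter> patch (cotangent_bundle M) i))" .
  qed auto
qed

end

text \<open>Covectors over one point share a canonical chart and are separated there; covectors over
  distinct points are separated by pulling back neighbourhoods of these points. Countably many
  patches covering \<open>M\<close> also give a cover of the bundle.\<close>

lemma (in smooth_mfd) smooth_mfd_cotangent: "smooth_mfd (cotangent_bundle M)"
proof -
  let ?T = "cotangent_bundle M"
  interpret T: smooth_atlas ?T by (rule smooth_atlas_cotangent)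
  show ?thesis
  proof
    show "Hausdorff_space (manifold_topology ?T)"
      unfolding Hausdorff_space_def
    proof (intro allI impI)
      fix a b
      assume ab: "a \<in> topspace (manifold_topology ?T) \<and> b \<in> topspace (manifold_topology ?T) \<and> a \<noteq> b"
      then have pts: "a \<in> points ?T" "b \<in> points ?T" by (simp_all add: T.topspace_manifold)
      show "\<exists>U V. openin (manifold_topology ?T) U \<and> openin (manifold_topology ?T) V \<and> a \<in> U \<and> b \<in> V \<and> disjnt U V"
      proof (cases "fst a = fst b")
        case True
        obtain i where i: "i \<in> charts_at ?T a" using pts by (auto simp: points_iff)
        then have "i \<in> charts_at ?T b" using True pts by (auto simp: charts_at_cotangent points_cotangent)
        then show ?thesis using T.separate_in_patch[OF i] ab by metis
      next
        case False
        moreover have "fst a \<in> topspace (manifold_topology M)" "fst b \<in> topspace (manifold_topology M)"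
          using pts by (simp_all add: topspace_manifold points_cotangent)
        ultimately obtain U V where UV: "openin (manifold_topology M) U" "openin (manifold_topology M) V"
          "fst a \<in> U" "fst b \<in> V" "disjnt U V"
          using hausdorff unfolding Hausdorff_space_def by metis
        show ?thesis
          by (intro exI[of _ "{a \<in> points ?T. fst a \<in> U}"] exI[of _ "{a \<in> points ?T. fst a \<in> V}"])
            (use UV pts in \<open>auto intro!: openin_cotangent_preimage simp: disjnt_iff\<close>)
      qed
    qed
    obtain C where C: "countable C" "C \<subseteq> indices M" "points M \<subseteq> (\<Union>i\<in>C. patch M i)"
      by (rule countable_cover)
    show "second_countable (manifold_topology ?T)"
    proof (rule T.second_countable_countable_cover[OF C(1)])
      show "C \<subseteq> indices ?T" using C by (simp add: indices_cotangent)
      show "points ?T \<subseteq> (\<Union>i\<in>C. patch ?T i)"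
        using C(3) by (auto simp: points_cotangent patch_cotangent subset_iff)
    qed
  qed
qed

section \<open>Horizontal lifts in canonical charts\<close>

text \<open>The functional \<open>v \<mapsto> \<eta> \<bullet> christoffel M D i y u v\<close>,
  stored as a vector because canonical charts store covectors in this way.\<close>

definition horizontal_part ::
  "('i, 'm, 'e::euclidean_space) manifold \<Rightarrow>
   (('m \<Rightarrow> 'i \<Rightarrow> 'e) \<Rightarrow> ('m \<Rightarrow> 'i \<Rightarrow> 'e) \<Rightarrow> 'm \<Rightarrow> 'i \<Rightarrow> 'e) \<Rightarrow> 'i \<Rightarrow> 'e \<Rightarrow> 'e \<Rightarrow> 'e \<Rightarrow> 'e" where
  "horizontal_part M D i y \<eta> u = (\<Sum>b\<in>Basis. (\<eta> \<bullet> christoffel M D i y u b) *\<^sub>R b)"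

lemma tangent_off: "v \<in> tangent_space M x \<Longrightarrow> i \<notin> charts_at M x \<Longrightarrow> v i = 0"
  unfolding tangent_space_def by blast

text \<open>The curve is required to stay in one patch at all times, which holds for the affine
  lines in a fibre that define vertical lifts.\<close>

lemma (in smooth_atlas) velocity_eq_coord_vector:
  assumes i: "i \<in> indices M" and c: "\<And>s. c s \<in> patch M i"
    and d: "(chart M i \<circ> c has_vector_derivative u) (at t)"
  shows "velocity M c t = coord_vector M i (c t) u"
proof
  fix j
  have ic: "i \<in> charts_at M (c s)" for s using i c by (simp add: mem_charts_at)
  show "velocity M c t j = coord_vector M i (c t) u j"
  proof (cases "j \<in> charts_at M (c t)")
    case True
    have "((\<lambda>s. transition M i j ((chart M i \<circ> c) s)) has_derivative
        (\<lambda>h. jacobian M i j (c t) (h *\<^sub>R u))) (at t)"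
      by (rule has_derivative_compose[OF d[unfolded has_vector_derivative_def]])
        (use has_derivative_transition[OF ic True] in simp)
    then have "(chart M j \<circ> c has_vector_derivative jacobian M i j (c t) u) (at t)"
      unfolding has_vector_derivative_def
      by (simp add: transition_chart[OF ic] linear_cmul[OF linear_jacobian[OF ic True]] comp_def)
    then show ?thesis
      by (simp add: velocity_def coord_vector_def True vector_derivative_at)
  qed (simp add: velocity_def coord_vector_def)
qed

context smooth_mfd
begin

lemma jacobian_cotangent_fst:
  assumes "i \<in> charts_at (cotangent_bundle M) a" "j \<in> charts_at (cotangent_bundle M) a"
  shows "fst (jacobian (cotangent_bundle M) i j a w) = jacobian M i j (fst a) (fst w)"
proof -
  interpret T: smooth_mfd "cotangent_bundle M" by (rule smooth_mfd_cotangent)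
  have ij: "i \<in> charts_at M (fst a)" "j \<in> charts_at M (fst a)"
    using assms by (auto simp: charts_at_cotangent)
  have iI: "i \<in> indices M" "j \<in> indices M" using ij by (auto simp: mem_charts_at)
  have 1: "((\<lambda>z. fst (transition (cotangent_bundle M) i j z)) has_derivative
      (\<lambda>w. fst (jacobian (cotangent_bundle M) i j a w))) (at (chart (cotangent_bundle M) i a))"
    by (rule has_derivative_fst[OF T.has_derivative_transition[OF assms]])
  have "((\<lambda>z. transition M i j (fst z)) has_derivative (\<lambda>w. jacobian M i j (fst a) (fst w)))
      (at (chart (cotangent_bundle M) i a))"
    by (rule has_derivative_compose[OF has_derivative_fst[OF has_derivative_ident]])
      (use has_derivative_transition[OF ij] in \<open>simp add: chart_cotangent\<close>)
  then have 2: "((\<lambda>z. fst (transition (cotangent_bundle M) i j z)) has_derivative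
      (\<lambda>w. jacobian M i j (fst a) (fst w))) (at (chart (cotangent_bundle M) i a))"
    by (rule has_derivative_transform_within_open[OF _ T.open_overlap[of i j] T.chart_in_overlap[OF assms]])
      (auto simp: indices_cotangent iI overlap_cotangent transition_cotangent)
  from fun_cong[OF has_derivative_unique[OF 1 2], of w] show ?thesis .
qed

text \<open>The transition maps of the bundle cover those of \<open>M\<close>, so the chart picked
  by \<open>pushforward\<close> drops out and the base components can be read off in every
  chart.\<close>

lemma pushforward_fst:
  assumes "a \<in> points (cotangent_bundle M)" "w \<in> tangent_space (cotangent_bundle M) a"
  shows "pushforward (cotangent_bundle M) M fst a w = (\<lambda>j. fst (w j))"
proof
  fix j
  interpret T: smooth_mfd "cotangent_bundle M" by (rule smooth_mfd_cotangent)
  define i where "i = (SOME i. i \<in> charts_at (cotangent_bundle M) a)"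
  have i: "i \<in> charts_at (cotangent_bundle M) a"
    unfolding i_def by (rule T.some_chart[OF assms(1)])
  show "pushforward (cotangent_bundle M) M fst a w j = fst (w j)"
  proof (cases "j \<in> charts_at M (fst a)")
    case True
    then have j: "j \<in> charts_at (cotangent_bundle M) a"
      using assms(1) by (simp add: charts_at_cotangent points_cotangent)
    have "chart M j \<circ> fst \<circ> param (cotangent_bundle M) i = (\<lambda>z. fst (transition (cotangent_bundle M) i j z))"
      by (auto simp: transition_def chart_cotangent)
    moreover have "frechet_derivative (\<lambda>z. fst (transition (cotangent_bundle M) i j z))
        (at (chart (cotangent_bundle M) i a)) = (\<lambda>w. fst (jacobian (cotangent_bundle M) i j a w))"
      by (rule frechet_derivative_at[symmetric, OF has_derivative_fst[OF T.has_derivative_transition[OF i j]]])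
    ultimately show ?thesis
      using True T.tangent_jacobian[OF i j assms(2)]
      by (simp add: pushforward_def flip: i_def)
  next
    case False
    then have "j \<notin> charts_at (cotangent_bundle M) a" by (simp add: charts_at_cotangent)
    then show ?thesis using False tangent_off[OF assms(2)] by (simp add: pushforward_def)
  qed
qed

lemma pushforward_fst_tangent:
  assumes "a \<in> points (cotangent_bundle M)" "w \<in> tangent_space (cotangent_bundle M) a"
  shows "pushforward (cotangent_bundle M) M fst a w \<in> tangent_space M (fst a)"
proof -
  interpret T: smooth_mfd "cotangent_bundle M" by (rule smooth_mfd_cotangent)
  have ch: "charts_at (cotangent_bundle M) a = charts_at M (fst a)"
    using assms(1) by (auto simp: charts_at_cotangent points_cotangent)
  show ?thesis
    unfolding pushforward_fst[OF assms] tangent_space_def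
  proof (intro CollectI conjI ballI allI impI)
    show "fst (w j) = jacobian M i j (fst a) (fst (w i))"
      if "i \<in> charts_at M (fst a)" "j \<in> charts_at M (fst a)" for i j
      using T.tangent_jacobian[OF _ _ assms(2), of i j] jacobian_cotangent_fst[of i a j "w i"] that ch by simp
    show "fst (w i) = 0" if "i \<notin> charts_at M (fst a)" for i
      using tangent_off[OF assms(2), of i] that ch by simp
  qed
qed

text \<open>In a canonical chart the evaluation function is
  \<open>(y, \<eta>) \<mapsto> \<eta> \<bullet> Y (param M i y) i\<close>; the two summands come
  from the product rule.\<close>

lemma deriv_along_evaluation:
  assumes a: "a \<in> points (cotangent_bundle M)" and i: "i \<in> charts_at M (fst a)"
    and w: "w \<in> tangent_space (cotangent_bundle M) a" and Y: "Y \<in> vector_fields M"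
  shows "deriv_along (cotangent_bundle M) a w (\<lambda>(y, \<beta>). \<beta> (Y y)) =
    snd (w i) \<bullet> Y (fst a) i + covector_coords M i (fst a) (snd a) \<bullet>
      frechet_derivative (\<lambda>z. Y (param M i z) i) (at (chart M i (fst a))) (fst (w i))"
proof -
  interpret T: smooth_mfd "cotangent_bundle M" by (rule smooth_mfd_cotangent)
  have iT: "i \<in> charts_at (cotangent_bundle M) a"
    using a i by (simp add: charts_at_cotangent points_cotangent)
  have iI: "i \<in> indices M" using i by (simp add: mem_charts_at)
  define y where "y = chart M i (fst a)"
  define \<eta> where "\<eta> = covector_coords M i (fst a) (snd a)"
  have yi: "y \<in> image_of M i" using i by (simp add: y_def mem_charts_at chart_in_image)
  have cy: "chart (cotangent_bundle M) i a = (y, \<eta>)" by (simp add: chart_cotangent y_def \<eta>_def)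
  have px: "param M i y = fst a" by (simp add: y_def param_chart[OF i])
  define Y' where "Y' = frechet_derivative (\<lambda>z. Y (param M i z) i) (at y)"
  have dY: "((\<lambda>z. Y (param M i z) i) has_derivative Y') (at y)"
    unfolding Y'_def by (rule smooth_on_has_derivative[OF vector_field_smooth[OF Y iI] yi])
  have "((\<lambda>z. Y (param M i (fst z)) i) has_derivative (\<lambda>u. Y' (fst u))) (at (y, \<eta>))"
    by (rule has_derivative_compose[OF has_derivative_fst[OF has_derivative_ident]]) (simp add: dY)
  from has_derivative_inner[OF has_derivative_snd[OF has_derivative_ident] this]
  have "((\<lambda>z. snd z \<bullet> Y (param M i (fst z)) i) has_derivative
      (\<lambda>u. \<eta> \<bullet> Y' (fst u) + snd u \<bullet> Y (fst a) i)) (at (y, \<eta>))"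
    by (simp add: px)
  then have "((\<lambda>(y, \<beta>). \<beta> (Y y)) \<circ> param (cotangent_bundle M) i has_derivative
      (\<lambda>u. \<eta> \<bullet> Y' (fst u) + snd u \<bullet> Y (fst a) i)) (at (y, \<eta>))"
  proof (rule has_derivative_transform_within_open)
    show "open (image_of (cotangent_bundle M) i)" by (rule T.open_image) (simp add: indices_cotangent iI)
    show "(y, \<eta>) \<in> image_of (cotangent_bundle M) i" using yi by (simp add: image_cotangent iI)
    show "snd z \<bullet> Y (param M i (fst z)) i = ((\<lambda>(y, \<beta>). \<beta> (Y y)) \<circ> param (cotangent_bundle M) i) z"
      if "z \<in> image_of (cotangent_bundle M) i" for z
      using that vector_field_tangent[OF Y param_in_points[OF iI]]
      by (cases z) (auto simp: image_cotangent iI param_cotangent covector_def)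
  qed
  from T.deriv_along_chart[OF iT w, unfolded cy, OF this] show ?thesis
    by (simp add: Y'_def y_def \<eta>_def)
qed

end

context connection_mfd
begin

lemma inner_horizontal_part:
  assumes "i \<in> indices M" "y \<in> image_of M i"
  shows "horizontal_part M D i y \<eta> u \<bullet> v = \<eta> \<bullet> christoffel M D i y u v"
  unfolding horizontal_part_def
  using sum_linear_Basis[where f="\<lambda>v. \<eta> \<bullet> christoffel M D i y u v"]
    linear_compose[OF linear_christoffel(2)[OF assms] bounded_linear.linear[OF bounded_linear_inner_right]]
  by (simp add: comp_def)

lemma linear_horizontal_part:
  assumes "i \<in> indices M" "y \<in> image_of M i"
  shows "linear (horizontal_part M D i y \<eta>)"
  by (rule linearI; rule euclidean_eqI)
    (simp_all add: inner_horizontal_part[OF assms] inner_add_left inner_add_right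
      linear_add[OF linear_christoffel(1)[OF assms]] linear_cmul[OF linear_christoffel(1)[OF assms]])

text \<open>The coordinate derivative of \<open>Y\<close> occurs on both sides of the horizontality
  condition and cancels. What remains depends on \<open>Y\<close> only through its value at the base
  point, and since that value is arbitrary it fixes the fibre component.\<close>

lemma horizontal_space_iff:
  assumes a: "a \<in> points (cotangent_bundle M)" and i: "i \<in> charts_at M (fst a)"
    and w: "w \<in> tangent_space (cotangent_bundle M) a"
  shows "w \<in> horizontal_space M D a \<longleftrightarrow>
    snd (w i) = horizontal_part M D i (chart M i (fst a)) (covector_coords M i (fst a) (snd a)) (fst (w i))"
proof -
  define x where "x = fst a"
  define y where "y = chart M i x"
  define \<eta> where "\<eta> = covector_coords M i x (snd a)"
  have ix: "i \<in> charts_at M x" using i by (simp add: x_def)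
  have iI: "i \<in> indices M" and yi: "y \<in> image_of M i" using ix by (simp_all add: y_def mem_charts_at chart_in_image)
  have px: "param M i y = x" by (simp add: y_def param_chart[OF ix])
  have xM: "x \<in> points M" using ix by (auto simp: points_iff)
  have cot: "snd a \<in> cotangent_space M x" using a by (simp add: points_cotangent x_def)
  have key: "deriv_along (cotangent_bundle M) a w (\<lambda>(y, \<beta>). \<beta> (Y y)) = snd a (D X Y x) \<longleftrightarrow>
      snd (w i) \<bullet> Y x i = horizontal_part M D i y \<eta> (fst (w i)) \<bullet> Y x i"
    if X: "X \<in> vector_fields M" and Y: "Y \<in> vector_fields M" and Xx: "X x i = fst (w i)" for X Y
  proof -
    have "snd a (D X Y x) = \<eta> \<bullet> D X Y x i"
      unfolding \<eta>_def by (rule covector_apply[OF ix cot vector_field_tangent[OF connection_field[OF X Y] xM]])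
    also have "D X Y x i = frechet_derivative (\<lambda>z. Y (param M i z) i) (at y) (fst (w i)) +
        christoffel M D i y (fst (w i)) (Y x i)"
      using connection_chart[OF iI yi X Y] by (simp add: px Xx)
    finally show ?thesis
      unfolding deriv_along_evaluation[OF a i w Y] inner_horizontal_part[OF iI yi]
      by (simp add: inner_add_right flip: x_def y_def \<eta>_def)
  qed
  have push: "pushforward (cotangent_bundle M) M fst a w = (\<lambda>j. fst (w j))"
    by (rule pushforward_fst[OF a w])
  show ?thesis
    unfolding x_def[symmetric] y_def[symmetric] \<eta>_def[symmetric]
  proof
    assume h: "w \<in> horizontal_space M D a"
    show "snd (w i) = horizontal_part M D i y \<eta> (fst (w i))"
    proof (rule euclidean_eqI)
      fix b :: 'e
      \<comment> \<open>Horizontality constrains \<open>w\<close> only if some global field extends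
        its projection. The field \<open>Y\<close> chosen next picks out the coordinate along
        \<open>b\<close>.\<close>
      obtain X where X: "X \<in> vector_fields M" "X x = pushforward (cotangent_bundle M) M fst a w"
        using vector_field_through[OF xM pushforward_fst_tangent[OF a w, folded x_def]] .
      obtain Y where Y: "Y \<in> vector_fields M" "Y (param M i y) i = b"
        using vector_field_through_chart[OF iI yi] .
      have "deriv_along (cotangent_bundle M) a w (\<lambda>(y, \<beta>). \<beta> (Y y)) = snd a (D X Y x)"
        using h X Y(1) by (simp add: horizontal_space_def x_def)
      then show "snd (w i) \<bullet> b = horizontal_part M D i y \<eta> (fst (w i)) \<bullet> b"
        using key[OF X(1) Y(1)] X(2) Y(2) by (simp add: push px)
    qed
  next
    assume e: "snd (w i) = horizontal_part M D i y \<eta> (fst (w i))"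
    show "w \<in> horizontal_space M D a"
      using key e w by (auto simp: horizontal_space_def push simp flip: x_def)
  qed
qed

text \<open>The projection prescribes the base component and horizontality determines the fibre
  component from it, so the definite description has exactly one solution.\<close>

lemma horizontal_lift_chart:
  assumes a: "a \<in> points (cotangent_bundle M)" and i: "i \<in> charts_at M (fst a)"
    and v: "v \<in> tangent_space M (fst a)"
  shows "horizontal_lift M D a v = coord_vector (cotangent_bundle M) i a
    (v i, horizontal_part M D i (chart M i (fst a)) (covector_coords M i (fst a) (snd a)) (v i))"
    (is "_ = ?W")
  unfolding horizontal_lift_def
proof (rule the_equality)
  interpret T: smooth_mfd "cotangent_bundle M" by (rule smooth_mfd_cotangent)
  have iT: "i \<in> charts_at (cotangent_bundle M) a"
    using a i by (simp add: charts_at_cotangent points_cotangent)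
  have W: "?W \<in> tangent_space (cotangent_bundle M) a" by (rule T.coord_vector_tangent[OF iT])
  have Wi: "?W i = (v i, horizontal_part M D i (chart M i (fst a)) (covector_coords M i (fst a) (snd a)) (v i))"
    by (rule T.coord_vector_self[OF iT])
  have "pushforward (cotangent_bundle M) M fst a ?W = v"
    by (rule tangent_eqI[OF i pushforward_fst_tangent[OF a W] v]) (simp add: pushforward_fst[OF a W] Wi)
  then show "?W \<in> horizontal_space M D a \<and> pushforward (cotangent_bundle M) M fst a ?W = v"
    by (simp add: horizontal_space_iff[OF a i W] Wi)
  fix w assume "w \<in> horizontal_space M D a \<and> pushforward (cotangent_bundle M) M fst a w = v"
  then have h: "w \<in> horizontal_space M D a" and p: "pushforward (cotangent_bundle M) M fst a w = v" by auto
  have w: "w \<in> tangent_space (cotangent_bundle M) a" using h by (simp add: horizontal_space_def)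
  have "fst (w i) = v i" using p by (auto simp: pushforward_fst[OF a w])
  then show "w = ?W"
    using h by (intro T.tangent_eqI[OF iT w W]) (simp add: horizontal_space_iff[OF a i w] Wi prod_eq_iff)
qed

section \<open>The bundle morphism in canonical charts\<close>

lemma vertical_lift_chart:
  assumes a: "a \<in> points (cotangent_bundle M)" and i: "i \<in> charts_at M (fst a)"
    and \<beta>: "\<beta> \<in> cotangent_space M (fst a)"
  shows "vertical_lift M a \<beta> = coord_vector (cotangent_bundle M) i a (0, covector_coords M i (fst a) \<beta>)"
proof -
  interpret T: smooth_mfd "cotangent_bundle M" by (rule smooth_mfd_cotangent)
  have cot: "snd a \<in> cotangent_space M (fst a)" using a by (simp add: points_cotangent)
  have "(chart (cotangent_bundle M) i \<circ> (\<lambda>t. (fst a, snd a + t *\<^sub>R \<beta>)) has_vector_derivative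
      (0, covector_coords M i (fst a) \<beta>)) (at 0)"
    unfolding comp_def chart_cotangent
    by (auto simp: linear_add[OF linear_covector_coords] linear_cmul[OF linear_covector_coords]
        intro!: derivative_eq_intros)
  from T.velocity_eq_coord_vector[OF _ _ this]
  show ?thesis
    using i subspace_add[OF subspace_cotangent_space cot subspace_scale[OF subspace_cotangent_space \<beta>]]
    by (simp add: vertical_lift_def indices_cotangent mem_charts_at patch_cotangent)
qed

lemma Phi_chart:
  assumes a: "a \<in> points (cotangent_bundle M)" and i: "i \<in> charts_at M (fst a)"
    and "X \<in> tangent_space M (fst a)" "\<beta> \<in> cotangent_space M (fst a)"
  shows "Phi M D a (X, \<beta>) = coord_vector (cotangent_bundle M) i a
    (X i, horizontal_part M D i (chart M i (fst a)) (covector_coords M i (fst a) (snd a)) (X i)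
      + covector_coords M i (fst a) \<beta>)"
proof -
  interpret T: smooth_mfd "cotangent_bundle M" by (rule smooth_mfd_cotangent)
  have "i \<in> charts_at (cotangent_bundle M) a"
    using a i by (simp add: charts_at_cotangent points_cotangent)
  then show ?thesis
    by (simp add: Phi_def horizontal_lift_chart[OF a i] vertical_lift_chart[OF a i] assms
        flip: linear_add[OF T.linear_coord_vector])
qed

lemma linear_on_Phi:
  assumes a: "a \<in> points (cotangent_bundle M)"
  shows "linear_on (gen_tangent_space M (fst a)) (Phi M D a)"
proof -
  interpret T: smooth_mfd "cotangent_bundle M" by (rule smooth_mfd_cotangent)
  have "fst a \<in> points M" using a by (simp add: points_cotangent)
  then obtain i where i: "i \<in> charts_at M (fst a)" by (auto simp: points_iff)
  have iT: "i \<in> charts_at (cotangent_bundle M) a"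
    using a i by (simp add: charts_at_cotangent points_cotangent)
  have iI: "i \<in> indices M" and yi: "chart M i (fst a) \<in> image_of M i"
    using i by (simp_all add: mem_charts_at chart_in_image)
  have sub: "subspace (tangent_space M (fst a))"
    using a by (auto simp: points_cotangent intro!: subspace_tangent_space)
  define h where "h = horizontal_part M D i (chart M i (fst a)) (covector_coords M i (fst a) (snd a))"
  have h: "linear h" unfolding h_def by (rule linear_horizontal_part[OF iI yi])
  define P where "P = (\<lambda>z. (fst z i, h (fst z i) + covector_coords M i (fst a) (snd z)))"
  have P: "Phi M D a z = coord_vector (cotangent_bundle M) i a (P z)" if "z \<in> gen_tangent_space M (fst a)" for z
    using that Phi_chart[OF a i, of "fst z" "snd z"] by (auto simp: gen_tangent_space_def P_def h_def)
  have Padd: "P (z + z') = P z + P z'" for z z'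
    by (simp add: P_def linear_add[OF h] linear_add[OF linear_covector_coords])
  have Pscale: "P (r *\<^sub>R z) = r *\<^sub>R P z" for r z
    by (simp add: P_def linear_cmul[OF h] linear_cmul[OF linear_covector_coords] scaleR_add_right)
  have add: "z + z' \<in> gen_tangent_space M (fst a)"
    if "z \<in> gen_tangent_space M (fst a)" "z' \<in> gen_tangent_space M (fst a)" for z z'
    using that subspace_add[OF sub] subspace_add[OF subspace_cotangent_space]
    by (auto simp: gen_tangent_space_def)
  have scale: "r *\<^sub>R z \<in> gen_tangent_space M (fst a)" if "z \<in> gen_tangent_space M (fst a)" for r z
    using that subspace_scale[OF sub] subspace_scale[OF subspace_cotangent_space]
    by (auto simp: gen_tangent_space_def)
  show ?thesis
    unfolding linear_on_def
    by (simp add: P add scale Padd Pscale linear_add[OF T.linear_coord_vector[OF iT]]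
        linear_cmul[OF T.linear_coord_vector[OF iT]])
qed

text \<open>In coordinates the map is the shear
  \<open>(u, \<xi>) \<mapsto> (u, ?h u + \<xi>)\<close>, which is invertible whatever the
  Christoffel symbols are.\<close>

lemma bij_betw_Phi:
  assumes a: "a \<in> points (cotangent_bundle M)"
  shows "bij_betw (Phi M D a) (gen_tangent_space M (fst a)) (tangent_space (cotangent_bundle M) a)"
proof -
  interpret T: smooth_mfd "cotangent_bundle M" by (rule smooth_mfd_cotangent)
  have "fst a \<in> points M" using a by (simp add: points_cotangent)
  then obtain i where i: "i \<in> charts_at M (fst a)" by (auto simp: points_iff)
  have iT: "i \<in> charts_at (cotangent_bundle M) a"
    using a i by (simp add: charts_at_cotangent points_cotangent)
  let ?h = "horizontal_part M D i (chart M i (fst a)) (covector_coords M i (fst a) (snd a))"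
  show ?thesis
  proof (rule bij_betw_imageI)
    show "inj_on (Phi M D a) (gen_tangent_space M (fst a))"
    proof (rule inj_onI)
      fix z z'
      assume z: "z \<in> gen_tangent_space M (fst a)" and z': "z' \<in> gen_tangent_space M (fst a)"
        and eq: "Phi M D a z = Phi M D a z'"
      obtain X \<beta> X' \<beta>' where zz: "z = (X, \<beta>)" "z' = (X', \<beta>')" by (metis surj_pair)
      have mem: "X \<in> tangent_space M (fst a)" "\<beta> \<in> cotangent_space M (fst a)"
          "X' \<in> tangent_space M (fst a)" "\<beta>' \<in> cotangent_space M (fst a)"
        using z z' by (auto simp: zz gen_tangent_space_def)
      have "Phi M D a z i = Phi M D a z' i" using eq by simp
      then have "X i = X' i" "covector_coords M i (fst a) \<beta> = covector_coords M i (fst a) \<beta>'"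
        by (auto simp: zz Phi_chart[OF a i] mem T.coord_vector_self[OF iT])
      then show "z = z'"
        using tangent_eqI[OF i mem(1,3)] cotangent_eqI[OF i mem(2,4)] by (simp add: zz)
    qed
    show "Phi M D a ` gen_tangent_space M (fst a) = tangent_space (cotangent_bundle M) a"
    proof
      show "Phi M D a ` gen_tangent_space M (fst a) \<subseteq> tangent_space (cotangent_bundle M) a"
        by (auto simp: gen_tangent_space_def Phi_chart[OF a i] intro!: T.coord_vector_tangent[OF iT])
      show "tangent_space (cotangent_bundle M) a \<subseteq> Phi M D a ` gen_tangent_space M (fst a)"
      proof
        fix w assume w: "w \<in> tangent_space (cotangent_bundle M) a"
        \<comment> \<open>The inverse shear: the base component is kept, and its horizontal part is
          subtracted from the fibre component.\<close>
        let ?z = "(coord_vector M i (fst a) (fst (w i)), covector M i (fst a) (snd (w i) - ?h (fst (w i))))"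
        have "Phi M D a ?z = coord_vector (cotangent_bundle M) i a (w i)"
          by (simp add: Phi_chart[OF a i] coord_vector_tangent[OF i] covector_cotangent[OF i]
              coord_vector_self[OF i] covector_coords_covector[OF i])
        then have "Phi M D a ?z = w" by (simp only: T.coord_vector_component[OF iT w])
        moreover have "?z \<in> gen_tangent_space M (fst a)"
          by (simp add: gen_tangent_space_def coord_vector_tangent[OF i] covector_cotangent[OF i])
        ultimately show "w \<in> Phi M D a ` gen_tangent_space M (fst a)" by (metis image_eqI)
      qed
    qed
  qed
qed

lemma Phi_inv_chart:
  assumes a: "a \<in> points (cotangent_bundle M)" and i: "i \<in> charts_at M (fst a)"
  shows "Phi_inv M D a (coord_vector (cotangent_bundle M) i a (u, \<xi>)) =
    (coord_vector M i (fst a) u, covector M i (fst a)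
      (\<xi> - horizontal_part M D i (chart M i (fst a)) (covector_coords M i (fst a) (snd a)) u))"
  unfolding Phi_inv_def
  by (rule inv_into_f_eq[OF bij_betw_imp_inj_on[OF bij_betw_Phi[OF a]]])
    (simp_all add: gen_tangent_space_def coord_vector_tangent[OF i] covector_cotangent[OF i]
      Phi_chart[OF a i] coord_vector_self[OF i] covector_coords_covector[OF i])

lemma smooth_horizontal_part:
  assumes i: "i \<in> indices M" and S: "open S" and f: "smooth_on f S" "f ` S \<subseteq> image_of M i"
    and h: "smooth_on h S" "smooth_on k S"
  shows "smooth_on (\<lambda>z. horizontal_part M D i (f z) (h z) (k z)) S"
proof -
  have "smooth_on (\<lambda>z. christoffel M D i (f z) (k z) b) S" for b
    by (rule smooth_on_linear_family[OF S _ smooth_on_compose[OF S open_image[OF i] smooth_christoffel[OF i] f] h(2)])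
      (use linear_christoffel(1)[OF i] f(2) in blast)
  then show ?thesis
    unfolding horizontal_part_def by (intro smooth_intros S h)
qed

end

section \<open>The block form of the generalized structures\<close>

lemma linear_on_inv_into:
  assumes f: "linear_on V f" and V: "subspace V" and bij: "bij_betw f V W"
  shows "linear_on W (inv_into V f)"
proof -
  have inj: "inj_on f V" and W: "W = f ` V" using bij by (auto simp: bij_betw_def)
  show ?thesis
    unfolding linear_on_def W
  proof (intro conjI ballI allI; elim imageE; hypsubst)
    fix u v assume "u \<in> V" "v \<in> V"
    then show "inv_into V f (f u + f v) = inv_into V f (f u) + inv_into V f (f v)"
      using f inv_into_f_f[OF inj subspace_add[OF V, of u v]] by (simp add: linear_on_def inj)
  next
    fix r u assume "u \<in> V"
    then show "inv_into V f (r *\<^sub>R f u) = r *\<^sub>R inv_into V f (f u)"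
      using f inv_into_f_f[OF inj subspace_scale[OF V, of u r]] by (simp add: linear_on_def inj)
  qed
qed

lemma linear_on_compose:
  "linear_on V f \<Longrightarrow> f ` V \<subseteq> W \<Longrightarrow> linear_on W h \<Longrightarrow> linear_on V (h \<circ> f)"
  unfolding linear_on_def by (auto simp: image_subset_iff)

lemma linear_on_diff:
  assumes "linear_on V f" "subspace V" "u \<in> V" "v \<in> V"
  shows "f (u - v) = f u - f v"
proof -
  have "f (u - v + v) = f (u - v) + f v"
    using assms(1,4) subspace_diff[OF assms(2-4)] unfolding linear_on_def by blast
  then show ?thesis by simp
qed

lemma linear_on_neg:
  assumes "linear_on V f" "v \<in> V"
  shows "f (- v) = - f v"
proof -
  have "f ((- 1) *\<^sub>R v) = (- 1) *\<^sub>R f v" using assms unfolding linear_on_def by blast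
  then show ?thesis by simp
qed

section \<open>Gram matrices and the musical isomorphisms\<close>

locale metric_mfd = smooth_mfd M for M :: "('i, 'm, 'e::euclidean_space) manifold" +
  fixes g :: "'m \<Rightarrow> ('i \<Rightarrow> 'e) \<Rightarrow> ('i \<Rightarrow> 'e) \<Rightarrow> real"
  assumes metric: "pseudo_riemannian_metric M g"
begin

lemma metric_linear_on: "x \<in> points M \<Longrightarrow> u \<in> tangent_space M x \<Longrightarrow> linear_on (tangent_space M x) (g x u)"
  and metric_commute: "x \<in> points M \<Longrightarrow> u \<in> tangent_space M x \<Longrightarrow> v \<in> tangent_space M x \<Longrightarrow> g x u v = g x v u"
  and metric_nondegenerate: "x \<in> points M \<Longrightarrow> nondegenerate_on (tangent_space M x) (g x)"
  and smooth_metric: "i \<in> indices M \<Longrightarrow> smooth_on (\<lambda>y. g (param M i y) (coord_vector M i (param M i y) \<xi>)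
      (coord_vector M i (param M i y) \<zeta>)) (image_of M i)"
  using metric unfolding pseudo_riemannian_metric_def by blast+

lemma metric_right:
  assumes "x \<in> points M" "u \<in> tangent_space M x" "v \<in> tangent_space M x"
  shows "w \<in> tangent_space M x \<Longrightarrow> g x u (v + w) = g x u v + g x u w"
    "g x u (r *\<^sub>R v) = r * g x u v"
    "w \<in> tangent_space M x \<Longrightarrow> g x u (v - w) = g x u v - g x u w"
    "g x u (- v) = - g x u v"
  using metric_linear_on[OF assms(1,2)] assms(3) subspace_tangent_space[OF assms(1)]
  by (simp_all add: linear_on_diff linear_on_neg) (simp_all add: linear_on_def)

lemma metric_left:
  assumes x: "x \<in> points M" "u \<in> tangent_space M x" "v \<in> tangent_space M x"
  shows "w \<in> tangent_space M x \<Longrightarrow> g x (v + w) u = g x v u + g x w u"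
    "g x (r *\<^sub>R v) u = r * g x v u"
    "w \<in> tangent_space M x \<Longrightarrow> g x (v - w) u = g x v u - g x w u"
    "g x (- v) u = - g x v u"
  using metric_right[OF assms] metric_commute[OF assms(1) _ assms(2)] assms(3)
    subspace_add[OF subspace_tangent_space[OF x(1)]] subspace_scale[OF subspace_tangent_space[OF x(1)]]
    subspace_diff[OF subspace_tangent_space[OF x(1)]] subspace_neg[OF subspace_tangent_space[OF x(1)]]
  by simp_all

lemma flat_apply: "v \<in> tangent_space M x \<Longrightarrow> flat M g x X v = g x X v"
  by (simp add: flat_def)

lemma flat_cotangent: "x \<in> points M \<Longrightarrow> X \<in> tangent_space M x \<Longrightarrow> flat M g x X \<in> cotangent_space M x"
  using subspace_add[OF subspace_tangent_space] subspace_scale[OF subspace_tangent_space]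
  by (simp add: cotangent_space_def linear_on_def flat_def metric_right)

lemma flat_linear_on: "x \<in> points M \<Longrightarrow> linear_on (tangent_space M x) (flat M g x)"
  by (simp add: linear_on_def fun_eq_iff flat_def metric_left)

lemma inj_on_flat:
  assumes x: "x \<in> points M"
  shows "inj_on (flat M g x) (tangent_space M x)"
proof (rule inj_onI)
  fix u v assume u: "u \<in> tangent_space M x" and v: "v \<in> tangent_space M x"
    and eq: "flat M g x u = flat M g x v"
  have "g x (u - v) w = 0" if w: "w \<in> tangent_space M x" for w
    using fun_cong[OF eq, of w] by (simp add: flat_apply w metric_left(3)[OF x w u v])
  then have "u - v = 0"
    using metric_nondegenerate[OF x] subspace_diff[OF subspace_tangent_space[OF x] u v]
    unfolding nondegenerate_on_def by blast
  then show "u = v" by simp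
qed

text \<open>The metric matrix of the chart as an endomorphism of the model space: pairing
  \<open>gram i y u\<close> with a component vector gives the metric, see
  \<open>metric_chart\<close>.\<close>

definition gram :: "'i \<Rightarrow> 'e \<Rightarrow> 'e \<Rightarrow> 'e" where
  "gram i y u = covector_coords M i (param M i y) (flat M g (param M i y) (coord_vector M i (param M i y) u))"

lemma linear_gram:
  assumes "i \<in> indices M" "y \<in> image_of M i"
  shows "linear (gram i y)"
proof -
  have "linear (\<lambda>u. flat M g (param M i y) (coord_vector M i (param M i y) u))"
    by (rule iffD1[OF linear_on_tangent_iff[OF param_charts_at[OF assms]] flat_linear_on[OF param_in_points[OF assms]]])
  from linear_compose[OF this linear_covector_coords[of M i "param M i y"]] show ?thesis
    by (simp add: comp_def gram_def[abs_def])
qed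

text \<open>Nondegeneracy gives injectivity. Surjectivity is a dimension count, carried out for
  \<open>gram\<close> on the Euclidean model space, since tangent vectors live in a function space
  that need not be finite-dimensional.\<close>

lemma bij_betw_flat:
  assumes x: "x \<in> points M"
  shows "bij_betw (flat M g x) (tangent_space M x) (cotangent_space M x)"
proof (rule bij_betw_imageI[OF inj_on_flat[OF x]])
  obtain i where i: "i \<in> charts_at M x" using x by (auto simp: points_iff)
  define y where "y = chart M i x"
  have y: "i \<in> indices M" "y \<in> image_of M i" "param M i y = x"
    using i by (simp_all add: y_def mem_charts_at chart_in_image param_chart[OF i])
  have "inj (gram i y)"
  proof (rule injI)
    fix u v assume "gram i y u = gram i y v"
    then have "flat M g x (coord_vector M i x u) = flat M g x (coord_vector M i x v)"
      by (intro cotangent_eqI[OF i flat_cotangent[OF x coord_vector_tangent[OF i]] flat_cotangent[OF x coord_vector_tangent[OF i]]])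
        (simp add: gram_def y)
    then have "coord_vector M i x u = coord_vector M i x v"
      by (rule inj_onD[OF inj_on_flat[OF x] _ coord_vector_tangent[OF i] coord_vector_tangent[OF i]])
    then show "u = v" using coord_vector_self[OF i] by metis
  qed
  then have surj: "surj (gram i y)" by (rule eucl.linear_inj_imp_surj[OF linear_gram[OF y(1,2)]])
  show "flat M g x ` tangent_space M x = cotangent_space M x"
  proof
    show "flat M g x ` tangent_space M x \<subseteq> cotangent_space M x" using flat_cotangent[OF x] by auto
    show "cotangent_space M x \<subseteq> flat M g x ` tangent_space M x"
    proof
      fix \<alpha> assume \<alpha>: "\<alpha> \<in> cotangent_space M x"
      obtain u where "gram i y u = covector_coords M i x \<alpha>" using surj by (metis surjD)
      then have "\<alpha> = flat M g x (coord_vector M i x u)"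
        by (intro cotangent_eqI[OF i \<alpha> flat_cotangent[OF x coord_vector_tangent[OF i]]]) (simp add: gram_def y)
      then show "\<alpha> \<in> flat M g x ` tangent_space M x" using coord_vector_tangent[OF i] by blast
    qed
  qed
qed

lemma sharp_flat: "x \<in> points M \<Longrightarrow> X \<in> tangent_space M x \<Longrightarrow> sharp M g x (flat M g x X) = X"
  by (simp add: sharp_def inv_into_f_f inj_on_flat)

lemma flat_sharp: "x \<in> points M \<Longrightarrow> \<alpha> \<in> cotangent_space M x \<Longrightarrow> flat M g x (sharp M g x \<alpha>) = \<alpha>"
  using bij_betw_inv_into_right[OF bij_betw_flat] by (simp add: sharp_def)

lemma sharp_tangent: "x \<in> points M \<Longrightarrow> \<alpha> \<in> cotangent_space M x \<Longrightarrow> sharp M g x \<alpha> \<in> tangent_space M x"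
  unfolding sharp_def using bij_betw_imp_surj_on[OF bij_betw_flat] inv_into_into by metis

text \<open>Every covector is written as \<open>flat M g x Z\<close>, so that \<open>sharp\<close>
  disappears from all later computations with the generalized structures.\<close>

lemma gen_tangent_flat:
  assumes "x \<in> points M" "z \<in> gen_tangent_space M x"
  obtains X Z where "z = (X, flat M g x Z)" "X \<in> tangent_space M x" "Z \<in> tangent_space M x"
proof (rule that)
  show "z = (fst z, flat M g x (sharp M g x (snd z)))" "fst z \<in> tangent_space M x"
    "sharp M g x (snd z) \<in> tangent_space M x"
    using assms by (auto simp: gen_tangent_space_def flat_sharp sharp_tangent)
qed

definition inv_gram :: "'i \<Rightarrow> 'e \<Rightarrow> 'e \<Rightarrow> 'e" where
  "inv_gram i y \<zeta> = sharp M g (param M i y) (covector M i (param M i y) \<zeta>) i"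

lemma inv_gram_gram:
  assumes "i \<in> indices M" "y \<in> image_of M i"
  shows "inv_gram i y (gram i y u) = u" "gram i y (inv_gram i y u) = u"
proof -
  have i: "i \<in> charts_at M (param M i y)" and x: "param M i y \<in> points M"
    using assms by (rule param_charts_at param_in_points)+
  note ct = coord_vector_tangent[OF i]
  show "inv_gram i y (gram i y u) = u"
    by (simp add: inv_gram_def gram_def covector_component[OF i flat_cotangent[OF x ct]]
        sharp_flat[OF x ct] coord_vector_self[OF i])
  show "gram i y (inv_gram i y u) = u"
    by (simp add: inv_gram_def gram_def covector_cotangent[OF i] flat_sharp[OF x] sharp_tangent[OF x]
        coord_vector_component[OF i] covector_coords_covector[OF i])
qed

lemma linear_inv_gram:
  assumes "i \<in> indices M" "y \<in> image_of M i"
  shows "linear (inv_gram i y)"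
  by (rule linear_right_inverse[OF linear_gram[OF assms]]) (simp_all add: inv_gram_gram[OF assms])

lemma metric_chart:
  assumes i: "i \<in> charts_at M x" and u: "u \<in> tangent_space M x" and v: "v \<in> tangent_space M x"
  shows "g x u v = gram i (chart M i x) (u i) \<bullet> v i"
proof -
  have x: "x \<in> points M" using i by (auto simp: points_iff)
  show ?thesis
    using covector_apply[OF i flat_cotangent[OF x u] v]
    by (simp add: flat_apply[OF v] gram_def param_chart[OF i] coord_vector_component[OF i u])
qed

lemma smooth_gram:
  assumes i: "i \<in> indices M"
  shows "smooth_on (\<lambda>y. gram i y u) (image_of M i)"
proof (rule smooth_on_cong[OF open_image[OF i]])
  show "smooth_on (\<lambda>y. \<Sum>b\<in>Basis. g (param M i y) (coord_vector M i (param M i y) u)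
      (coord_vector M i (param M i y) b) *\<^sub>R b) (image_of M i)"
    by (intro smooth_intros open_image i smooth_metric)
qed (simp add: gram_def covector_coords_def flat_def coord_vector_tangent[OF param_charts_at[OF i]])

lemma smooth_inv_gram:
  assumes i: "i \<in> indices M"
  shows "smooth_on (\<lambda>y. inv_gram i y w) (image_of M i)"
  by (rule smooth_on_inverse_family[OF open_image[OF i] linear_gram[OF i] smooth_gram[OF i]])
    (simp_all add: inv_gram_gram[OF i])

end

section \<open>The generalized structures for a symmetric endomorphism\<close>

locale endo_mfd = metric_mfd M g for M :: "('i, 'm, 'e::euclidean_space) manifold" and g +
  fixes J :: "'m \<Rightarrow> ('i \<Rightarrow> 'e) \<Rightarrow> 'i \<Rightarrow> 'e"
  assumes endo: "endomorphism_field M J" and symmetric: "metric_symmetric M g J"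
begin

lemma endo_tangent: "x \<in> points M \<Longrightarrow> v \<in> tangent_space M x \<Longrightarrow> J x v \<in> tangent_space M x"
  and endo_linear_on: "x \<in> points M \<Longrightarrow> linear_on (tangent_space M x) (J x)"
  and smooth_endo: "i \<in> indices M \<Longrightarrow>
    smooth_on (\<lambda>y. J (param M i y) (coord_vector M i (param M i y) u) i) (image_of M i)"
  using endo unfolding endomorphism_field_def by blast+

lemma endo_symmetric:
  "x \<in> points M \<Longrightarrow> u \<in> tangent_space M x \<Longrightarrow> v \<in> tangent_space M x \<Longrightarrow> g x (J x u) v = g x u (J x v)"
  using symmetric unfolding metric_symmetric_def by blast

lemma endo_arith:
  assumes "x \<in> points M" "v \<in> tangent_space M x"
  shows "w \<in> tangent_space M x \<Longrightarrow> J x (v + w) = J x v + J x w"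
    "J x (r *\<^sub>R v) = r *\<^sub>R J x v"
    "w \<in> tangent_space M x \<Longrightarrow> J x (v - w) = J x v - J x w"
    "J x (- v) = - J x v"
  using endo_linear_on[OF assms(1)] assms(2) subspace_tangent_space[OF assms(1)]
  by (simp_all add: linear_on_diff linear_on_neg) (simp_all add: linear_on_def)

lemma tangent_arith:
  assumes "x \<in> points M" "v \<in> tangent_space M x"
  shows "w \<in> tangent_space M x \<Longrightarrow> v + w \<in> tangent_space M x"
    "r *\<^sub>R v \<in> tangent_space M x"
    "w \<in> tangent_space M x \<Longrightarrow> v - w \<in> tangent_space M x"
    "- v \<in> tangent_space M x"
  using assms subspace_tangent_space[OF assms(1)]
  by (simp_all add: subspace_add subspace_scale subspace_diff subspace_neg)

lemmas tangent_simps = endo_tangent tangent_arith endo_arith metric_left metric_right endo_symmetric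

lemma flat_arith:
  assumes "x \<in> points M" "v \<in> tangent_space M x"
  shows "w \<in> tangent_space M x \<Longrightarrow> flat M g x (v + w) = flat M g x v + flat M g x w"
    "flat M g x (r *\<^sub>R v) = r *\<^sub>R flat M g x v"
    "w \<in> tangent_space M x \<Longrightarrow> flat M g x (v - w) = flat M g x v - flat M g x w"
  using flat_linear_on[OF assms(1)] assms(2) subspace_tangent_space[OF assms(1)]
  by (simp_all add: linear_on_diff) (simp_all add: linear_on_def)

lemma check_J_flat:
  assumes x: "x \<in> points M" and X: "X \<in> tangent_space M x" and Z: "Z \<in> tangent_space M x"
  shows "check_J M g J p q x (X, flat M g x Z) =
    (J x X + (- J x (J x Z) + p *\<^sub>R J x Z + q *\<^sub>R Z), flat M g x (X - J x Z + p *\<^sub>R Z))"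
proof -
  \<comment> \<open>Symmetry of \<open>J\<close> turns the dual endomorphism into \<open>J\<close>
    under \<open>flat\<close>, which produces the entry pI - J of the second row.\<close>
  have "dual_endo M J x (flat M g x Z) = flat M g x (J x Z)"
    using x Z by (auto simp: dual_endo_def flat_def fun_eq_iff tangent_simps)
  then show ?thesis
    using x X Z by (simp add: check_J_def Let_def sharp_flat flat_arith tangent_simps)
qed

lemma check_g_flat:
  assumes x: "x \<in> points M" and XZ: "X \<in> tangent_space M x" "Z \<in> tangent_space M x"
    and YW: "Y \<in> tangent_space M x" "W \<in> tangent_space M x"
  shows "check_g M g J p q x (X, flat M g x Z) (Y, flat M g x W) =
    g x X Y + (p\<^sup>2 + 4 * q) / 4 * g x Z W + p / 4 * (g x Z Y + g x X W)
      - 1 / 2 * (g x Z (J x Y) + g x X (J x W))"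
proof -
  have "g x W X = g x X W" "g x W (J x X) = g x X (J x W)"
    using metric_commute[OF x YW(2)] x XZ YW by (simp_all add: tangent_simps)
  then show ?thesis
    using x XZ YW by (simp add: check_g_def sharp_flat flat_apply endo_tangent)
qed

lemma subspace_gen_tangent_space: "x \<in> points M \<Longrightarrow> subspace (gen_tangent_space M x)"
  unfolding gen_tangent_space_def by (intro subspace_Times subspace_tangent_space subspace_cotangent_space)

lemma check_J_gen_tangent:
  assumes "x \<in> points M" "z \<in> gen_tangent_space M x"
  shows "check_J M g J p q x z \<in> gen_tangent_space M x"
proof -
  obtain X Z where "z = (X, flat M g x Z)" "X \<in> tangent_space M x" "Z \<in> tangent_space M x"
    using assms by (rule gen_tangent_flat)
  then show ?thesis
    using assms(1) by (simp add: check_J_flat) (simp add: gen_tangent_space_def flat_cotangent tangent_simps)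
qed

lemma check_J_linear_on:
  assumes x: "x \<in> points M"
  shows "linear_on (gen_tangent_space M x) (check_J M g J p q x)"
  unfolding linear_on_def
proof (intro conjI ballI allI)
  fix z z' assume z: "z \<in> gen_tangent_space M x" and z': "z' \<in> gen_tangent_space M x"
  obtain X Z where XZ: "z = (X, flat M g x Z)" "X \<in> tangent_space M x" "Z \<in> tangent_space M x"
    using x z by (rule gen_tangent_flat)
  obtain Y W where YW: "z' = (Y, flat M g x W)" "Y \<in> tangent_space M x" "W \<in> tangent_space M x"
    using x z' by (rule gen_tangent_flat)
  have sum: "z + z' = (X + Y, flat M g x (Z + W))"
    using x XZ YW by (simp add: flat_arith)
  show "check_J M g J p q x (z + z') = check_J M g J p q x z + check_J M g J p q x z'"
    unfolding sum unfolding XZ(1) YW(1)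
    using x XZ(2,3) YW(2,3) by (simp add: check_J_flat tangent_simps) (simp add: flat_arith tangent_simps algebra_simps)
next
  fix r z assume z: "z \<in> gen_tangent_space M x"
  obtain X Z where XZ: "z = (X, flat M g x Z)" "X \<in> tangent_space M x" "Z \<in> tangent_space M x"
    using x z by (rule gen_tangent_flat)
  have scale: "r *\<^sub>R z = (r *\<^sub>R X, flat M g x (r *\<^sub>R Z))"
    using x XZ by (simp add: flat_arith)
  show "check_J M g J p q x (r *\<^sub>R z) = r *\<^sub>R check_J M g J p q x z"
    unfolding scale unfolding XZ(1)
    using x XZ(2,3) by (simp add: check_J_flat tangent_simps) (simp add: flat_arith tangent_simps algebra_simps)
qed

text \<open>This is the Cayley-Hamilton identity for a 2x2 matrix over the commutative ring of
  polynomials in \<open>J\<close>: the trace is J + (pI - J) = pI, and the determinant is J(pI - J)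
  - (-J^2 + pJ + qI) = -qI.\<close>

lemma check_J_metallic:
  assumes x: "x \<in> points M" and z: "z \<in> gen_tangent_space M x"
  shows "check_J M g J p q x (check_J M g J p q x z) = p *\<^sub>R check_J M g J p q x z + q *\<^sub>R z"
proof -
  obtain X Z where XZ: "z = (X, flat M g x Z)" "X \<in> tangent_space M x" "Z \<in> tangent_space M x"
    using x z by (rule gen_tangent_flat)
  show ?thesis
    unfolding XZ(1)
    \<comment> \<open>The covector part stays a single \<open>flat\<close> while both applications
      are expanded by the block form; only afterwards is \<open>flat\<close> distributed over
      sums.\<close>
    using x XZ(2,3) by (simp add: check_J_flat tangent_simps) (simp add: flat_arith tangent_simps algebra_simps)
qed

lemma check_g_commute:
  assumes x: "x \<in> points M" and z: "z \<in> gen_tangent_space M x" and z': "z' \<in> gen_tangent_space M x"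
  shows "check_g M g J p q x z z' = check_g M g J p q x z' z"
proof -
  obtain X Z where XZ: "z = (X, flat M g x Z)" "X \<in> tangent_space M x" "Z \<in> tangent_space M x"
    using x z by (rule gen_tangent_flat)
  obtain Y W where YW: "z' = (Y, flat M g x W)" "Y \<in> tangent_space M x" "W \<in> tangent_space M x"
    using x z' by (rule gen_tangent_flat)
  show ?thesis
    using metric_commute[OF x XZ(2) YW(2)] metric_commute[OF x XZ(3) YW(3)]
    by (simp add: check_g_def XZ(1) YW(1) sharp_flat[OF x] XZ YW add.commute)
qed

lemma check_g_linear_on:
  assumes x: "x \<in> points M" and z: "z \<in> gen_tangent_space M x"
  shows "linear_on (gen_tangent_space M x) (check_g M g J p q x z)"
  unfolding linear_on_def
proof (intro conjI ballI allI)
  fix y y' assume y: "y \<in> gen_tangent_space M x" and y': "y' \<in> gen_tangent_space M x"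
  obtain X Z where XZ: "z = (X, flat M g x Z)" "X \<in> tangent_space M x" "Z \<in> tangent_space M x"
    using x z by (rule gen_tangent_flat)
  obtain Y W where YW: "y = (Y, flat M g x W)" "Y \<in> tangent_space M x" "W \<in> tangent_space M x"
    using x y by (rule gen_tangent_flat)
  obtain Y' W' where YW': "y' = (Y', flat M g x W')" "Y' \<in> tangent_space M x" "W' \<in> tangent_space M x"
    using x y' by (rule gen_tangent_flat)
  have sum: "y + y' = (Y + Y', flat M g x (W + W'))"
    using x YW YW' by (simp add: flat_arith)
  show "check_g M g J p q x z (y + y') = check_g M g J p q x z y + check_g M g J p q x z y'"
    unfolding sum unfolding XZ(1) YW(1) YW'(1)
    using x XZ(2,3) YW(2,3) YW'(2,3) by (simp add: check_g_flat tangent_simps) (simp add: field_simps)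
next
  fix r y assume y: "y \<in> gen_tangent_space M x"
  obtain X Z where XZ: "z = (X, flat M g x Z)" "X \<in> tangent_space M x" "Z \<in> tangent_space M x"
    using x z by (rule gen_tangent_flat)
  obtain Y W where YW: "y = (Y, flat M g x W)" "Y \<in> tangent_space M x" "W \<in> tangent_space M x"
    using x y by (rule gen_tangent_flat)
  have scale: "r *\<^sub>R y = (r *\<^sub>R Y, flat M g x (r *\<^sub>R W))"
    using x YW by (simp add: flat_arith)
  show "check_g M g J p q x z (r *\<^sub>R y) = r *\<^sub>R check_g M g J p q x z y"
    unfolding scale unfolding XZ(1) YW(1)
    using x XZ(2,3) YW(2,3) by (simp add: check_g_flat tangent_simps) (simp add: field_simps)
qed

text \<open>For commuting symmetric blocks, symmetry means that the Gram matrix times the matrix of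
  \<open>check_J\<close> has equal off-diagonal entries. Both equal -J^2/2 + pJ/4 + (p^2 + 4q)/4 I;
  given the other entries, this equality forces the coefficient of the dual part of
  \<open>check_g\<close>.\<close>

lemma check_g_symmetric:
  assumes x: "x \<in> points M" and z: "z \<in> gen_tangent_space M x" and z': "z' \<in> gen_tangent_space M x"
  shows "check_g M g J p q x (check_J M g J p q x z) z' = check_g M g J p q x z (check_J M g J p q x z')"
proof -
  obtain X Z where XZ: "z = (X, flat M g x Z)" "X \<in> tangent_space M x" "Z \<in> tangent_space M x"
    using x z by (rule gen_tangent_flat)
  obtain Y W where YW: "z' = (Y, flat M g x W)" "Y \<in> tangent_space M x" "W \<in> tangent_space M x"
    using x z' by (rule gen_tangent_flat)
  show ?thesis
    unfolding XZ(1) YW(1)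
    using x XZ(2,3) YW(2,3)
    by (simp add: check_J_flat check_g_flat tangent_simps)
      (simp add: field_simps power2_eq_square)
qed

definition endo_coords :: "'i \<Rightarrow> 'e \<Rightarrow> 'e \<Rightarrow> 'e" where
  "endo_coords i y u = J (param M i y) (coord_vector M i (param M i y) u) i"

lemma endo_chart:
  "i \<in> charts_at M x \<Longrightarrow> v \<in> tangent_space M x \<Longrightarrow> J x v i = endo_coords i (chart M i x) (v i)"
  by (simp only: endo_coords_def param_chart coord_vector_component)

lemma linear_endo_coords:
  assumes "i \<in> indices M" "y \<in> image_of M i"
  shows "linear (endo_coords i y)"
proof -
  have L: "linear (\<lambda>u. J (param M i y) (coord_vector M i (param M i y) u))"
    by (rule iffD1[OF linear_on_tangent_iff[OF param_charts_at[OF assms]] endo_linear_on[OF param_in_points[OF assms]]])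
  show ?thesis
    by (intro linearI) (simp_all add: endo_coords_def linear_add[OF L] linear_cmul[OF L])
qed

end

section \<open>The structures on the cotangent bundle\<close>

locale lifted_mfd = connection_mfd M D + endo_mfd M g J
  for M :: "('i, 'm, 'e::euclidean_space) manifold" and D g J +
  fixes p q :: real
  assumes metric_check_g: "is_metric_check_g M g J p q"
begin

lemma point_fst: "a \<in> points (cotangent_bundle M) \<Longrightarrow> fst a \<in> points M"
  by (simp add: points_cotangent)

lemma Phi_Phi_inv:
  "a \<in> points (cotangent_bundle M) \<Longrightarrow> w \<in> tangent_space (cotangent_bundle M) a \<Longrightarrow>
    Phi M D a (Phi_inv M D a w) = w"
  unfolding Phi_inv_def by (rule bij_betw_inv_into_right[OF bij_betw_Phi])

lemma Phi_inv_Phi: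
  "a \<in> points (cotangent_bundle M) \<Longrightarrow> z \<in> gen_tangent_space M (fst a) \<Longrightarrow>
    Phi_inv M D a (Phi M D a z) = z"
  unfolding Phi_inv_def by (rule bij_betw_inv_into_left[OF bij_betw_Phi])

lemma Phi_tangent:
  "a \<in> points (cotangent_bundle M) \<Longrightarrow> z \<in> gen_tangent_space M (fst a) \<Longrightarrow>
    Phi M D a z \<in> tangent_space (cotangent_bundle M) a"
  by (rule bij_betw_apply[OF bij_betw_Phi])

lemma Phi_inv_gen_tangent:
  "a \<in> points (cotangent_bundle M) \<Longrightarrow> w \<in> tangent_space (cotangent_bundle M) a \<Longrightarrow>
    Phi_inv M D a w \<in> gen_tangent_space M (fst a)"
  unfolding Phi_inv_def by (rule bij_betw_apply[OF bij_betw_inv_into[OF bij_betw_Phi]])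

lemma Phi_inv_linear_on:
  assumes a: "a \<in> points (cotangent_bundle M)"
  shows "linear_on (tangent_space (cotangent_bundle M) a) (Phi_inv M D a)"
  unfolding Phi_inv_def
  by (rule linear_on_inv_into[OF linear_on_Phi[OF a] subspace_gen_tangent_space[OF point_fst[OF a]] bij_betw_Phi[OF a]])

lemmas transport_simps = Phi_Phi_inv Phi_inv_Phi Phi_tangent Phi_inv_gen_tangent check_J_gen_tangent point_fst

lemma tilde_J_tangent:
  "a \<in> points (cotangent_bundle M) \<Longrightarrow> w \<in> tangent_space (cotangent_bundle M) a \<Longrightarrow>
    tilde_J M g D J p q a w \<in> tangent_space (cotangent_bundle M) a"
  by (simp add: tilde_J_def transport_simps)

lemma tilde_J_linear_on:
  assumes a: "a \<in> points (cotangent_bundle M)"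
  shows "linear_on (tangent_space (cotangent_bundle M) a) (tilde_J M g D J p q a)"
  unfolding tilde_J_def
  by (rule linear_on_compose[OF Phi_inv_linear_on[OF a] _
        linear_on_compose[OF check_J_linear_on[OF point_fst[OF a]] _ linear_on_Phi[OF a]]])
    (auto simp: a transport_simps)

text \<open>Conjugation by \<open>Phi\<close> preserves polynomial relations, so the metallic
  constants remain \<open>p\<close> and \<open>q\<close>.\<close>

lemma tilde_J_metallic:
  assumes a: "a \<in> points (cotangent_bundle M)" and w: "w \<in> tangent_space (cotangent_bundle M) a"
  shows "tilde_J M g D J p q a (tilde_J M g D J p q a w) = p *\<^sub>R tilde_J M g D J p q a w + q *\<^sub>R w"
proof -
  let ?z = "Phi_inv M D a w" and ?C = "check_J M g J p q (fst a)"
  have z: "?z \<in> gen_tangent_space M (fst a)" using a w by (rule Phi_inv_gen_tangent)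
  have x: "fst a \<in> points M" using a by (rule point_fst)
  have Cz: "?C ?z \<in> gen_tangent_space M (fst a)" using x z by (rule check_J_gen_tangent)
  note sub = subspace_gen_tangent_space[OF x]
  have "tilde_J M g D J p q a (tilde_J M g D J p q a w) = Phi M D a (p *\<^sub>R ?C ?z + q *\<^sub>R ?z)"
    by (simp add: tilde_J_def Phi_inv_Phi[OF a Cz] check_J_metallic[OF x z])
  also have "\<dots> = p *\<^sub>R Phi M D a (?C ?z) + q *\<^sub>R Phi M D a ?z"
    using linear_on_Phi[OF a] subspace_scale[OF sub Cz] subspace_scale[OF sub z] Cz z
    by (simp add: linear_on_def)
  finally show ?thesis by (simp add: tilde_J_def Phi_Phi_inv[OF a w])
qed

lemma tilde_g_linear_on:
  assumes a: "a \<in> points (cotangent_bundle M)" and u: "u \<in> tangent_space (cotangent_bundle M) a"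
  shows "linear_on (tangent_space (cotangent_bundle M) a) (tilde_g M g D J p q a u)"
proof -
  have "linear_on (tangent_space (cotangent_bundle M) a)
      (check_g M g J p q (fst a) (Phi_inv M D a u) \<circ> Phi_inv M D a)"
    by (rule linear_on_compose[OF Phi_inv_linear_on[OF a] _
          check_g_linear_on[OF point_fst[OF a] Phi_inv_gen_tangent[OF a u]]])
      (auto simp: a transport_simps)
  then show ?thesis by (simp add: tilde_g_def[abs_def] comp_def)
qed

lemma tilde_g_commute:
  "a \<in> points (cotangent_bundle M) \<Longrightarrow> u \<in> tangent_space (cotangent_bundle M) a \<Longrightarrow>
    v \<in> tangent_space (cotangent_bundle M) a \<Longrightarrow> tilde_g M g D J p q a u v = tilde_g M g D J p q a v u"
  unfolding tilde_g_def by (rule check_g_commute) (simp_all add: transport_simps)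

lemma tilde_g_symmetric:
  "a \<in> points (cotangent_bundle M) \<Longrightarrow> u \<in> tangent_space (cotangent_bundle M) a \<Longrightarrow>
    v \<in> tangent_space (cotangent_bundle M) a \<Longrightarrow>
    tilde_g M g D J p q a (tilde_J M g D J p q a u) v = tilde_g M g D J p q a u (tilde_J M g D J p q a v)"
  by (simp add: tilde_g_def tilde_J_def transport_simps check_g_symmetric)

text \<open>As \<open>Phi\<close> maps onto the tangent space, a vector orthogonal to all of it has
  a preimage orthogonal to the whole generalized tangent space, which vanishes by
  \<open>metric_check_g\<close>.\<close>

lemma tilde_g_nondegenerate:
  assumes a: "a \<in> points (cotangent_bundle M)"
  shows "nondegenerate_on (tangent_space (cotangent_bundle M) a) (tilde_g M g D J p q a)"
  unfolding nondegenerate_on_def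
proof (intro ballI impI)
  fix u assume u: "u \<in> tangent_space (cotangent_bundle M) a"
    and 0: "\<forall>v\<in>tangent_space (cotangent_bundle M) a. tilde_g M g D J p q a u v = 0"
  have x: "fst a \<in> points M" using a by (rule point_fst)
  have "check_g M g J p q (fst a) (Phi_inv M D a u) z = 0" if z: "z \<in> gen_tangent_space M (fst a)" for z
    using bspec[OF 0 Phi_tangent[OF a z]] by (simp add: tilde_g_def Phi_inv_Phi[OF a z])
  then have "Phi_inv M D a u = 0"
    using metric_check_g x Phi_inv_gen_tangent[OF a u]
    unfolding is_metric_check_g_def nondegenerate_on_def by blast
  \<comment> \<open>Zero is written as a multiple so that homogeneity of \<open>Phi\<close> on the
    generalized tangent space yields its value at zero.\<close>
  then have "u = Phi M D a (0 *\<^sub>R 0)" using Phi_Phi_inv[OF a u] by simp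
  also have "\<dots> = 0 *\<^sub>R Phi M D a 0"
    using linear_on_Phi[OF a] subspace_0[OF subspace_gen_tangent_space[OF x]] unfolding linear_on_def by blast
  finally show "u = 0" by simp
qed

section \<open>Coordinate expressions of the lifted structures\<close>

definition vertical_coords :: "'i \<Rightarrow> 'e \<times> 'e \<Rightarrow> 'e \<times> 'e \<Rightarrow> 'e" where
  "vertical_coords i z w = inv_gram i (fst z) (snd w - horizontal_part M D i (fst z) (snd z) (fst w))"

text \<open>The covector part of the preimage is put in the form \<open>flat\<close> of a vector,
  with components \<open>vertical_coords\<close>, so that the block formulas
  \<open>check_J_flat\<close> and \<open>check_g_flat\<close> apply directly.\<close>

lemma Phi_inv_coords:
  assumes i: "i \<in> indices M" and z: "z \<in> image_of M i \<times> UNIV"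
  defines "a \<equiv> param (cotangent_bundle M) i z"
  shows "Phi_inv M D a (coord_vector (cotangent_bundle M) i a w) =
    (coord_vector M i (fst a) (fst w), flat M g (fst a) (coord_vector M i (fst a) (vertical_coords i z w)))"
proof -
  have y: "fst z \<in> image_of M i" using z by auto
  have a_eq: "a = (param M i (fst z), covector M i (param M i (fst z)) (snd z))"
    unfolding a_def using param_cotangent[OF i y, of "snd z"] by simp
  have ix: "i \<in> charts_at M (fst a)" using param_charts_at[OF i y] by (simp add: a_eq)
  have x: "fst a \<in> points M" using ix by (auto simp: points_iff)
  have a: "a \<in> points (cotangent_bundle M)"
    using x covector_cotangent[OF ix] by (simp add: points_cotangent a_eq)
  have c: "chart M i (fst a) = fst z" "covector_coords M i (fst a) (snd a) = snd z"
    using covector_coords_covector[OF ix] by (simp_all add: a_eq chart_param[OF y])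
  have cot: "covector M i (fst a) \<zeta> \<in> cotangent_space M (fst a)" for \<zeta>
    by (rule covector_cotangent[OF ix])
  have "coord_vector M i (fst a) (inv_gram i (fst z) \<zeta>) = sharp M g (fst a) (covector M i (fst a) \<zeta>)" for \<zeta>
    unfolding inv_gram_def
    using coord_vector_component[OF ix sharp_tangent[OF x cot]] by (simp add: a_eq)
  then show ?thesis
    using Phi_inv_chart[OF a ix, of "fst w" "snd w"] by (simp add: c vertical_coords_def flat_sharp[OF x cot])
qed

text \<open>The new base component \<open>u\<close> occurs twice because mapping back by
  \<open>Phi\<close> adds its horizontal part to the fibre component.\<close>

lemma tilde_J_coords:
  fixes w :: "'e \<times> 'e"
  assumes i: "i \<in> indices M" and z: "z \<in> image_of M i \<times> UNIV"
  defines "a \<equiv> param (cotangent_bundle M) i z" and "J' \<equiv> endo_coords i (fst z)"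
    and "\<zeta> \<equiv> vertical_coords i z w"
  shows "tilde_J M g D J p q a (coord_vector (cotangent_bundle M) i a w) i =
    (let u = J' (fst w) + (- J' (J' \<zeta>) + p *\<^sub>R J' \<zeta> + q *\<^sub>R \<zeta>)
     in (u, horizontal_part M D i (fst z) (snd z) u + gram i (fst z) (fst w - J' \<zeta> + p *\<^sub>R \<zeta>)))"
proof -
  interpret T: smooth_mfd "cotangent_bundle M" by (rule smooth_mfd_cotangent)
  have y: "fst z \<in> image_of M i" using z by auto
  have a_eq: "a = (param M i (fst z), covector M i (param M i (fst z)) (snd z))"
    unfolding a_def using param_cotangent[OF i y, of "snd z"] by simp
  have ix: "i \<in> charts_at M (fst a)" using param_charts_at[OF i y] by (simp add: a_eq)
  have x: "fst a \<in> points M" using ix by (auto simp: points_iff)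
  have a: "a \<in> points (cotangent_bundle M)"
    using x covector_cotangent[OF ix] by (simp add: points_cotangent a_eq)
  have iT: "i \<in> charts_at (cotangent_bundle M) a"
    using a ix by (simp add: charts_at_cotangent points_cotangent)
  have c: "chart M i (fst a) = fst z" "covector_coords M i (fst a) (snd a) = snd z"
    using covector_coords_covector[OF ix] by (simp_all add: a_eq chart_param[OF y])
  have px: "param M i (fst z) = fst a" by (simp add: a_eq)
  define X where "X = coord_vector M i (fst a) (fst w)"
  define Z where "Z = coord_vector M i (fst a) \<zeta>"
  have XZ: "X \<in> tangent_space M (fst a)" "Z \<in> tangent_space M (fst a)"
    by (simp_all add: X_def Z_def coord_vector_tangent[OF ix])
  have comp: "X i = fst w" "Z i = \<zeta>" by (simp_all add: X_def Z_def coord_vector_self[OF ix])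
  have J: "J (fst a) v i = J' (v i)" if "v \<in> tangent_space M (fst a)" for v
    unfolding J'_def using endo_chart[OF ix that] by (simp add: c)
  define X' where "X' = J (fst a) X + (- J (fst a) (J (fst a) Z) + p *\<^sub>R J (fst a) Z + q *\<^sub>R Z)"
  define Z' where "Z' = X - J (fst a) Z + p *\<^sub>R Z"
  have XZ': "X' \<in> tangent_space M (fst a)" "Z' \<in> tangent_space M (fst a)"
    using x XZ by (simp_all add: X'_def Z'_def tangent_simps)
  have comp': "X' i = J' (fst w) + (- J' (J' \<zeta>) + p *\<^sub>R J' \<zeta> + q *\<^sub>R \<zeta>)" "Z' i = fst w - J' \<zeta> + p *\<^sub>R \<zeta>"
    using x XZ by (simp_all add: X'_def Z'_def J comp endo_tangent)
  have "covector_coords M i (fst a) (flat M g (fst a) Z') = gram i (fst z) (Z' i)"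
    by (simp add: gram_def px coord_vector_component[OF ix XZ'(2)])
  moreover have "tilde_J M g D J p q a (coord_vector (cotangent_bundle M) i a w) = Phi M D a (X', flat M g (fst a) Z')"
    unfolding tilde_J_def comp_def Phi_inv_coords[OF i z, folded a_def]
    by (simp add: check_J_flat[OF x XZ] X'_def Z'_def flip: X_def Z_def \<zeta>_def)
  ultimately show ?thesis
    by (simp add: Phi_chart[OF a ix XZ'(1) flat_cotangent[OF x XZ'(2)]] T.coord_vector_self[OF iT] c comp' Let_def)
qed

lemma tilde_g_coords:
  fixes w w' :: "'e \<times> 'e"
  assumes i: "i \<in> indices M" and z: "z \<in> image_of M i \<times> UNIV"
  defines "a \<equiv> param (cotangent_bundle M) i z" and "J' \<equiv> endo_coords i (fst z)" and "G \<equiv> gram i (fst z)"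
    and "\<zeta> \<equiv> vertical_coords i z w" and "\<zeta>' \<equiv> vertical_coords i z w'"
  shows "tilde_g M g D J p q a (coord_vector (cotangent_bundle M) i a w) (coord_vector (cotangent_bundle M) i a w') =
    G (fst w) \<bullet> fst w' + (p\<^sup>2 + 4 * q) / 4 * (G \<zeta> \<bullet> \<zeta>') + p / 4 * (G \<zeta> \<bullet> fst w' + G (fst w) \<bullet> \<zeta>')
      - 1 / 2 * (G \<zeta> \<bullet> J' (fst w') + G (fst w) \<bullet> J' \<zeta>')"
proof -
  have y: "fst z \<in> image_of M i" using z by auto
  have a_eq: "fst a = param M i (fst z)"
    unfolding a_def using param_cotangent[OF i y, of "snd z"] by simp
  have ix: "i \<in> charts_at M (fst a)" using param_charts_at[OF i y] by (simp add: a_eq)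
  have x: "fst a \<in> points M" using ix by (auto simp: points_iff)
  have c: "chart M i (fst a) = fst z" by (simp add: a_eq chart_param[OF y])
  note ct = coord_vector_tangent[OF ix]
  show ?thesis
    unfolding tilde_g_def Phi_inv_coords[OF i z, folded a_def] check_g_flat[OF x ct ct ct ct]
    by (simp add: metric_chart[OF ix] endo_chart[OF ix] ct endo_tangent[OF x] coord_vector_self[OF ix] c
        G_def J'_def \<zeta>_def \<zeta>'_def)
qed

section \<open>Smoothness in canonical charts\<close>

context
  fixes i and S :: "('e \<times> 'e) set"
  assumes i: "i \<in> indices M"
  defines "S \<equiv> image_of M i \<times> (UNIV :: 'e set)"
begin

lemma open_S: "open S"
  unfolding S_def by (simp add: open_Times open_image i)

text \<open>The family depends on the base point only: it is pulled back along the first projection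
  and then applied to a vector that varies over the whole chart of the bundle.\<close>

lemma smooth_on_fibrewise:
  assumes lin: "\<And>y. y \<in> image_of M i \<Longrightarrow> linear (L y)" and sm: "\<And>u. smooth_on (\<lambda>y. L y u) (image_of M i)"
    and k: "smooth_on k S"
  shows "smooth_on (\<lambda>z. L (fst z) (k z :: 'e) :: 'e) S"
  by (rule smooth_on_linear_family[OF open_S _ smooth_on_compose[OF open_S open_image[OF i] sm] k])
    (auto simp: S_def intro!: lin smooth_intros open_S[unfolded S_def])

lemmas smooth_on_gram = smooth_on_fibrewise[OF linear_gram[OF i] smooth_gram[OF i]]
  and smooth_on_inv_gram = smooth_on_fibrewise[OF linear_inv_gram[OF i] smooth_inv_gram[OF i]]
  and smooth_on_endo = smooth_on_fibrewise[where L="endo_coords i", OF linear_endo_coords[OF i]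
    smooth_endo[OF i, folded endo_coords_def]]

lemma smooth_on_horizontal: "smooth_on k S \<Longrightarrow> smooth_on (\<lambda>z. horizontal_part M D i (fst z) (snd z) (k z)) S"
  by (rule smooth_horizontal_part[OF i open_S]) (auto simp: S_def intro!: smooth_intros open_S[unfolded S_def])

lemma smooth_on_vertical_coords: "smooth_on (\<lambda>z. vertical_coords i z w) S"
  unfolding vertical_coords_def
  by (intro smooth_on_inv_gram smooth_intros smooth_on_horizontal open_S)

lemma smooth_tilde_J:
  "smooth_on (\<lambda>z. tilde_J M g D J p q (param (cotangent_bundle M) i z)
    (coord_vector (cotangent_bundle M) i (param (cotangent_bundle M) i z) w) i) (image_of (cotangent_bundle M) i)"
  unfolding image_cotangent[OF i] S_def[symmetric]
proof (rule smooth_on_cong[OF open_S])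
  fix z assume "z \<in> S"
  then show "(let u = endo_coords i (fst z) (fst w) + (- endo_coords i (fst z) (endo_coords i (fst z) (vertical_coords i z w))
          + p *\<^sub>R endo_coords i (fst z) (vertical_coords i z w) + q *\<^sub>R vertical_coords i z w)
     in (u, horizontal_part M D i (fst z) (snd z) u + gram i (fst z) (fst w
          - endo_coords i (fst z) (vertical_coords i z w) + p *\<^sub>R vertical_coords i z w))) =
    tilde_J M g D J p q (param (cotangent_bundle M) i z)
      (coord_vector (cotangent_bundle M) i (param (cotangent_bundle M) i z) w) i"
    unfolding S_def by (rule tilde_J_coords[OF i, symmetric])
qed (unfold Let_def, intro smooth_intros smooth_on_horizontal smooth_on_gram smooth_on_endo
    smooth_on_vertical_coords open_S)

lemma smooth_tilde_g:
  "smooth_on (\<lambda>z. tilde_g M g D J p q (param (cotangent_bundle M) i z)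
    (coord_vector (cotangent_bundle M) i (param (cotangent_bundle M) i z) w)
    (coord_vector (cotangent_bundle M) i (param (cotangent_bundle M) i z) w')) (image_of (cotangent_bundle M) i)"
  unfolding image_cotangent[OF i] S_def[symmetric]
proof (rule smooth_on_cong[OF open_S])
  fix z assume "z \<in> S"
  then show "gram i (fst z) (fst w) \<bullet> fst w'
      + (p\<^sup>2 + 4 * q) / 4 * (gram i (fst z) (vertical_coords i z w) \<bullet> vertical_coords i z w')
      + p / 4 * (gram i (fst z) (vertical_coords i z w) \<bullet> fst w' + gram i (fst z) (fst w) \<bullet> vertical_coords i z w')
      - 1 / 2 * (gram i (fst z) (vertical_coords i z w) \<bullet> endo_coords i (fst z) (fst w')
          + gram i (fst z) (fst w) \<bullet> endo_coords i (fst z) (vertical_coords i z w')) =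
    tilde_g M g D J p q (param (cotangent_bundle M) i z)
      (coord_vector (cotangent_bundle M) i (param (cotangent_bundle M) i z) w)
      (coord_vector (cotangent_bundle M) i (param (cotangent_bundle M) i z) w')"
    unfolding S_def by (rule tilde_g_coords[OF i, symmetric])
qed (intro smooth_intros smooth_on_gram smooth_on_endo smooth_on_vertical_coords open_S)

end

lemma metallic_cotangent_bundle:
  "metallic_pseudo_riemannian_manifold (cotangent_bundle M) (tilde_J M g D J p q) (tilde_g M g D J p q)"
  unfolding metallic_pseudo_riemannian_manifold_def
proof (intro conjI)
  show "smooth_manifold (cotangent_bundle M)"
    by (simp add: smooth_manifold_iff smooth_mfd_cotangent)
  show "pseudo_riemannian_metric (cotangent_bundle M) (tilde_g M g D J p q)"
    unfolding pseudo_riemannian_metric_def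
    by (auto simp: indices_cotangent intro: tilde_g_linear_on tilde_g_commute tilde_g_nondegenerate smooth_tilde_g)
  show "endomorphism_field (cotangent_bundle M) (tilde_J M g D J p q)"
    unfolding endomorphism_field_def
    by (auto simp: indices_cotangent intro: tilde_J_linear_on tilde_J_tangent smooth_tilde_J)
  show "metric_symmetric (cotangent_bundle M) (tilde_g M g D J p q) (tilde_J M g D J p q)"
    unfolding metric_symmetric_def by (blast intro: tilde_g_symmetric)
  show "\<exists>p' q'. \<forall>x\<in>points (cotangent_bundle M). \<forall>v\<in>tangent_space (cotangent_bundle M) x.
      tilde_J M g D J p q x (tilde_J M g D J p q x v) = p' *\<^sub>R tilde_J M g D J p q x v + q' *\<^sub>R v"
    by (intro exI[of _ p] exI[of _ q] ballI tilde_J_metallic)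
qed

end

theorem proposition7p3:
  fixes M :: "('i, 'm, 'e::euclidean_space) manifold"
    and g :: "'m \<Rightarrow> ('i \<Rightarrow> 'e) \<Rightarrow> ('i \<Rightarrow> 'e) \<Rightarrow> real"
    and D :: "('m \<Rightarrow> 'i \<Rightarrow> 'e) \<Rightarrow> ('m \<Rightarrow> 'i \<Rightarrow> 'e) \<Rightarrow> 'm \<Rightarrow> 'i \<Rightarrow> 'e"
    and J :: "'m \<Rightarrow> ('i \<Rightarrow> 'e) \<Rightarrow> 'i \<Rightarrow> 'e"
    and p q :: real
  assumes "smooth_manifold M"
    and "pseudo_riemannian_metric M g"
    and "linear_connection M D"
    and "endomorphism_field M J"
    and "metric_symmetric M g J"
    and "is_metric_check_g M g J p q"
  shows "metallic_pseudo_riemannian_manifold (cotangent_bundle M)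
           (tilde_J M g D J p q) (tilde_g M g D J p q)"
proof -
  interpret smooth_mfd M using assms(1) by (simp add: smooth_manifold_iff)
  interpret lifted_mfd M D g J p q by unfold_locales (rule assms)+
  show ?thesis by (rule metallic_cotangent_bundle)
qed

end
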